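(* Let $(\Gamma,\Lambda)$ be a valued quiver and let $M$ be a preprojective finite dimensional $k(\Gamma,\Lambda)$-module. Sequences in $\mathfrak S$ are considered up to the equivalence $\sim$. (a) There exists a unique up to equivalence $\sim$ shortest sequence $S_M\in\mathfrak S$ annihilating $M$. (b) If $M\cong N_1\oplus\dots\oplus N_s$, then each $N_i$ is preprojective and $S_M=S_{N_1}\vee\dots\vee S_{N_s}$. In particular, for all integers $m>0$, $S_{M^m}=S_M$, where $M^m$ is the direct sum of $m$ copies of $M$. (c) If $M\cong M_1^{m_1}\oplus\dots\oplus M_t^{m_t}$ where the $M_i$ are pairwise nonisomorphic indecomposable $k(\Gamma,\Lambda)$-modules and $m_i>0$ for all $i$, then $S_M=S_{M_1}\vee\dots\vee S_{M_t}$. (d) If $M$ is indecomposable and $N$ is an indecomposable preprojective finite dimensional $k(\Gamma,\Lambda)$-module, then $S_N\sim S_M$ if and only if $N\cong M$.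
   Context: Setting. $\Gamma=(\Gamma_0,\Gamma_1)$ is a finite graph with $|\Gamma_0|>1$ whose edges are two-element subsets of $\Gamma_0$, with a fixed valuation $\mathbf b$: nonnegative integers $b_{ij}$ ($i,j\in\Gamma_0$) with $b_{ii}=0$ for which there are positive integers $d_i$ with $d_ib_{ij}=d_jb_{ji}$ for all $i,j$; $\{i,j\}$ is an edge iff $b_{ij}\neq0$. $\Gamma$ is connected. An orientation $\Lambda$ turns each edge into an arrow by choosing its starting point and endpoint; all orientations considered are such that there are no oriented cycles. A modulation is fixed: division rings $\mathbf k_i$ ($i\in\Gamma_0$), and for each edge $\{i,j\}$ a $\mathbf k_i$-$\mathbf k_j$-bimodule ${}_iB_j$ and a $\mathbf k_j$-$\mathbf k_i$-bimodule ${}_jB_i$ with $\mathbf k_j$-$\mathbf k_i$-bimodule isomorphisms ${}_jB_i\cong\mathrm{Hom}_{\mathbf k_i}({}_iB_j,\mathbf k_i)\cong\mathrm{Hom}_{\mathbf k_j}({}_iB_j,\mathbf k_j)$ and $\dim_{\mathbf k_i}({}_iB_j)=b_{ij}$. The $\mathbf k_i$ are finite dimensional over a common central subfield $k$ acting centrally on all ${}_iB_j$. $(\Gamma,\Lambda)$ denotes the resulting valued quiver. Representations. A representation $(V,f)$ of $(\Gamma,\Lambda)$ consists of finite dimensional left $\mathbf k_i$-spaces $V_i$ and $\mathbf k_j$-linear maps $f_a:{}_jB_i\otimes_{\mathbf k_i}V_i\to V_j$ for all arrows $a:i\to j$; morphisms are the natural ones. With $\mathbf k=\prod_i\mathbf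 k_i$ and $B=\bigoplus_{i\to j}{}_jB_i$ (sum over arrows), $k(\Gamma,\Lambda)$ is the tensor ring of the $\mathbf k$-$\mathbf k$-bimodule $B$, a finite dimensional $k$-algebra; finite dimensional left $k(\Gamma,\Lambda)$-modules are identified with representations of $(\Gamma,\Lambda)$. Reflection functors. For a vertex $x$, $\sigma_x\Lambda$ is obtained from $\Lambda$ by reversing all arrows incident with $x$. If $x$ is a sink (no arrow starts at $x$) with arrows $a_i:y_i\to x$, $i=1,\dots,l$, ending at it, $F_x^+$ sends a representation $(V,f)$ of $(\Gamma,\Lambda)$ to the representation $(W,g)$ of $(\Gamma,\sigma_x\Lambda)$ with $W_y=V_y$ for $y\ne x$; $W_x=\mathrm{Ker}\,h$ where $h:\bigoplus_i{}_xB_{y_i}\otimes_{\mathbf k_{y_i}}V_{y_i}\to V_x$ is induced by the $f_{a_i}$; $g_b=f_b$ for arrows $b$ not starting at $x$; and for the reversed arrow $x\to y_i$ the map ${}_{y_i}B_x\otimes_{\mathbf k_x}W_x\to W_{y_i}$ corresponds to the component $W_x\to{}_xB_{y_i}\otimes W_{y_i}$ of the inclusion under the natural isomorphism $\mathrm{Hom}_{\mathbf k_x}(W_x,{}_xB_{y_i}\otimes W_{y_i})\cong\mathrm{Hom}_{\mathbf k_{y_i}}({}_{y_i}B_x\otimes W_x,W_{y_i})$; $F_x^+$ is defined on morphisms in the natural way. Admissible sequences. A sequence $S=x_1,\dots,x_s$ ($s\ge0$) of vertices is (+)-admissible on $(\Gamma,\Lambda)$ if it is empty or $x_1$ is a sink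 for $\Lambda$, $x_2$ is a sink for $\sigma_{x_1}\Lambda$, and so on. $\mathfrak S$ is the set of (+)-admissible sequences on $(\Gamma,\Lambda)$. Put $\Lambda^S=\sigma_{x_s}\cdots\sigma_{x_1}\Lambda$ and $F(S)=F_{x_s}^+\cdots F_{x_1}^+$ (the identity if $S=\emptyset$). $\mathrm{Supp}\,S$ is the set of vertices occurring in $S$. $\sim$ is the equivalence relation on $\mathfrak S$ generated by interchanging two consecutive vertices $x_i,x_{i+1}$ not connected by an edge. For $S,T\in\mathfrak S$, $S$ is a subsequence of $T$, written $S\preccurlyeq T$, if $T\sim SU$ (concatenation) for some (+)-admissible sequence $U$ on $(\Gamma,\Lambda^S)$; it is proper if $S\not\sim T$. $\preccurlyeq$ induces a partial order on the set of equivalence classes, which is a lattice; $S\vee T$ denotes the least upper bound. Equality of sequences obtained with $\vee$ means equality of equivalence classes. $S$ annihilates $M$ if $F(S)M=0$; it is a shortest sequence annihilating $M$ if in addition no proper subsequence of $S$ annihilates $M$. $M$ is preprojective if some $S\in\mathfrak S$ annihilates it. *)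

theory Defs
  imports "HOL-Algebra.Algebra" "HOL-Algebra.Free_Abelian_Groups"
begin

section \<open>Modules over noncommutative rings\<close>

text \<open>
  The locale \<^locale>\<open>module\<close> of the library requires a commutative ring of scalars.  We keep its
  record type (with the fields for multiplication and unit unused) and its axioms, but drop
  commutativity.
\<close>

locale left_module = R?: ring R + M?: abelian_group M
  for R :: "('k, 'm) ring_scheme" (structure) and M :: "('k, 'v, 'n) module_scheme" (structure) +
  assumes smult_closed:
      "\<lbrakk>a \<in> carrier R; x \<in> carrier M\<rbrakk> \<Longrightarrow> a \<odot>\<^bsub>M\<^esub> x \<in> carrier M"
    and smult_l_distr:
      "\<lbrakk>a \<in> carrier R; b \<in> carrier R; x \<in> carrier M\<rbrakk>
        \<Longrightarrow> (a \<oplus>\<^bsub>R\<^esub> b) \<odot>\<^bsub>M\<^esub> x = a \<odot>\<^bsub>M\<^esub> x \<oplus>\<^bsub>M\<^esub> b \<odot>\<^bsub>M\<^esub> x"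
    and smult_r_distr:
      "\<lbrakk>a \<in> carrier R; x \<in> carrier M; y \<in> carrier M\<rbrakk>
        \<Longrightarrow> a \<odot>\<^bsub>M\<^esub> (x \<oplus>\<^bsub>M\<^esub> y) = a \<odot>\<^bsub>M\<^esub> x \<oplus>\<^bsub>M\<^esub> a \<odot>\<^bsub>M\<^esub> y"
    and smult_assoc1:
      "\<lbrakk>a \<in> carrier R; b \<in> carrier R; x \<in> carrier M\<rbrakk>
        \<Longrightarrow> (a \<otimes>\<^bsub>R\<^esub> b) \<odot>\<^bsub>M\<^esub> x = a \<odot>\<^bsub>M\<^esub> (b \<odot>\<^bsub>M\<^esub> x)"
    and smult_one:
      "x \<in> carrier M \<Longrightarrow> \<one>\<^bsub>R\<^esub> \<odot>\<^bsub>M\<^esub> x = x"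

record ('k, 'b) bimodule = "('k, 'b) module" +
  rsmult :: "'b \<Rightarrow> 'k \<Rightarrow> 'b"

text \<open>\<open>bimodule R S B\<close>: the ring \<open>R\<close> acts on the left, \<open>S\<close> on the right.\<close>

locale bimodule = left_module R B + S?: ring S
  for R :: "('k, 'm) ring_scheme" (structure) and S :: "('k, 'n) ring_scheme" (structure)
    and B :: "('k, 'b) bimodule" (structure) +
  assumes rsmult_closed:
      "\<lbrakk>x \<in> carrier B; s \<in> carrier S\<rbrakk> \<Longrightarrow> rsmult B x s \<in> carrier B"
    and rsmult_l_distr:
      "\<lbrakk>x \<in> carrier B; y \<in> carrier B; s \<in> carrier S\<rbrakk>
        \<Longrightarrow> rsmult B (x \<oplus>\<^bsub>B\<^esub> y) s = rsmult B x s \<oplus>\<^bsub>B\<^esub> rsmult B y s"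
    and rsmult_r_distr:
      "\<lbrakk>x \<in> carrier B; s \<in> carrier S; t \<in> carrier S\<rbrakk>
        \<Longrightarrow> rsmult B x (s \<oplus>\<^bsub>S\<^esub> t) = rsmult B x s \<oplus>\<^bsub>B\<^esub> rsmult B x t"
    and rsmult_assoc:
      "\<lbrakk>x \<in> carrier B; s \<in> carrier S; t \<in> carrier S\<rbrakk>
        \<Longrightarrow> rsmult B x (s \<otimes>\<^bsub>S\<^esub> t) = rsmult B (rsmult B x s) t"
    and rsmult_one:
      "x \<in> carrier B \<Longrightarrow> rsmult B x \<one>\<^bsub>S\<^esub> = x"
    and smult_rsmult:
      "\<lbrakk>r \<in> carrier R; x \<in> carrier B; s \<in> carrier S\<rbrakk>
        \<Longrightarrow> rsmult B (r \<odot>\<^bsub>B\<^esub> x) s = r \<odot>\<^bsub>B\<^esub> rsmult B x s"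

locale skew_field = ring R for R (structure) +
  assumes one_not_zero: "\<one>\<^bsub>R\<^esub> \<noteq> \<zero>\<^bsub>R\<^esub>"
    and Units_eq: "Units R = carrier R - {\<zero>\<^bsub>R\<^esub>}"

definition left_span :: "('k, 'm) ring_scheme \<Rightarrow> ('k, 'v, 'n) module_scheme \<Rightarrow> 'v set \<Rightarrow> 'v set" where
  "left_span R M A = {finsum M (\<lambda>a. c a \<odot>\<^bsub>M\<^esub> a) A | c. c \<in> A \<rightarrow> carrier R}"

definition fin_dim :: "('k, 'm) ring_scheme \<Rightarrow> ('k, 'v, 'n) module_scheme \<Rightarrow> bool" where
  "fin_dim R M \<longleftrightarrow> (\<exists>A. finite A \<and> A \<subseteq> carrier M \<and> left_span R M A = carrier M)"

definition left_indep :: "('k, 'm) ring_scheme \<Rightarrow> ('k, 'v, 'n) module_scheme \<Rightarrow> 'v set \<Rightarrow> bool" where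
  "left_indep R M A \<longleftrightarrow>
    (\<forall>c \<in> A \<rightarrow> carrier R. finsum M (\<lambda>a. c a \<odot>\<^bsub>M\<^esub> a) A = \<zero>\<^bsub>M\<^esub> \<longrightarrow> (\<forall>a\<in>A. c a = \<zero>\<^bsub>R\<^esub>))"

definition has_dim :: "('k, 'm) ring_scheme \<Rightarrow> ('k, 'v, 'n) module_scheme \<Rightarrow> nat \<Rightarrow> bool" where
  "has_dim R M n \<longleftrightarrow>
    (\<exists>A. finite A \<and> A \<subseteq> carrier M \<and> left_span R M A = carrier M \<and> left_indep R M A \<and> card A = n)"

definition left_linear ::
    "('k, 'm) ring_scheme \<Rightarrow> ('k, 'v, 'n) module_scheme \<Rightarrow> ('k, 'w, 'o) module_scheme \<Rightarrow> ('v \<Rightarrow> 'w) set" where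
  "left_linear R M N = {\<phi> \<in> carrier M \<rightarrow> carrier N.
     (\<forall>x\<in>carrier M. \<forall>y\<in>carrier M. \<phi> (x \<oplus>\<^bsub>M\<^esub> y) = \<phi> x \<oplus>\<^bsub>N\<^esub> \<phi> y) \<and>
     (\<forall>r\<in>carrier R. \<forall>x\<in>carrier M. \<phi> (r \<odot>\<^bsub>M\<^esub> x) = r \<odot>\<^bsub>N\<^esub> \<phi> x)}"

definition bimodule_iso ::
    "('k, 'm) ring_scheme \<Rightarrow> ('k, 'n) ring_scheme \<Rightarrow> ('k, 'b) bimodule \<Rightarrow> ('k, 'c) bimodule \<Rightarrow> ('b \<Rightarrow> 'c) \<Rightarrow> bool" where
  "bimodule_iso R S B C \<phi> \<longleftrightarrow>
     bij_betw \<phi> (carrier B) (carrier C) \<and> \<phi> \<in> left_linear R B C \<and>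
     (\<forall>x\<in>carrier B. \<forall>s\<in>carrier S. \<phi> (rsmult B x s) = rsmult C (\<phi> x) s)"

text \<open>
  For an \<open>R\<close>-\<open>S\<close>-bimodule \<open>B\<close>, the \<open>S\<close>-\<open>R\<close>-bimodules \<open>Hom\<^sub>R(B, R)\<close> of left \<open>R\<close>-linear maps and
  \<open>Hom\<^sub>S(B, S)\<close> of right \<open>S\<close>-linear maps.
\<close>

definition left_dual ::
    "'k ring \<Rightarrow> 'k ring \<Rightarrow> ('k, 'b) bimodule \<Rightarrow> ('k, 'b \<Rightarrow> 'k) bimodule" where
  "left_dual R S B = \<lparr>
     carrier = {\<phi> \<in> carrier B \<rightarrow>\<^sub>E carrier R.
       (\<forall>x\<in>carrier B. \<forall>y\<in>carrier B. \<phi> (x \<oplus>\<^bsub>B\<^esub> y) = \<phi> x \<oplus>\<^bsub>R\<^esub> \<phi> y) \<and>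
       (\<forall>r\<in>carrier R. \<forall>x\<in>carrier B. \<phi> (r \<odot>\<^bsub>B\<^esub> x) = r \<otimes>\<^bsub>R\<^esub> \<phi> x)},
     monoid.mult = undefined, one = undefined,
     ring.zero = (\<lambda>x\<in>carrier B. \<zero>\<^bsub>R\<^esub>),
     add = (\<lambda>\<phi> \<psi>. \<lambda>x\<in>carrier B. \<phi> x \<oplus>\<^bsub>R\<^esub> \<psi> x),
     smult = (\<lambda>s \<phi>. \<lambda>x\<in>carrier B. \<phi> (rsmult B x s)),
     rsmult = (\<lambda>\<phi> r. \<lambda>x\<in>carrier B. \<phi> x \<otimes>\<^bsub>R\<^esub> r)\<rparr>"

definition right_dual ::
    "'k ring \<Rightarrow> 'k ring \<Rightarrow> ('k, 'b) bimodule \<Rightarrow> ('k, 'b \<Rightarrow> 'k) bimodule" where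
  "right_dual R S B = \<lparr>
     carrier = {\<phi> \<in> carrier B \<rightarrow>\<^sub>E carrier S.
       (\<forall>x\<in>carrier B. \<forall>y\<in>carrier B. \<phi> (x \<oplus>\<^bsub>B\<^esub> y) = \<phi> x \<oplus>\<^bsub>S\<^esub> \<phi> y) \<and>
       (\<forall>x\<in>carrier B. \<forall>s\<in>carrier S. \<phi> (rsmult B x s) = \<phi> x \<otimes>\<^bsub>S\<^esub> s)},
     monoid.mult = undefined, one = undefined,
     ring.zero = (\<lambda>x\<in>carrier B. \<zero>\<^bsub>S\<^esub>),
     add = (\<lambda>\<phi> \<psi>. \<lambda>x\<in>carrier B. \<phi> x \<oplus>\<^bsub>S\<^esub> \<psi> x),
     smult = (\<lambda>s \<phi>. \<lambda>x\<in>carrier B. s \<otimes>\<^bsub>S\<^esub> \<phi> x),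
     rsmult = (\<lambda>\<phi> r. \<lambda>x\<in>carrier B. \<phi> (r \<odot>\<^bsub>B\<^esub> x))\<rparr>"

definition dsum :: "'j set \<Rightarrow> ('j \<Rightarrow> ('k, 'v) module) \<Rightarrow> ('k, 'j \<Rightarrow> 'v) module" where
  "dsum J M = \<lparr>
     carrier = (\<Pi>\<^sub>E j\<in>J. carrier (M j)),
     monoid.mult = undefined, one = undefined,
     ring.zero = (\<lambda>j\<in>J. \<zero>\<^bsub>M j\<^esub>),
     add = (\<lambda>u v. \<lambda>j\<in>J. u j \<oplus>\<^bsub>M j\<^esub> v j),
     smult = (\<lambda>r u. \<lambda>j\<in>J. r \<odot>\<^bsub>M j\<^esub> u j)\<rparr>"

text \<open>Transport of a module structure along a map that is injective on the carrier.\<close>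

definition module_image :: "('v \<Rightarrow> 'w) \<Rightarrow> ('k, 'v) module \<Rightarrow> ('k, 'w) module" where
  "module_image e M = (let d = inv_into (carrier M) e in \<lparr>
     carrier = e ` carrier M,
     monoid.mult = undefined, one = undefined,
     ring.zero = e \<zero>\<^bsub>M\<^esub>,
     add = (\<lambda>u v. e (d u \<oplus>\<^bsub>M\<^esub> d v)),
     smult = (\<lambda>r u. e (r \<odot>\<^bsub>M\<^esub> d u))\<rparr>)"


section \<open>Tensor products\<close>

text \<open>
  \<open>B \<otimes>\<^sub>R V\<close> for a bimodule \<open>B\<close> (with \<open>R\<close> acting on the right) and a left \<open>R\<close>-module \<open>V\<close>: the free
  abelian group on \<open>B \<times> V\<close> modulo the subgroup generated by the usual relations.  Its elements are
  cosets.
\<close>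

type_synonym ('b, 'v) tens = "('b \<times> 'v \<Rightarrow>\<^sub>0 int) set"

definition tensor_free :: "('k, 'b) bimodule \<Rightarrow> ('k, 'v) module \<Rightarrow> ('b \<times> 'v \<Rightarrow>\<^sub>0 int) monoid" where
  "tensor_free B V = free_Abelian_group (carrier B \<times> carrier V)"

definition tensor_rels :: "'k ring \<Rightarrow> ('k, 'b) bimodule \<Rightarrow> ('k, 'v) module \<Rightarrow> ('b, 'v) tens" where
  "tensor_rels R B V = generate (tensor_free B V)
     ({frag_of (x \<oplus>\<^bsub>B\<^esub> y, v) - frag_of (x, v) - frag_of (y, v) | x y v.
         x \<in> carrier B \<and> y \<in> carrier B \<and> v \<in> carrier V} \<union>
      {frag_of (x, v \<oplus>\<^bsub>V\<^esub> w) - frag_of (x, v) - frag_of (x, w) | x v w.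
         x \<in> carrier B \<and> v \<in> carrier V \<and> w \<in> carrier V} \<union>
      {frag_of (rsmult B x r, v) - frag_of (x, r \<odot>\<^bsub>V\<^esub> v) | x r v.
         x \<in> carrier B \<and> r \<in> carrier R \<and> v \<in> carrier V})"

definition tensor_class ::
    "'k ring \<Rightarrow> ('k, 'b) bimodule \<Rightarrow> ('k, 'v) module \<Rightarrow> ('b \<times> 'v \<Rightarrow>\<^sub>0 int) \<Rightarrow> ('b, 'v) tens" where
  "tensor_class R B V c = tensor_rels R B V #>\<^bsub>tensor_free B V\<^esub> c"

definition tensor :: "'k ring \<Rightarrow> ('k, 'b) bimodule \<Rightarrow> ('k, 'v) module \<Rightarrow> ('k, ('b, 'v) tens) module" where
  "tensor R B V = (let Q = tensor_free B V Mod tensor_rels R B V in \<lparr>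
     carrier = carrier Q,
     monoid.mult = undefined, one = undefined,
     ring.zero = \<one>\<^bsub>Q\<^esub>,
     add = (\<lambda>s t. s \<otimes>\<^bsub>Q\<^esub> t),
     smult = (\<lambda>a t. tensor_class R B V
       (frag_extend (\<lambda>(x, v). frag_of (a \<odot>\<^bsub>B\<^esub> x, v)) (SOME c. c \<in> t)))\<rparr>)"

text \<open>
  The additive map \<open>B \<otimes>\<^sub>R V \<rightarrow> M\<close> with \<open>x \<otimes> v \<mapsto> \<beta> (x, v)\<close>, for a biadditive and \<open>R\<close>-balanced \<open>\<beta>\<close>
  (so that the choice of the representative \<open>c\<close> is immaterial).
\<close>

definition tensor_lift :: "('w, 'm) ring_scheme \<Rightarrow> ('b \<times> 'v \<Rightarrow> 'w) \<Rightarrow> ('b, 'v) tens \<Rightarrow> 'w" where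
  "tensor_lift M \<beta> t = (let c = (SOME c. c \<in> t) in
     finsum M (\<lambda>p. [Poly_Mapping.lookup c p] \<cdot>\<^bsub>M\<^esub> \<beta> p) (Poly_Mapping.keys c))"

text \<open>The map \<open>1 \<otimes> \<phi>\<close> into \<open>B \<otimes>\<^sub>R W\<close>.\<close>

definition tensor_map ::
    "'k ring \<Rightarrow> ('k, 'b) bimodule \<Rightarrow> ('k, 'w) module \<Rightarrow> ('v \<Rightarrow> 'w) \<Rightarrow> ('b, 'v) tens \<Rightarrow> ('b, 'w) tens" where
  "tensor_map R B W \<phi> = tensor_lift (tensor R B W) (\<lambda>(x, v). tensor_class R B W (frag_of (x, \<phi> v)))"


section \<open>Valued graphs with a modulation\<close>

text \<open>
  The graph \<open>\<Gamma>\<close> has as vertex set the whole (finite) type \<open>'i\<close>, and \<open>{i, j}\<close> is an edge iff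
  \<open>val G i j \<noteq> 0\<close>.  \<open>bimod G i j\<close> is \<open>\<^sub>iB\<^sub>j\<close>; \<open>ldual_iso G i j\<close> and \<open>rdual_iso G i j\<close> are the chosen
  isomorphisms from \<open>\<^sub>jB\<^sub>i\<close> to the dual of \<open>\<^sub>iB\<^sub>j\<close> with respect to \<open>\<^bold>k\<^sub>i\<close> and \<open>\<^bold>k\<^sub>j\<close>, respectively.
  Data belonging to a pair that is not an edge are irrelevant.  The common central subfield is
  given by embeddings of a field \<open>base G\<close> into the \<open>\<^bold>k\<^sub>i\<close>.
\<close>

record ('i, 'k, 'b, 'c) modulation =
  val :: "'i \<Rightarrow> 'i \<Rightarrow> nat"
  dring :: "'i \<Rightarrow> 'k ring"
  bimod :: "'i \<Rightarrow> 'i \<Rightarrow> ('k, 'b) bimodule"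
  ldual_iso :: "'i \<Rightarrow> 'i \<Rightarrow> 'b \<Rightarrow> 'b \<Rightarrow> 'k"
  rdual_iso :: "'i \<Rightarrow> 'i \<Rightarrow> 'b \<Rightarrow> 'b \<Rightarrow> 'k"
  base :: "'c ring"
  base_emb :: "'i \<Rightarrow> 'c \<Rightarrow> 'k"

definition base_space :: "('i, 'k, 'b, 'c) modulation \<Rightarrow> 'i \<Rightarrow> ('c, 'k) module" where
  "base_space G i = \<lparr>
     carrier = carrier (dring G i), monoid.mult = monoid.mult (dring G i), one = one (dring G i),
     ring.zero = ring.zero (dring G i), add = add (dring G i),
     smult = (\<lambda>c x. base_emb G i c \<otimes>\<^bsub>dring G i\<^esub> x)\<rparr>"

locale modulated_graph =
  fixes G :: "('i::finite, 'k, 'b, 'c) modulation"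
  assumes more_than_one_vertex: "card (UNIV :: 'i set) > 1"
    and val_diag: "val G i i = 0"
    and symmetrizable: "\<exists>d :: 'i \<Rightarrow> nat. (\<forall>i. d i > 0) \<and> (\<forall>i j. d i * val G i j = d j * val G j i)"
    and connected: "(i, j) \<in> {(i, j). val G i j \<noteq> 0}\<^sup>*"
    and dring: "skew_field (dring G i)"
    and bimod: "val G i j \<noteq> 0 \<Longrightarrow> bimodule (dring G i) (dring G j) (bimod G i j)"
    and bimod_dim: "val G i j \<noteq> 0 \<Longrightarrow> has_dim (dring G i) (bimod G i j) (val G i j)"
    and ldual_iso: "val G i j \<noteq> 0 \<Longrightarrow>
      bimodule_iso (dring G j) (dring G i) (bimod G j i)
        (left_dual (dring G i) (dring G j) (bimod G i j)) (ldual_iso G i j)"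
    and rdual_iso: "val G i j \<noteq> 0 \<Longrightarrow>
      bimodule_iso (dring G j) (dring G i) (bimod G j i)
        (right_dual (dring G i) (dring G j) (bimod G i j)) (rdual_iso G i j)"
    and base: "field (base G)"
    and base_emb: "base_emb G i \<in> ring_hom (base G) (dring G i)"
    and base_central: "\<lbrakk>c \<in> carrier (base G); a \<in> carrier (dring G i)\<rbrakk> \<Longrightarrow>
      base_emb G i c \<otimes>\<^bsub>dring G i\<^esub> a = a \<otimes>\<^bsub>dring G i\<^esub> base_emb G i c"
    and base_fin_dim: "fin_dim (base G) (base_space G i)"
    and base_acts_centrally: "\<lbrakk>val G i j \<noteq> 0; c \<in> carrier (base G); x \<in> carrier (bimod G i j)\<rbrakk> \<Longrightarrow>
      base_emb G i c \<odot>\<^bsub>bimod G i j\<^esub> x = rsmult (bimod G i j) x (base_emb G j c)"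

text \<open>An orientation is given by its set of arrows; \<open>(i, j)\<close> stands for the arrow \<open>i \<rightarrow> j\<close>.\<close>

definition orientation :: "('i, 'k, 'b, 'c) modulation \<Rightarrow> ('i \<times> 'i) set \<Rightarrow> bool" where
  "orientation G \<Lambda> \<longleftrightarrow>
     (\<forall>i j. val G i j \<noteq> 0 \<longleftrightarrow> (i, j) \<in> \<Lambda> \<or> (j, i) \<in> \<Lambda>) \<and>
     (\<forall>i j. (i, j) \<in> \<Lambda> \<longrightarrow> (j, i) \<notin> \<Lambda>)"

definition valued_quiver :: "('i::finite, 'k, 'b, 'c) modulation \<Rightarrow> ('i \<times> 'i) set \<Rightarrow> bool" where
  "valued_quiver G \<Lambda> \<longleftrightarrow> modulated_graph G \<and> orientation G \<Lambda> \<and> acyclic \<Lambda>"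


section \<open>Representations\<close>

record ('i, 'k, 'b, 'v) rep =
  space :: "'i \<Rightarrow> ('k, 'v) module"
  arrow_map :: "'i \<Rightarrow> 'i \<Rightarrow> ('b, 'v) tens \<Rightarrow> 'v"

text \<open>\<open>ten G i j V\<close> is \<open>\<^sub>iB\<^sub>j \<otimes> V\<close>, a left \<open>\<^bold>k\<^sub>i\<close>-space.\<close>

abbreviation ten ::
    "('i, 'k, 'b, 'c) modulation \<Rightarrow> 'i \<Rightarrow> 'i \<Rightarrow> ('k, 'v) module \<Rightarrow> ('k, ('b, 'v) tens) module" where
  "ten G i j V \<equiv> tensor (dring G j) (bimod G i j) V"

abbreviation ten_map ::
    "('i, 'k, 'b, 'c) modulation \<Rightarrow> 'i \<Rightarrow> 'i \<Rightarrow> ('k, 'w) module \<Rightarrow> ('v \<Rightarrow> 'w) \<Rightarrow> ('b, 'v) tens \<Rightarrow> ('b, 'w) tens" where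
  "ten_map G i j W \<phi> \<equiv> tensor_map (dring G j) (bimod G i j) W \<phi>"

definition is_rep ::
    "('i, 'k, 'b, 'c) modulation \<Rightarrow> ('i \<times> 'i) set \<Rightarrow> ('i, 'k, 'b, 'v) rep \<Rightarrow> bool" where
  "is_rep G \<Lambda> M \<longleftrightarrow>
     (\<forall>i. left_module (dring G i) (space M i) \<and> fin_dim (dring G i) (space M i)) \<and>
     (\<forall>(i, j)\<in>\<Lambda>. arrow_map M i j \<in> left_linear (dring G j) (ten G j i (space M i)) (space M j))"

definition rep_hom ::
    "('i, 'k, 'b, 'c) modulation \<Rightarrow> ('i \<times> 'i) set \<Rightarrow> ('i, 'k, 'b, 'v) rep \<Rightarrow> ('i, 'k, 'b, 'w) rep
      \<Rightarrow> ('i \<Rightarrow> 'v \<Rightarrow> 'w) set" where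
  "rep_hom G \<Lambda> M N = {\<phi>.
     (\<forall>i. \<phi> i \<in> left_linear (dring G i) (space M i) (space N i)) \<and>
     (\<forall>(i, j)\<in>\<Lambda>. \<forall>t\<in>carrier (ten G j i (space M i)).
        \<phi> j (arrow_map M i j t) = arrow_map N i j (ten_map G j i (space N i) (\<phi> i) t))}"

definition rep_iso ::
    "('i, 'k, 'b, 'c) modulation \<Rightarrow> ('i \<times> 'i) set \<Rightarrow> ('i, 'k, 'b, 'v) rep \<Rightarrow> ('i, 'k, 'b, 'w) rep \<Rightarrow> bool" where
  "rep_iso G \<Lambda> M N \<longleftrightarrow>
     (\<exists>\<phi>\<in>rep_hom G \<Lambda> M N. \<forall>i. bij_betw (\<phi> i) (carrier (space M i)) (carrier (space N i)))"

definition rep_is_zero :: "('i, 'k, 'b, 'v) rep \<Rightarrow> bool" where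
  "rep_is_zero M \<longleftrightarrow> (\<forall>i. carrier (space M i) = {\<zero>\<^bsub>space M i\<^esub>})"

definition rep_dsum ::
    "('i, 'k, 'b, 'c) modulation \<Rightarrow> 'j set \<Rightarrow> ('j \<Rightarrow> ('i, 'k, 'b, 'v) rep) \<Rightarrow> ('i, 'k, 'b, 'j \<Rightarrow> 'v) rep" where
  "rep_dsum G J N = \<lparr>
     space = (\<lambda>i. dsum J (\<lambda>r. space (N r) i)),
     arrow_map = (\<lambda>i j t. \<lambda>r\<in>J.
       arrow_map (N r) i j (ten_map G j i (space (N r) i) (\<lambda>u. u r) t))\<rparr>"

definition rep_pow ::
    "('i, 'k, 'b, 'c) modulation \<Rightarrow> nat \<Rightarrow> ('i, 'k, 'b, 'v) rep \<Rightarrow> ('i, 'k, 'b, nat \<Rightarrow> 'v) rep" where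
  "rep_pow G m M = rep_dsum G {..<m} (\<lambda>_. M)"

text \<open>
  Every direct summand of \<open>M\<close> is isomorphic to a subrepresentation of \<open>M\<close>, so it is enough to let the
  two summands range over representations with the same type of elements as \<open>M\<close>.
\<close>

definition indecomposable ::
    "('i, 'k, 'b, 'c) modulation \<Rightarrow> ('i \<times> 'i) set \<Rightarrow> ('i, 'k, 'b, 'v) rep \<Rightarrow> bool" where
  "indecomposable G \<Lambda> M \<longleftrightarrow> \<not> rep_is_zero M \<and>
     (\<forall>N :: nat \<Rightarrow> ('i, 'k, 'b, 'v) rep.
        is_rep G \<Lambda> (N 0) \<and> is_rep G \<Lambda> (N 1) \<and> rep_iso G \<Lambda> M (rep_dsum G {0, 1} N)
        \<longrightarrow> rep_is_zero (N 0) \<or> rep_is_zero (N 1))"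


section \<open>Reflection functors\<close>

text \<open>
  The space \<open>W\<^sub>x\<close> produced by a reflection consists of families of tensors over the given spaces.  So
  that reflections can be iterated, all representations they act on have their elements in one type
  closed under this construction.  A tensor is stored as a list of pairs \<open>(b, v)\<close> whose sum of
  \<open>b \<otimes> v\<close> it is; since \<open>- (b \<otimes> v) = (- b) \<otimes> v\<close>, every tensor is such a sum.
\<close>

datatype ('i, 'b, 'v) elem =
    Atom 'v
  | Fam "'i \<Rightarrow> ('b \<times> ('i, 'b, 'v) elem) list"

definition encode :: "('i \<Rightarrow> ('b, ('i, 'b, 'v) elem) tens) \<Rightarrow> ('i, 'b, 'v) elem" where
  "encode t = Fam (\<lambda>y. SOME ps. sum_list (map frag_of ps) \<in> t y)"

definition reverse_at :: "'i \<Rightarrow> ('i \<times> 'i) set \<Rightarrow> ('i \<times> 'i) set" where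
  "reverse_at x \<Lambda> = {(i, j). if i = x \<or> j = x then (j, i) \<in> \<Lambda> else (i, j) \<in> \<Lambda>}"

definition sink :: "('i \<times> 'i) set \<Rightarrow> 'i \<Rightarrow> bool" where
  "sink \<Lambda> x \<longleftrightarrow> (\<forall>y. (x, y) \<notin> \<Lambda>)"

text \<open>The kernel of \<open>h : \<Oplus> \<^sub>xB\<^sub>y \<otimes> V\<^sub>y \<rightarrow> V\<^sub>x\<close>, the sum being over the arrows \<open>y \<rightarrow> x\<close>.\<close>

definition reflection_ker ::
    "('i, 'k, 'b, 'c) modulation \<Rightarrow> ('i \<times> 'i) set \<Rightarrow> 'i \<Rightarrow> ('i, 'k, 'b, 'v) rep
      \<Rightarrow> ('k, 'i \<Rightarrow> ('b, 'v) tens) module" where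
  "reflection_ker G \<Lambda> x M = (let
     Y = {y. (y, x) \<in> \<Lambda>};
     D = dsum Y (\<lambda>y. ten G x y (space M y));
     h = (\<lambda>t. finsum (space M x) (\<lambda>y. arrow_map M y x (t y)) Y)
   in D\<lparr>carrier := {t \<in> carrier D. h t = \<zero>\<^bsub>space M x\<^esub>}\<rparr>)"

text \<open>
  The image of \<open>\<theta> : W \<rightarrow> \<^sub>xB\<^sub>y \<otimes> V\<close> under
  \<open>Hom(W, \<^sub>xB\<^sub>y \<otimes> V) \<cong> Hom(\<^sub>yB\<^sub>x \<otimes> W, V)\<close>.  The isomorphism comes from
  \<open>\<^sub>yB\<^sub>x \<cong> Hom(\<^sub>xB\<^sub>y, \<^bold>k\<^sub>y)\<close>, written \<open>c \<mapsto> c\<^sup>*\<close>: the element \<open>c \<otimes> w\<close> is mapped to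
  \<open>(c\<^sup>* \<otimes> 1) (\<theta> w)\<close>, where \<open>(c\<^sup>* \<otimes> 1) (b \<otimes> v) = c\<^sup>*(b) v\<close>.
\<close>

definition adjoint_map ::
    "('i, 'k, 'b, 'c) modulation \<Rightarrow> 'i \<Rightarrow> 'i \<Rightarrow> ('k, 'v) module
      \<Rightarrow> ('w \<Rightarrow> ('b, 'v) tens) \<Rightarrow> ('b, 'w) tens \<Rightarrow> 'v" where
  "adjoint_map G x y V \<theta> = tensor_lift V (\<lambda>(c, w).
     tensor_lift V (\<lambda>(b, v). rdual_iso G x y c b \<odot>\<^bsub>V\<^esub> v) (\<theta> w))"

definition reflect ::
    "('i, 'k, 'b, 'c) modulation \<Rightarrow> ('i \<times> 'i) set \<Rightarrow> 'i
      \<Rightarrow> ('i, 'k, 'b, ('i, 'b, 'v) elem) rep \<Rightarrow> ('i, 'k, 'b, ('i, 'b, 'v) elem) rep" where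
  "reflect G \<Lambda> x M = (let
     Ker = reflection_ker G \<Lambda> x M;
     decode = inv_into (carrier Ker) encode
   in \<lparr>
     space = (\<lambda>y. if y = x then module_image encode Ker else space M y),
     arrow_map = (\<lambda>i j. if i = x then adjoint_map G x j (space M j) (\<lambda>w. decode w j)
                        else arrow_map M i j)\<rparr>)"

fun reflect_seq ::
    "('i, 'k, 'b, 'c) modulation \<Rightarrow> ('i \<times> 'i) set \<Rightarrow> 'i list
      \<Rightarrow> ('i, 'k, 'b, ('i, 'b, 'v) elem) rep \<Rightarrow> ('i, 'k, 'b, ('i, 'b, 'v) elem) rep" where
  "reflect_seq G \<Lambda> [] M = M"
| "reflect_seq G \<Lambda> (x # S) M = reflect_seq G (reverse_at x \<Lambda>) S (reflect G \<Lambda> x M)"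

text \<open>The copy of a representation with elements in the type on which reflections act.\<close>

definition rep_atom ::
    "('i, 'k, 'b, 'c) modulation \<Rightarrow> ('i, 'k, 'b, 'v) rep \<Rightarrow> ('i, 'k, 'b, ('i, 'b, 'v) elem) rep" where
  "rep_atom G M = \<lparr>
     space = (\<lambda>i. module_image Atom (space M i)),
     arrow_map = (\<lambda>i j t. Atom (arrow_map M i j
       (ten_map G j i (space M i) (inv_into (carrier (space M i)) Atom) t)))\<rparr>"


section \<open>Admissible sequences\<close>

fun admissible :: "('i \<times> 'i) set \<Rightarrow> 'i list \<Rightarrow> bool" where
  "admissible \<Lambda> [] \<longleftrightarrow> True"
| "admissible \<Lambda> (x # S) \<longleftrightarrow> sink \<Lambda> x \<and> admissible (reverse_at x \<Lambda>) S"

definition reverse_seq :: "'i list \<Rightarrow> ('i \<times> 'i) set \<Rightarrow> ('i \<times> 'i) set" where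
  "reverse_seq S \<Lambda> = fold reverse_at S \<Lambda>"

definition interchange ::
    "('i, 'k, 'b, 'c) modulation \<Rightarrow> ('i \<times> 'i) set \<Rightarrow> 'i list \<Rightarrow> 'i list \<Rightarrow> bool" where
  "interchange G \<Lambda> S T \<longleftrightarrow> admissible \<Lambda> S \<and> admissible \<Lambda> T \<and>
     (\<exists>us x y vs. val G x y = 0 \<and> S = us @ [x, y] @ vs \<and> T = us @ [y, x] @ vs)"

definition seq_equiv ::
    "('i, 'k, 'b, 'c) modulation \<Rightarrow> ('i \<times> 'i) set \<Rightarrow> 'i list \<Rightarrow> 'i list \<Rightarrow> bool" where
  "seq_equiv G \<Lambda> S T \<longleftrightarrow> admissible \<Lambda> S \<and> admissible \<Lambda> T \<and> equivclp (interchange G \<Lambda>) S T"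

definition seq_le ::
    "('i, 'k, 'b, 'c) modulation \<Rightarrow> ('i \<times> 'i) set \<Rightarrow> 'i list \<Rightarrow> 'i list \<Rightarrow> bool" where
  "seq_le G \<Lambda> S T \<longleftrightarrow> admissible \<Lambda> S \<and> admissible \<Lambda> T \<and>
     (\<exists>U. admissible (reverse_seq S \<Lambda>) U \<and> seq_equiv G \<Lambda> T (S @ U))"

text \<open>
  The order on \<open>\<SS>\<close> modulo \<open>\<sim>\<close>, in the form used by the library for orders whose equality is a given
  equivalence relation.
\<close>

definition seq_order :: "('i, 'k, 'b, 'c) modulation \<Rightarrow> ('i \<times> 'i) set \<Rightarrow> 'i list gorder" where
  "seq_order G \<Lambda> = \<lparr>carrier = {S. admissible \<Lambda> S}, eq = seq_equiv G \<Lambda>, le = seq_le G \<Lambda>\<rparr>"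

text \<open>\<open>S\<close> represents the join of the classes of the members of \<open>\<C>\<close>.\<close>

definition is_join ::
    "('i, 'k, 'b, 'c) modulation \<Rightarrow> ('i \<times> 'i) set \<Rightarrow> 'i list \<Rightarrow> 'i list set \<Rightarrow> bool" where
  "is_join G \<Lambda> S \<C> \<longleftrightarrow> least (seq_order G \<Lambda>) S (Upper (seq_order G \<Lambda>) \<C>)"


section \<open>Preprojective modules\<close>

definition annihilates ::
    "('i, 'k, 'b, 'c) modulation \<Rightarrow> ('i \<times> 'i) set \<Rightarrow> 'i list \<Rightarrow> ('i, 'k, 'b, 'v) rep \<Rightarrow> bool" where
  "annihilates G \<Lambda> S M \<longleftrightarrow> rep_is_zero (reflect_seq G \<Lambda> S (rep_atom G M))"

definition preprojective ::
    "('i, 'k, 'b, 'c) modulation \<Rightarrow> ('i \<times> 'i) set \<Rightarrow> ('i, 'k, 'b, 'v) rep \<Rightarrow> bool" where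
  "preprojective G \<Lambda> M \<longleftrightarrow> (\<exists>S. admissible \<Lambda> S \<and> annihilates G \<Lambda> S M)"

definition shortest_annihilating ::
    "('i, 'k, 'b, 'c) modulation \<Rightarrow> ('i \<times> 'i) set \<Rightarrow> 'i list \<Rightarrow> ('i, 'k, 'b, 'v) rep \<Rightarrow> bool" where
  "shortest_annihilating G \<Lambda> S M \<longleftrightarrow> admissible \<Lambda> S \<and> annihilates G \<Lambda> S M \<and>
     (\<forall>T. seq_le G \<Lambda> T S \<and> \<not> seq_equiv G \<Lambda> T S \<longrightarrow> \<not> annihilates G \<Lambda> T M)"

text \<open>A representative of the class \<open>S\<^sub>M\<close>.\<close>

definition shortest_seq ::
    "('i, 'k, 'b, 'c) modulation \<Rightarrow> ('i \<times> 'i) set \<Rightarrow> ('i, 'k, 'b, 'v) rep \<Rightarrow> 'i list" where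
  "shortest_seq G \<Lambda> M = (SOME S. shortest_annihilating G \<Lambda> S M)"

end

theory Submission
  imports Defs
begin

text \<open>
  The class of an admissible sequence is determined by the number of occurrences of each vertex, and
  \<open>\<preceq>\<close> is the pointwise order of these multiplicities.  Suppose that \<open>S\<close> and \<open>T\<close> annihilate \<open>M\<close>.  If
  they have a vertex in common, then they have a sink in common, which can be moved to the front of
  both; if not, then \<open>M = 0\<close>, because \<open>F(S)\<close> only changes the spaces at the vertices of \<open>S\<close>.  By
  induction the meet of \<open>S\<close> and \<open>T\<close>, with the minimum of the multiplicities, annihilates \<open>M\<close>, which
  gives (a).  Reflections preserve jointly injective families of morphisms, so that a sequence
  annihilates a direct sum iff it annihilates every summand, which gives (b) and (c).

  For (d), let \<open>x\<close> be the first vertex of the common shortest sequence.  If \<open>F\<^sub>x M = 0\<close>, then \<open>M\<close> is the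
  simple representation at \<open>x\<close>.  Otherwise the map \<open>h\<close> into \<open>M\<^sub>x\<close> is surjective, since \<open>M\<close> is
  indecomposable; as \<open>M\<^sub>x\<close> is then the cokernel of the kernel of \<open>h\<close>, the functor \<open>F\<^sub>x\<close> is fully faithful
  on such representations, so that \<open>F\<^sub>x M\<close> is indecomposable again and determines \<open>M\<close>.  The
  adjunction behind the reflections enters through the maps \<open>c\<^sup>* \<otimes> 1\<close>, which separate the elements
  of \<open>\<^sub>xB\<^sub>y \<otimes> V\<close>.
\<close>

section \<open>Admissible sequences\<close>


text \<open>Read through multiplicities, the sequences annihilating \<open>M\<close> form an upward
  closed set that is closed under minima. Its least element is S_M, and intersecting such sets gives
  the joins in (b) and (c). Two obstacles shape the rest. First, the space created by a reflection
  consists of families of cosets. Its elements are detected by evaluating functionals of the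
  bimodules, so that the statements about injectivity become statements about the spaces at the
  neighbouring vertices, where nothing has changed. One lemma on jointly injective families then
  gives invariance under isomorphism, preservation of zero and the behaviour on direct sums. Second,
  \<open>indecomposable\<close> speaks of all decompositions, and a decomposition of a reflection is
  not visibly the reflection of one. The induction therefore carries the condition that every
  idempotent endomorphism is 0 or 1, which a fully faithful functor transports. Fullness also
  supplies the inverse construction: morphisms between reflections are lifted back, in place of a
  functor in the opposite direction.\<close>

lemma reverse_at_sink_iff:
  assumes "sink \<Lambda> x"
  shows "(i, j) \<in> reverse_at x \<Lambda> \<longleftrightarrow> (if i = x then (j, x) \<in> \<Lambda> else j \<noteq> x \<and> (i, j) \<in> \<Lambda>)"
  using assms by (auto simp: reverse_at_def sink_def)

lemma orientation_reverse_at: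
  assumes "orientation G \<Lambda>"
  shows "orientation G (reverse_at x \<Lambda>)"
  using assms by (auto simp: orientation_def reverse_at_def)

text \<open>The reversal turns \<open>x\<close> into a source. No path ends there any more, so a
  path that starts elsewhere never meets \<open>x\<close> and is already a path of
  \<open>\<Lambda>\<close>. A new cycle would be an old one.\<close>

lemma acyclic_reverse_at:
  assumes "acyclic \<Lambda>" "sink \<Lambda> x"
  shows "acyclic (reverse_at x \<Lambda>)"
proof -
  have "b \<noteq> x \<and> (a \<noteq> x \<longrightarrow> (a, b) \<in> \<Lambda>\<^sup>+)" if "(a, b) \<in> (reverse_at x \<Lambda>)\<^sup>+" for a b
    using that
  proof (induction rule: trancl_induct)
    case (base y)
    then show ?case
      using assms by (auto simp: reverse_at_sink_iff sink_def split: if_splits)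
  next
    case (step y z)
    then show ?case
      using assms by (auto simp: reverse_at_sink_iff sink_def split: if_splits)
  qed
  with assms(1) show ?thesis
    unfolding acyclic_def by blast
qed

lemma sinks_not_adjacent:
  assumes "orientation G \<Lambda>" "sink \<Lambda> x" "sink \<Lambda> y"
  shows "val G x y = 0"
  using assms by (auto simp: orientation_def sink_def)

lemma sink_reverse_at:
  assumes "orientation G \<Lambda>" "sink \<Lambda> x" "sink \<Lambda> y" "x \<noteq> y"
  shows "sink (reverse_at x \<Lambda>) y"
  using assms by (auto simp: sink_def reverse_at_def)

lemma reverse_at_commute:
  assumes "sink \<Lambda> x" "sink \<Lambda> y"
  shows "reverse_at y (reverse_at x \<Lambda>) = reverse_at x (reverse_at y \<Lambda>)"
  using assms by (auto simp: reverse_at_def sink_def)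

lemma admissible_append:
  "admissible \<Lambda> (S @ T) \<longleftrightarrow> admissible \<Lambda> S \<and> admissible (reverse_seq S \<Lambda>) T"
  by (induction S arbitrary: \<Lambda>) (auto simp: reverse_seq_def)

lemma reverse_seq_Cons [simp]: "reverse_seq (x # S) \<Lambda> = reverse_seq S (reverse_at x \<Lambda>)"
  by (simp add: reverse_seq_def)

lemma reverse_seq_Nil [simp]: "reverse_seq [] \<Lambda> = \<Lambda>"
  by (simp add: reverse_seq_def)

section \<open>Equivalence, order and multiplicities of sequences\<close>

lemma seq_equiv_refl: "admissible \<Lambda> S \<Longrightarrow> seq_equiv G \<Lambda> S S"
  by (simp add: seq_equiv_def)

lemma seq_equiv_sym: "seq_equiv G \<Lambda> S T \<Longrightarrow> seq_equiv G \<Lambda> T S"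
  by (simp add: seq_equiv_def equivclp_sym)

lemma seq_equiv_trans: "seq_equiv G \<Lambda> S T \<Longrightarrow> seq_equiv G \<Lambda> T U \<Longrightarrow> seq_equiv G \<Lambda> S U"
  unfolding seq_equiv_def by (blast intro: equivclp_trans)

lemma equivclp_map:
  assumes "equivclp r a b" "\<And>a b. r a b \<Longrightarrow> equivclp s (f a) (f b)"
  shows "equivclp s (f a) (f b)"
  using assms(1)
proof (induction rule: equivclp_induct)
  case base
  then show ?case by simp
next
  case (step y z)
  then have "equivclp s (f y) (f z)"
    using assms(2) equivclp_sym by metis
  with step show ?case
    using equivclp_trans by metis
qed

lemma seq_equiv_Cons:
  assumes "seq_equiv G (reverse_at x \<Lambda>) S T" "sink \<Lambda> x"
  shows "seq_equiv G \<Lambda> (x # S) (x # T)"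
proof -
  have "interchange G \<Lambda> (x # A) (x # B)" if "interchange G (reverse_at x \<Lambda>) A B" for A B
  proof -
    from that obtain us y z vs where *: "val G y z = 0" "A = us @ [y, z] @ vs" "B = us @ [z, y] @ vs"
      "admissible (reverse_at x \<Lambda>) A" "admissible (reverse_at x \<Lambda>) B"
      by (auto simp: interchange_def)
    then have "x # A = (x # us) @ [y, z] @ vs" "x # B = (x # us) @ [z, y] @ vs"
      by simp_all
    with * assms(2) show ?thesis
      unfolding interchange_def by (metis admissible.simps(2))
  qed
  note step = r_into_equivclp[of "interchange G \<Lambda>", OF this]
  have "equivclp (interchange G (reverse_at x \<Lambda>)) S T"
    using assms(1) by (simp add: seq_equiv_def)
  from equivclp_map[where f = "(#) x", OF this step] show ?thesis
    using assms by (simp add: seq_equiv_def)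
qed

lemma interchange_sinks:
  assumes "orientation G \<Lambda>" "sink \<Lambda> x" "sink \<Lambda> y" "x \<noteq> y"
    and "admissible (reverse_at y (reverse_at x \<Lambda>)) S"
  shows "interchange G \<Lambda> (x # y # S) (y # x # S)"
proof -
  have "admissible \<Lambda> (x # y # S)"
    using assms by (simp add: sink_reverse_at)
  moreover have "admissible \<Lambda> (y # x # S)"
    using assms sink_reverse_at[of G \<Lambda> y x] by (simp add: reverse_at_commute)
  ultimately show ?thesis
    using sinks_not_adjacent[OF assms(1-3)] unfolding interchange_def
    by (metis append_Cons append_Nil)
qed

text \<open>Until its first occurrence \<open>y\<close> stays a sink, and each vertex before that
  occurrence is a sink when its turn comes. Two sinks are never adjacent, so \<open>y\<close> can be
  moved past these vertices one at a time.\<close>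

lemma sink_to_front:
  assumes "orientation G \<Lambda>" "admissible \<Lambda> S" "sink \<Lambda> y" "y \<in> set S"
  obtains T where "admissible (reverse_at y \<Lambda>) T" "seq_equiv G \<Lambda> S (y # T)"
proof -
  have "\<exists>T. admissible (reverse_at y \<Lambda>) T \<and> seq_equiv G \<Lambda> S (y # T)"
    using assms
  proof (induction S arbitrary: \<Lambda>)
    case Nil
    then show ?case by simp
  next
    case (Cons z S)
    show ?case
    proof (cases "z = y")
      case True
      with Cons.prems show ?thesis
        by (intro exI[of _ S]) (simp add: seq_equiv_refl)
    next
      case False
      have z: "sink \<Lambda> z" and adm: "admissible (reverse_at z \<Lambda>) S"
        using Cons.prems by auto
      obtain T where T: "admissible (reverse_at y (reverse_at z \<Lambda>)) T"
          "seq_equiv G (reverse_at z \<Lambda>) S (y # T)"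
        using Cons.IH[OF orientation_reverse_at adm] Cons.prems False sink_reverse_at[OF _ z]
        by (metis set_ConsD)
      have ic: "interchange G \<Lambda> (z # y # T) (y # z # T)"
        using Cons.prems z T False interchange_sinks by metis
      then have "seq_equiv G \<Lambda> (z # y # T) (y # z # T)"
        using r_into_equivclp[of "interchange G \<Lambda>", OF ic] unfolding seq_equiv_def interchange_def by simp
      then have "seq_equiv G \<Lambda> (z # S) (y # z # T)"
        by (rule seq_equiv_trans[OF seq_equiv_Cons[OF T(2) z]])
      moreover from ic have "admissible (reverse_at y \<Lambda>) (z # T)"
        by (simp add: interchange_def)
      ultimately show ?thesis by blast
    qed
  qed
  with that show thesis by blast
qed

lemma count_list_seq_equiv:
  assumes "seq_equiv G \<Lambda> S T"
  shows "count_list S = count_list T"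
proof -
  have "equivclp (interchange G \<Lambda>) S T"
    using assms by (simp add: seq_equiv_def)
  then have "equivclp (=) (count_list S) (count_list T)"
    by (rule equivclp_map) (auto simp: interchange_def fun_eq_iff)
  then show ?thesis
    by (induction rule: equivclp_induct) auto
qed

text \<open>Between two reflections at one end of an edge there is one at the other end, which turns
  the edge back. Thus the occurrences of \<open>i\<close> and \<open>j\<close> alternate, and the
  first is that of \<open>j\<close>, where the arrow points.\<close>

lemma count_list_arrow:
  assumes "orientation G \<Lambda>" "admissible \<Lambda> S" "(i, j) \<in> \<Lambda>"
  shows "count_list S i \<le> count_list S j \<and> count_list S j \<le> Suc (count_list S i)"
  using assms
proof (induction S arbitrary: \<Lambda> i j)
  case Nil
  then show ?case by simp
next
  case (Cons x S)
  have x: "sink \<Lambda> x" "admissible (reverse_at x \<Lambda>) S"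
    using Cons.prems by auto
  have i: "i \<noteq> x"
    using x Cons.prems by (auto simp: sink_def)
  have "i \<noteq> j"
    using Cons.prems by (auto simp: orientation_def)
  show ?case
  proof (cases "j = x")
    case True
    then have "(x, i) \<in> reverse_at x \<Lambda>"
      using Cons.prems x by (simp add: reverse_at_sink_iff)
    from Cons.IH[OF orientation_reverse_at[OF Cons.prems(1)] x(2) this] show ?thesis
      using True i by simp
  next
    case False
    then have "(i, j) \<in> reverse_at x \<Lambda>"
      using Cons.prems x i by (simp add: reverse_at_sink_iff)
    from Cons.IH[OF orientation_reverse_at[OF Cons.prems(1)] x(2) this] show ?thesis
      using False i by simp
  qed
qed

text \<open>The first vertex of \<open>S\<close> is a sink of \<open>\<Lambda>\<close> that also
  occurs in \<open>T\<close>. It can be moved to the front of \<open>T\<close> and removed from both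
  sequences, which preserves the inequality.\<close>

lemma count_le_imp_seq_le:
  assumes "orientation G \<Lambda>" "admissible \<Lambda> S" "admissible \<Lambda> T" "count_list S \<le> count_list T"
  shows "seq_le G \<Lambda> S T"
  using assms
proof (induction S arbitrary: \<Lambda> T)
  case Nil
  then show ?case
    by (auto simp: seq_le_def intro: seq_equiv_refl)
next
  case (Cons x S)
  have x: "sink \<Lambda> x" "admissible (reverse_at x \<Lambda>) S"
    using Cons.prems by auto
  have "count_list T x > 0"
    using le_funD[OF Cons.prems(4), of x] by simp
  then have "x \<in> set T"
    by (metis count_list_0_iff less_numeral_extra(3))
  then obtain T' where T': "admissible (reverse_at x \<Lambda>) T'" "seq_equiv G \<Lambda> T (x # T')"
    using sink_to_front Cons.prems x by metis
  have "count_list (x # S) \<le> count_list (x # T')"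
    using Cons.prems(4) count_list_seq_equiv[OF T'(2)] by metis
  then have "count_list S \<le> count_list T'"
    unfolding le_fun_def by (metis Suc_le_mono add.commute count_list.simps(2) plus_1_eq_Suc)
  then have "seq_le G (reverse_at x \<Lambda>) S T'"
    using Cons.IH[OF orientation_reverse_at x(2)] Cons.prems T' by blast
  then obtain U where U: "admissible (reverse_seq S (reverse_at x \<Lambda>)) U"
      "seq_equiv G (reverse_at x \<Lambda>) T' (S @ U)"
    by (auto simp: seq_le_def)
  have "seq_equiv G \<Lambda> T ((x # S) @ U)"
    using seq_equiv_trans[OF T'(2) seq_equiv_Cons[OF U(2) x(1)]] by simp
  with U show ?case
    using Cons.prems by (auto simp: seq_le_def)
qed

lemma seq_le_iff:
  assumes "orientation G \<Lambda>"
  shows "seq_le G \<Lambda> S T \<longleftrightarrow> admissible \<Lambda> S \<and> admissible \<Lambda> T \<and> count_list S \<le> count_list T"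
proof
  assume le: "seq_le G \<Lambda> S T"
  then obtain U where "seq_equiv G \<Lambda> T (S @ U)"
    by (auto simp: seq_le_def)
  then have "count_list T = count_list (S @ U)"
    by (rule count_list_seq_equiv)
  with le show "admissible \<Lambda> S \<and> admissible \<Lambda> T \<and> count_list S \<le> count_list T"
    by (auto simp: seq_le_def le_fun_def)
qed (use count_le_imp_seq_le[OF assms] in blast)

text \<open>Equal multiplicities give \<open>T\<close> equivalent to \<open>S @ U\<close> with no
  vertex occurring in \<open>U\<close>, so \<open>U\<close> is empty.\<close>

lemma seq_equiv_iff:
  assumes "orientation G \<Lambda>"
  shows "seq_equiv G \<Lambda> S T \<longleftrightarrow> admissible \<Lambda> S \<and> admissible \<Lambda> T \<and> count_list S = count_list T"
proof
  assume "seq_equiv G \<Lambda> S T"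
  then show "admissible \<Lambda> S \<and> admissible \<Lambda> T \<and> count_list S = count_list T"
    using count_list_seq_equiv by (auto simp: seq_equiv_def)
next
  assume *: "admissible \<Lambda> S \<and> admissible \<Lambda> T \<and> count_list S = count_list T"
  then have "seq_le G \<Lambda> S T"
    using count_le_imp_seq_le[OF assms] by simp
  then obtain U where U: "seq_equiv G \<Lambda> T (S @ U)"
    by (auto simp: seq_le_def)
  then have "count_list U x = 0" for x
    using count_list_seq_equiv[OF U] * by (metis add_cancel_right_right count_list_append)
  then have "U = []"
    by (metis count_list_0_iff list.set_intros(1) neq_Nil_conv)
  with U show "seq_equiv G \<Lambda> S T"
    using seq_equiv_sym by fastforce
qed

text \<open>
  On arrows outside the orientation, \<open>arrow_map\<close> carries junk values, and reflections at different
  vertices commute only up to these.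
\<close>

definition rep_eq_on :: "('i \<times> 'i) set \<Rightarrow> ('i, 'k, 'b, 'v) rep \<Rightarrow> ('i, 'k, 'b, 'v) rep \<Rightarrow> bool" where
  "rep_eq_on \<Lambda> M N \<longleftrightarrow> space M = space N \<and> (\<forall>(i, j)\<in>\<Lambda>. arrow_map M i j = arrow_map N i j)"

section \<open>Reflections along equivalent sequences\<close>

lemma rep_eq_on_refl: "rep_eq_on \<Lambda> M M"
  by (auto simp: rep_eq_on_def)

lemma rep_eq_on_sym: "rep_eq_on \<Lambda> M N \<Longrightarrow> rep_eq_on \<Lambda> N M"
  by (auto simp: rep_eq_on_def)

lemma rep_eq_on_trans: "rep_eq_on \<Lambda> M N \<Longrightarrow> rep_eq_on \<Lambda> N P \<Longrightarrow> rep_eq_on \<Lambda> M P"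
  by (fastforce simp: rep_eq_on_def)

lemma foldSetD_cong:
  assumes "(B, y) \<in> foldSetD D f e" "B \<subseteq> A" "\<And>x. x \<in> A \<Longrightarrow> f x = g x"
  shows "(B, y) \<in> foldSetD D g e"
  using assms(1,2)
proof induction
  case (insertI x A y)
  then show ?case
    using foldSetD.insertI[of x A g y D e] assms(3)[of x] by auto
qed (simp add: foldSetD.emptyI)

text \<open>The fold behind \<open>finsum\<close> sees only the values on \<open>A\<close>, whether
  or not they lie in the carrier and whatever \<open>M\<close> satisfies. Hence reflections can be
  compared up to \<open>rep_eq_on\<close> for arbitrary data, before anything is known to be a
  representation.\<close>

lemma finsum_cong_weak:
  assumes "\<And>x. x \<in> A \<Longrightarrow> f x = g x"
  shows "finsum M f A = finsum M g A"
proof -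
  have "(A, y) \<in> foldSetD (carrier M) (add M \<circ> f) \<zero>\<^bsub>M\<^esub> \<longleftrightarrow>
        (A, y) \<in> foldSetD (carrier M) (add M \<circ> g) \<zero>\<^bsub>M\<^esub>" for y
    using foldSetD_cong[of A y _ "add M \<circ> f" _ A "add M \<circ> g"]
      foldSetD_cong[of A y _ "add M \<circ> g" _ A "add M \<circ> f"] assms
    by auto
  then show ?thesis
    by (auto simp: finsum_def finprod_def foldD_def)
qed

lemma reflection_ker_cong:
  assumes "space M = space N" "\<And>y. (y, x) \<in> \<Lambda> \<Longrightarrow> arrow_map M y x = arrow_map N y x"
  shows "reflection_ker G \<Lambda> x M = reflection_ker G \<Lambda> x N"
proof -
  have "finsum (space M x) (\<lambda>y. arrow_map M y x (t y)) {y. (y, x) \<in> \<Lambda>} =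
        finsum (space N x) (\<lambda>y. arrow_map N y x (t y)) {y. (y, x) \<in> \<Lambda>}" for t
    using assms finsum_cong_weak[of "{y. (y, x) \<in> \<Lambda>}" "\<lambda>y. arrow_map M y x (t y)" "\<lambda>y. arrow_map N y x (t y)"]
    by simp
  then show ?thesis
    using assms by (simp add: reflection_ker_def)
qed

lemma rep_eq_on_reflect:
  assumes "sink \<Lambda> x" "rep_eq_on \<Lambda> M N"
  shows "rep_eq_on (reverse_at x \<Lambda>) (reflect G \<Lambda> x M) (reflect G \<Lambda> x N)"
proof -
  have "reflection_ker G \<Lambda> x M = reflection_ker G \<Lambda> x N"
    by (rule reflection_ker_cong) (use assms in \<open>auto simp: rep_eq_on_def\<close>)
  then show ?thesis
    using assms by (auto simp: rep_eq_on_def reflect_def Let_def reverse_at_sink_iff split: if_splits)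
qed


lemma rep_eq_on_reflect_seq:
  assumes "admissible \<Lambda> S" "rep_eq_on \<Lambda> M N"
  shows "rep_eq_on (reverse_seq S \<Lambda>) (reflect_seq G \<Lambda> S M) (reflect_seq G \<Lambda> S N)"
  using assms
  by (induction S arbitrary: \<Lambda> M N) (auto intro: rep_eq_on_reflect)

lemma reflect_seq_append:
  "reflect_seq G \<Lambda> (S @ T) M = reflect_seq G (reverse_seq S \<Lambda>) T (reflect_seq G \<Lambda> S M)"
  by (induction S arbitrary: \<Lambda> M) auto

lemma reflect_other [simp]: "y \<noteq> x \<Longrightarrow> space (reflect G \<Lambda> x M) y = space M y"
  by (simp add: reflect_def Let_def)

text \<open>Distinct sinks are not adjacent, so neither reflection touches the spaces and arrows
  from which the other one forms its kernel.\<close>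

lemma rep_eq_on_reflect_commute:
  assumes "sink \<Lambda> x" "sink \<Lambda> y" "x \<noteq> y"
  shows "rep_eq_on (reverse_at y (reverse_at x \<Lambda>))
    (reflect G (reverse_at x \<Lambda>) y (reflect G \<Lambda> x M)) (reflect G (reverse_at y \<Lambda>) x (reflect G \<Lambda> y M))"
proof -
  have arrows: "{z. (z, b) \<in> reverse_at a \<Lambda>} = {z. (z, b) \<in> \<Lambda>} \<and> (a, b) \<notin> \<Lambda>"
    if "sink \<Lambda> a" "sink \<Lambda> b" "a \<noteq> b" for a b
    using that by (auto simp: reverse_at_def sink_def)
  have ker: "reflection_ker G (reverse_at a \<Lambda>) b (reflect G \<Lambda> a M) = reflection_ker G \<Lambda> b M"
    if "sink \<Lambda> a" "sink \<Lambda> b" "a \<noteq> b" for a b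
  proof -
    have "{z. (z, b) \<in> reverse_at a \<Lambda>} = {z. (z, b) \<in> \<Lambda>}"
      using arrows that by blast
    moreover have "dsum {z. (z, b) \<in> \<Lambda>} (\<lambda>z. ten G b z (space (reflect G \<Lambda> a M) z)) =
        dsum {z. (z, b) \<in> \<Lambda>} (\<lambda>z. ten G b z (space M z))"
    proof -
      have "ten G b z (space (reflect G \<Lambda> a M) z) = ten G b z (space M z)" if "(z, b) \<in> \<Lambda>" for z
        using that arrows[OF \<open>sink \<Lambda> a\<close> \<open>sink \<Lambda> b\<close> \<open>a \<noteq> b\<close>] by (metis reflect_other)
      then show ?thesis
        by (simp add: dsum_def restrict_def PiE_def Pi_def fun_eq_iff cong: conj_cong if_cong)
    qed
    moreover have "finsum (space (reflect G \<Lambda> a M) b) (\<lambda>z. arrow_map (reflect G \<Lambda> a M) z b (t z)) {z. (z, b) \<in> \<Lambda>} =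
      finsum (space M b) (\<lambda>z. arrow_map M z b (t z)) {z. (z, b) \<in> \<Lambda>}" for t
    proof -
      have "arrow_map (reflect G \<Lambda> a M) z b (t z) = arrow_map M z b (t z)" if "(z, b) \<in> \<Lambda>" for z
        using that arrows[OF \<open>sink \<Lambda> a\<close> \<open>sink \<Lambda> b\<close> \<open>a \<noteq> b\<close>] by (auto simp: reflect_def Let_def)
      moreover have "space (reflect G \<Lambda> a M) b = space M b"
        using \<open>a \<noteq> b\<close> by simp
      ultimately show ?thesis
        by (auto intro: finsum_cong_weak)
    qed
    ultimately show ?thesis
      using that by (simp add: reflection_ker_def Let_def)
  qed
  \<comment> \<open>The two composites may disagree at the pairs \<open>(x, y)\<close> and
    \<open>(y, x)\<close>, where \<open>adjoint_map\<close> is formed with the old space in one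
    order and the new space in the other. Neither pair is an arrow.\<close>
  have "reverse_at y (reverse_at x \<Lambda>) \<subseteq> {(i, j). \<not> (i = x \<and> j = y) \<and> \<not> (i = y \<and> j = x)}"
    using assms by (auto simp: reverse_at_def sink_def)
  then show ?thesis
    using assms ker[of x y] ker[of y x]
    by (auto simp: rep_eq_on_def reflect_def Let_def fun_eq_iff)
qed

lemma rep_eq_on_interchange:
  assumes "orientation G \<Lambda>" "interchange G \<Lambda> S T"
  shows "rep_eq_on (reverse_seq S \<Lambda>) (reflect_seq G \<Lambda> S M) (reflect_seq G \<Lambda> T M) \<and>
    reverse_seq S \<Lambda> = reverse_seq T \<Lambda>"
proof -
  obtain us x y vs where *: "val G x y = 0" "S = us @ [x, y] @ vs" "T = us @ [y, x] @ vs"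
      "admissible \<Lambda> S" "admissible \<Lambda> T"
    using assms(2) by (auto simp: interchange_def)
  let ?\<Lambda> = "reverse_seq us \<Lambda>" and ?M = "reflect_seq G \<Lambda> us M"
  have sinks: "sink ?\<Lambda> x" "sink ?\<Lambda> y"
    using * by (auto simp: admissible_append)
  have 1: "reverse_at y (reverse_at x ?\<Lambda>) = reverse_at x (reverse_at y ?\<Lambda>)"
    using reverse_at_commute[OF sinks] .
  have "rep_eq_on (reverse_at y (reverse_at x ?\<Lambda>))
    (reflect G (reverse_at x ?\<Lambda>) y (reflect G ?\<Lambda> x ?M)) (reflect G (reverse_at y ?\<Lambda>) x (reflect G ?\<Lambda> y ?M))"
    by (cases "x = y") (auto intro: rep_eq_on_refl rep_eq_on_reflect_commute sinks)
  then have "rep_eq_on (reverse_seq vs (reverse_at y (reverse_at x ?\<Lambda>)))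
    (reflect_seq G (reverse_at y (reverse_at x ?\<Lambda>)) vs (reflect G (reverse_at x ?\<Lambda>) y (reflect G ?\<Lambda> x ?M)))
    (reflect_seq G (reverse_at y (reverse_at x ?\<Lambda>)) vs (reflect G (reverse_at y ?\<Lambda>) x (reflect G ?\<Lambda> y ?M)))"
    using * by (intro rep_eq_on_reflect_seq) (simp_all add: admissible_append)
  with 1 * show ?thesis
    by (simp add: reflect_seq_append reverse_seq_def)
qed

lemma rep_eq_on_seq_equiv:
  assumes "orientation G \<Lambda>" "seq_equiv G \<Lambda> S T"
  shows "rep_eq_on (reverse_seq S \<Lambda>) (reflect_seq G \<Lambda> S M) (reflect_seq G \<Lambda> T M) \<and>
    reverse_seq S \<Lambda> = reverse_seq T \<Lambda>"
proof -
  have "equivclp (interchange G \<Lambda>) S T"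
    using assms by (simp add: seq_equiv_def)
  then show ?thesis
  proof (induction rule: equivclp_induct)
    case base
    then show ?case by (simp add: rep_eq_on_refl)
  next
    case (step y z)
    from step.hyps(2) show ?case
    proof
      assume "interchange G \<Lambda> y z"
      from rep_eq_on_interchange[OF assms(1) this, of M] step.IH show ?case
        by (metis rep_eq_on_trans)
    next
      assume "interchange G \<Lambda> z y"
      from rep_eq_on_interchange[OF assms(1) this, of M] step.IH show ?case
        by (metis rep_eq_on_trans rep_eq_on_sym)
    qed
  qed
qed

lemma rep_is_zero_seq_equiv:
  assumes "orientation G \<Lambda>" "seq_equiv G \<Lambda> S T"
  shows "rep_is_zero (reflect_seq G \<Lambda> S M) \<longleftrightarrow> rep_is_zero (reflect_seq G \<Lambda> T M)"
  using rep_eq_on_seq_equiv[OF assms, of M] by (simp add: rep_eq_on_def rep_is_zero_def)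

section \<open>The least annihilating sequence\<close>

lemma reflect_seq_other: "i \<notin> set S \<Longrightarrow> space (reflect_seq G \<Lambda> S M) i = space M i"
  by (induction S arbitrary: \<Lambda> M) auto

lemma length_eq_sum_count_list: "length (S :: 'i::finite list) = (\<Sum>i\<in>UNIV. count_list S i)"
  by (simp add: sum_count_set)

lemma annihilating_meet:
  fixes \<Lambda> :: "('i::finite \<times> 'i) set"
  assumes "orientation G \<Lambda>" "acyclic \<Lambda>" "admissible \<Lambda> S" "admissible \<Lambda> T"
    and "rep_is_zero (reflect_seq G \<Lambda> S M)" "rep_is_zero (reflect_seq G \<Lambda> T M)"
  obtains U where "admissible \<Lambda> U" "rep_is_zero (reflect_seq G \<Lambda> U M)"
    "count_list U = (\<lambda>i. min (count_list S i) (count_list T i))"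
proof -
  have "\<exists>U. admissible \<Lambda> U \<and> rep_is_zero (reflect_seq G \<Lambda> U M) \<and>
    count_list U = (\<lambda>i. min (count_list S i) (count_list T i))"
    using assms
  proof (induction "length S" arbitrary: \<Lambda> M S T)
    case (0 S)
    then show ?case by (intro exI[of _ "[]"]) auto
  next
    case (Suc n S)
    show ?case
    proof (cases "set S \<inter> set T = {}")
      case True
      have "rep_is_zero M"
        unfolding rep_is_zero_def
      proof
        fix i
        from True have "i \<notin> set S \<or> i \<notin> set T" by blast
        then show "carrier (space M i) = {\<zero>\<^bsub>space M i\<^esub>}"
          using Suc.prems(5,6) reflect_seq_other unfolding rep_is_zero_def by metis
      qed
      moreover have "min (count_list S i) (count_list T i) = 0" for i
        using True count_list_0_iff[of S i] count_list_0_iff[of T i] by auto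
      ultimately show ?thesis
        by (intro exI[of _ "[]"]) auto
    next
      case False
      \<comment> \<open>Choose a common vertex \<open>y\<close> without successors among the common
        vertices. By \<open>count_list_arrow\<close> every successor of \<open>y\<close> would occur
        in both sequences as well, so \<open>y\<close> has no successor at all and is a
        sink.\<close>
      have "wf (\<Lambda>\<inverse>)"
        using finite_acyclic_wf_converse[OF finite Suc.prems(2)] .
      then obtain y where y: "y \<in> set S \<inter> set T" "\<And>z. (y, z) \<in> \<Lambda> \<Longrightarrow> z \<notin> set S \<inter> set T"
        using False by (metis wfE_min' converseI)
      have "sink \<Lambda> y"
        unfolding sink_def
      proof (intro allI notI)
        fix z assume yz: "(y, z) \<in> \<Lambda>"
        have "count_list S y > 0" "count_list T y > 0"
          using y(1) by (auto simp: count_list_0_iff intro: Suc_leI gr_zeroI)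
        then have "count_list S z > 0" "count_list T z > 0"
          using count_list_arrow[OF Suc.prems(1,3) yz] count_list_arrow[OF Suc.prems(1,4) yz] by auto
        then have "z \<in> set S \<inter> set T"
          by (metis IntI count_list_0_iff less_irrefl)
        with y(2)[OF yz] show False by simp
      qed
      obtain S' where S': "admissible (reverse_at y \<Lambda>) S'" "seq_equiv G \<Lambda> S (y # S')"
        using sink_to_front[OF Suc.prems(1,3) \<open>sink \<Lambda> y\<close>] y(1) by blast
      obtain T' where T': "admissible (reverse_at y \<Lambda>) T'" "seq_equiv G \<Lambda> T (y # T')"
        using sink_to_front[OF Suc.prems(1,4) \<open>sink \<Lambda> y\<close>] y(1) by blast
      have cS: "count_list S = count_list (y # S')" and cT: "count_list T = count_list (y # T')"
        using S' T' count_list_seq_equiv by blast+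
      have "length (y # S') = length S"
        unfolding length_eq_sum_count_list cS ..
      then have len: "n = length S'"
        using Suc.hyps by simp
      have "rep_is_zero (reflect_seq G (reverse_at y \<Lambda>) S' (reflect G \<Lambda> y M))"
           "rep_is_zero (reflect_seq G (reverse_at y \<Lambda>) T' (reflect G \<Lambda> y M))"
        using rep_is_zero_seq_equiv[OF Suc.prems(1) S'(2), of M] rep_is_zero_seq_equiv[OF Suc.prems(1) T'(2), of M]
          Suc.prems(5,6) by auto
      from Suc.hyps(1)[OF len orientation_reverse_at acyclic_reverse_at S'(1) T'(1) this] Suc.prems \<open>sink \<Lambda> y\<close>
      obtain U where "admissible (reverse_at y \<Lambda>) U" "rep_is_zero (reflect_seq G (reverse_at y \<Lambda>) U (reflect G \<Lambda> y M))"
        and cU: "count_list U = (\<lambda>i. min (count_list S' i) (count_list T' i))"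
        by blast
      moreover have "count_list (y # U) = (\<lambda>i. min (count_list S i) (count_list T i))"
        unfolding cS cT by (auto simp: cU fun_eq_iff)
      ultimately show ?thesis
        using \<open>sink \<Lambda> y\<close> by (intro exI[of _ "y # U"]) simp
    qed
  qed
  with that show thesis by blast
qed

text \<open>A sequence \<open>U\<close> of minimal length will do. Its meet with any annihilating
  \<open>T\<close> also annihilates and is not longer, so it has the multiplicities of
  \<open>U\<close>, which are therefore bounded by those of \<open>T\<close>.\<close>

lemma annihilating_least:
  fixes \<Lambda> :: "('i::finite \<times> 'i) set"
  assumes "orientation G \<Lambda>" "acyclic \<Lambda>" "admissible \<Lambda> S" "rep_is_zero (reflect_seq G \<Lambda> S M)"
  obtains U where "admissible \<Lambda> U" "rep_is_zero (reflect_seq G \<Lambda> U M)"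
    "\<And>T. admissible \<Lambda> T \<Longrightarrow> rep_is_zero (reflect_seq G \<Lambda> T M) \<Longrightarrow> count_list U \<le> count_list T"
proof -
  let ?P = "\<lambda>S. admissible \<Lambda> S \<and> rep_is_zero (reflect_seq G \<Lambda> S M)"
  obtain U where U: "?P U" "\<And>T. ?P T \<Longrightarrow> length U \<le> length T"
    using assms(3,4) ex_has_least_nat[of ?P S length] by blast
  have "count_list U \<le> count_list T" if T: "?P T" for T
  proof -
    obtain V where V: "?P V" "count_list V = (\<lambda>i. min (count_list U i) (count_list T i))"
      using annihilating_meet[OF assms(1,2), of U T M] U(1) T by blast
    have "count_list U i \<le> count_list T i" for i
    proof (rule ccontr)
      assume "\<not> ?thesis"
      then have "count_list V i < count_list U i" "\<forall>j. count_list V j \<le> count_list U j"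
        using V by auto
      then have "length V < length U"
        unfolding length_eq_sum_count_list by (intro sum_strict_mono_ex1) auto
      with U(2)[OF V(1)] show False by simp
    qed
    then show ?thesis by (simp add: le_fun_def)
  qed
  with U that show thesis by blast
qed

section \<open>Modules\<close>

context left_module
begin

lemma minus_zero_eq: "\<ominus>\<^bsub>M\<^esub> \<zero>\<^bsub>M\<^esub> = \<zero>\<^bsub>M\<^esub>"
  using M.minus_equality[of "\<zero>\<^bsub>M\<^esub>" "\<zero>\<^bsub>M\<^esub>"] by simp

lemma smult_zero: "a \<in> carrier R \<Longrightarrow> a \<odot>\<^bsub>M\<^esub> \<zero>\<^bsub>M\<^esub> = \<zero>\<^bsub>M\<^esub>"
  by (metis M.add.r_cancel_one' M.zero_closed M.l_zero smult_closed smult_r_distr)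

lemma zero_smult: "x \<in> carrier M \<Longrightarrow> \<zero>\<^bsub>R\<^esub> \<odot>\<^bsub>M\<^esub> x = \<zero>\<^bsub>M\<^esub>"
  by (metis M.add.r_cancel_one' R.l_zero R.zero_closed smult_closed smult_l_distr)

lemma minus_smult: "a \<in> carrier R \<Longrightarrow> x \<in> carrier M \<Longrightarrow> (\<ominus>\<^bsub>R\<^esub> a) \<odot>\<^bsub>M\<^esub> x = \<ominus>\<^bsub>M\<^esub> (a \<odot>\<^bsub>M\<^esub> x)"
  by (metis M.minus_equality R.a_inv_closed R.l_neg smult_closed smult_l_distr zero_smult)

lemma smult_minus: "a \<in> carrier R \<Longrightarrow> x \<in> carrier M \<Longrightarrow> a \<odot>\<^bsub>M\<^esub> (\<ominus>\<^bsub>M\<^esub> x) = \<ominus>\<^bsub>M\<^esub> (a \<odot>\<^bsub>M\<^esub> x)"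
  by (metis M.minus_equality M.a_inv_closed M.l_neg smult_closed smult_r_distr smult_zero)

lemma finsum_smult:
  assumes "finite A" "a \<in> carrier R" "f \<in> A \<rightarrow> carrier M"
  shows "a \<odot>\<^bsub>M\<^esub> finsum M f A = finsum M (\<lambda>x. a \<odot>\<^bsub>M\<^esub> f x) A"
  using assms(1,3)
proof induction
  case empty
  then show ?case using assms(2) by (simp add: smult_zero)
next
  case (insert x F)
  then have "(\<lambda>x. a \<odot>\<^bsub>M\<^esub> f x) \<in> F \<rightarrow> carrier M" "a \<odot>\<^bsub>M\<^esub> f x \<in> carrier M"
    using assms(2) by (auto intro: smult_closed)
  with insert show ?case
    using assms(2) by (simp add: Pi_iff smult_r_distr)
qed

lemma submoduleI:
  assumes "U \<subseteq> carrier M" "\<zero>\<^bsub>M\<^esub> \<in> U" "\<And>x y. x \<in> U \<Longrightarrow> y \<in> U \<Longrightarrow> x \<oplus>\<^bsub>M\<^esub> y \<in> U"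
    "\<And>a x. a \<in> carrier R \<Longrightarrow> x \<in> U \<Longrightarrow> a \<odot>\<^bsub>M\<^esub> x \<in> U"
  shows "submodule U R M"
proof (intro submodule.intro submodule_axioms.intro M.add.subgroupI)
  fix x assume "x \<in> U"
  then have "\<ominus>\<^bsub>M\<^esub> x = (\<ominus>\<^bsub>R\<^esub> \<one>\<^bsub>R\<^esub>) \<odot>\<^bsub>M\<^esub> x"
    using assms(1) by (auto simp: minus_smult smult_one)
  then show "\<ominus>\<^bsub>M\<^esub> x \<in> U"
    using assms(4) \<open>x \<in> U\<close> by simp
qed (use assms in auto)

lemma submoduleD:
  assumes "submodule U R M"
  shows "U \<subseteq> carrier M" "\<zero>\<^bsub>M\<^esub> \<in> U" "\<And>x y. x \<in> U \<Longrightarrow> y \<in> U \<Longrightarrow> x \<oplus>\<^bsub>M\<^esub> y \<in> U"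
    "\<And>a x. a \<in> carrier R \<Longrightarrow> x \<in> U \<Longrightarrow> a \<odot>\<^bsub>M\<^esub> x \<in> U" "\<And>x. x \<in> U \<Longrightarrow> \<ominus>\<^bsub>M\<^esub> x \<in> U"
proof -
  interpret U: submodule U R M by fact
  show "U \<subseteq> carrier M" "\<zero>\<^bsub>M\<^esub> \<in> U" "\<And>x y. x \<in> U \<Longrightarrow> y \<in> U \<Longrightarrow> x \<oplus>\<^bsub>M\<^esub> y \<in> U"
    "\<And>a x. a \<in> carrier R \<Longrightarrow> x \<in> U \<Longrightarrow> a \<odot>\<^bsub>M\<^esub> x \<in> U" "\<And>x. x \<in> U \<Longrightarrow> \<ominus>\<^bsub>M\<^esub> x \<in> U"
    using U.subset U.one_closed U.m_closed U.smult_closed U.m_inv_closed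
    by (auto simp: a_inv_def[symmetric])
qed

end

text \<open>Negatives come from the scalar -1: (-1)x + x = 0x, which is zero by the last assumption.
  The constructions below that use this rule need not exhibit a negation.\<close>

lemma left_moduleI:
  fixes M :: "('k, 'v, 'n) module_scheme"
  assumes "ring R" "\<zero>\<^bsub>M\<^esub> \<in> carrier M"
    "\<And>x y. x \<in> carrier M \<Longrightarrow> y \<in> carrier M \<Longrightarrow> x \<oplus>\<^bsub>M\<^esub> y \<in> carrier M"
    "\<And>x y z. x \<in> carrier M \<Longrightarrow> y \<in> carrier M \<Longrightarrow> z \<in> carrier M \<Longrightarrow>
      (x \<oplus>\<^bsub>M\<^esub> y) \<oplus>\<^bsub>M\<^esub> z = x \<oplus>\<^bsub>M\<^esub> (y \<oplus>\<^bsub>M\<^esub> z)"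
    "\<And>x y. x \<in> carrier M \<Longrightarrow> y \<in> carrier M \<Longrightarrow> x \<oplus>\<^bsub>M\<^esub> y = y \<oplus>\<^bsub>M\<^esub> x"
    "\<And>x. x \<in> carrier M \<Longrightarrow> \<zero>\<^bsub>M\<^esub> \<oplus>\<^bsub>M\<^esub> x = x"
    "\<And>a x. a \<in> carrier R \<Longrightarrow> x \<in> carrier M \<Longrightarrow> a \<odot>\<^bsub>M\<^esub> x \<in> carrier M"
    "\<And>a b x. a \<in> carrier R \<Longrightarrow> b \<in> carrier R \<Longrightarrow> x \<in> carrier M \<Longrightarrow>
      (a \<oplus>\<^bsub>R\<^esub> b) \<odot>\<^bsub>M\<^esub> x = a \<odot>\<^bsub>M\<^esub> x \<oplus>\<^bsub>M\<^esub> b \<odot>\<^bsub>M\<^esub> x"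
    "\<And>a x y. a \<in> carrier R \<Longrightarrow> x \<in> carrier M \<Longrightarrow> y \<in> carrier M \<Longrightarrow>
      a \<odot>\<^bsub>M\<^esub> (x \<oplus>\<^bsub>M\<^esub> y) = a \<odot>\<^bsub>M\<^esub> x \<oplus>\<^bsub>M\<^esub> a \<odot>\<^bsub>M\<^esub> y"
    "\<And>a b x. a \<in> carrier R \<Longrightarrow> b \<in> carrier R \<Longrightarrow> x \<in> carrier M \<Longrightarrow>
      (a \<otimes>\<^bsub>R\<^esub> b) \<odot>\<^bsub>M\<^esub> x = a \<odot>\<^bsub>M\<^esub> (b \<odot>\<^bsub>M\<^esub> x)"
    "\<And>x. x \<in> carrier M \<Longrightarrow> \<one>\<^bsub>R\<^esub> \<odot>\<^bsub>M\<^esub> x = x"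
    and zero_smult: "\<And>x. x \<in> carrier M \<Longrightarrow> \<zero>\<^bsub>R\<^esub> \<odot>\<^bsub>M\<^esub> x = \<zero>\<^bsub>M\<^esub>"
  shows "left_module R M"
proof -
  interpret R: ring R by fact
  have inv: "\<exists>y\<in>carrier M. y \<oplus>\<^bsub>M\<^esub> x = \<zero>\<^bsub>M\<^esub>" if x: "x \<in> carrier M" for x
  proof
    show "(\<ominus>\<^bsub>R\<^esub> \<one>\<^bsub>R\<^esub>) \<odot>\<^bsub>M\<^esub> x \<in> carrier M"
      using assms(7) x by simp
    have "(\<ominus>\<^bsub>R\<^esub> \<one>\<^bsub>R\<^esub>) \<odot>\<^bsub>M\<^esub> x \<oplus>\<^bsub>M\<^esub> x = (\<ominus>\<^bsub>R\<^esub> \<one>\<^bsub>R\<^esub> \<oplus>\<^bsub>R\<^esub> \<one>\<^bsub>R\<^esub>) \<odot>\<^bsub>M\<^esub> x"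
      using assms(8)[of "\<ominus>\<^bsub>R\<^esub> \<one>\<^bsub>R\<^esub>" "\<one>\<^bsub>R\<^esub>" x] assms(11) x by simp
    then show "(\<ominus>\<^bsub>R\<^esub> \<one>\<^bsub>R\<^esub>) \<odot>\<^bsub>M\<^esub> x \<oplus>\<^bsub>M\<^esub> x = \<zero>\<^bsub>M\<^esub>"
      using zero_smult x by (simp add: R.l_neg)
  qed
  interpret M: abelian_group M
    using assms inv by (intro abelian_groupI) auto
  show ?thesis
    using assms by unfold_locales auto
qed

lemma left_linearD:
  assumes "f \<in> left_linear R M N"
  shows "x \<in> carrier M \<Longrightarrow> f x \<in> carrier N"
    "x \<in> carrier M \<Longrightarrow> y \<in> carrier M \<Longrightarrow> f (x \<oplus>\<^bsub>M\<^esub> y) = f x \<oplus>\<^bsub>N\<^esub> f y"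
    "r \<in> carrier R \<Longrightarrow> x \<in> carrier M \<Longrightarrow> f (r \<odot>\<^bsub>M\<^esub> x) = r \<odot>\<^bsub>N\<^esub> f x"
  using assms by (auto simp: left_linear_def)

lemma left_linearI:
  assumes "\<And>x. x \<in> carrier M \<Longrightarrow> f x \<in> carrier N"
    "\<And>x y. x \<in> carrier M \<Longrightarrow> y \<in> carrier M \<Longrightarrow> f (x \<oplus>\<^bsub>M\<^esub> y) = f x \<oplus>\<^bsub>N\<^esub> f y"
    "\<And>r x. r \<in> carrier R \<Longrightarrow> x \<in> carrier M \<Longrightarrow> f (r \<odot>\<^bsub>M\<^esub> x) = r \<odot>\<^bsub>N\<^esub> f x"
  shows "f \<in> left_linear R M N"
  using assms by (auto simp: left_linear_def)

lemma left_linear_compose: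
  assumes "f \<in> left_linear R M N" "g \<in> left_linear R N P"
  shows "(\<lambda>x. g (f x)) \<in> left_linear R M P"
  using assms by (auto simp: left_linear_def Pi_iff)

lemma left_linear_zero:
  assumes "f \<in> left_linear R M N" "left_module R M" "left_module R N"
  shows "f \<zero>\<^bsub>M\<^esub> = \<zero>\<^bsub>N\<^esub>"
proof -
  interpret M: left_module R M by fact
  interpret N: left_module R N by fact
  have "f (\<zero>\<^bsub>R\<^esub> \<odot>\<^bsub>M\<^esub> \<zero>\<^bsub>M\<^esub>) = \<zero>\<^bsub>R\<^esub> \<odot>\<^bsub>N\<^esub> f \<zero>\<^bsub>M\<^esub>"
    using left_linearD[OF assms(1)] by simp
  then show ?thesis
    using left_linearD[OF assms(1)] by (simp add: M.zero_smult N.zero_smult)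
qed

lemma left_linear_minus:
  assumes "f \<in> left_linear R M N" "left_module R M" "left_module R N" "x \<in> carrier M"
  shows "f (\<ominus>\<^bsub>M\<^esub> x) = \<ominus>\<^bsub>N\<^esub> f x"
proof -
  interpret M: left_module R M by fact
  interpret N: left_module R N by fact
  have "f (\<ominus>\<^bsub>M\<^esub> x) \<oplus>\<^bsub>N\<^esub> f x = \<zero>\<^bsub>N\<^esub>"
    using left_linearD[OF assms(1)] left_linear_zero[OF assms(1-3)] assms(4)
    by (metis M.add.inv_closed M.add.l_inv)
  then show ?thesis
    using left_linearD[OF assms(1)] assms(4) by (metis M.add.inv_closed N.minus_equality)
qed

lemma left_linear_finsum:
  assumes "f \<in> left_linear R M N" "left_module R M" "left_module R N" "finite A" "g \<in> A \<rightarrow> carrier M"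
  shows "f (finsum M g A) = finsum N (\<lambda>a. f (g a)) A"
  using assms(4,5)
proof induction
  interpret M: left_module R M by fact
  interpret N: left_module R N by fact
  case empty
  show ?case using left_linear_zero assms by simp
next
  interpret M: left_module R M by fact
  interpret N: left_module R N by fact
  case (insert x F)
  then show ?case
    using left_linearD[OF assms(1)] by (simp add: Pi_iff)
qed

lemma left_module_submodule:
  assumes "left_module R M" "submodule U R M"
  shows "left_module R (M\<lparr>carrier := U\<rparr>)"
proof -
  interpret M: left_module R M by fact
  note U = M.submoduleD[OF assms(2)]
  show ?thesis
    by (rule left_moduleI)
      (use U M.ring_axioms in \<open>auto intro: M.zero_smult M.smult_one M.smult_l_distr M.smult_r_distr
         M.smult_assoc1 M.a_comm M.a_assoc M.R.ring_axioms subsetD\<close>)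
qed

lemma left_module_image:
  fixes M :: "('k, 'v) module"
  assumes "left_module R M" "inj_on e (carrier M)"
  shows "left_module R (module_image e M)"
    "e \<in> left_linear R M (module_image e M)"
    "inv_into (carrier M) e \<in> left_linear R (module_image e M) M"
proof -
  interpret M: left_module R M by fact
  have [simp]: "inv_into (carrier M) e (e x) = x" if "x \<in> carrier M" for x
    using assms(2) that by simp
  have c: "carrier (module_image e M) = e ` carrier M" "\<zero>\<^bsub>module_image e M\<^esub> = e \<zero>\<^bsub>M\<^esub>"
    by (simp_all add: module_image_def Let_def)
  have a: "e x \<oplus>\<^bsub>module_image e M\<^esub> e y = e (x \<oplus>\<^bsub>M\<^esub> y)" if "x \<in> carrier M" "y \<in> carrier M" for x y
    using that by (simp add: module_image_def Let_def)
  have s: "r \<odot>\<^bsub>module_image e M\<^esub> e x = e (r \<odot>\<^bsub>M\<^esub> x)" if "x \<in> carrier M" for r x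
    using that by (simp add: module_image_def Let_def)
  show "left_module R (module_image e M)"
    by (rule left_moduleI)
      (auto simp: c a s M.smult_closed M.smult_l_distr M.smult_r_distr M.smult_assoc1 M.smult_one
        M.zero_smult M.a_ac M.R.ring_axioms)
  show "e \<in> left_linear R M (module_image e M)"
    by (rule left_linearI) (auto simp: c a s)
  show "inv_into (carrier M) e \<in> left_linear R (module_image e M) M"
    by (rule left_linearI) (auto simp: c a s M.smult_closed)
qed

lemma left_module_dsum:
  fixes M :: "'j \<Rightarrow> ('k, 'v) module"
  assumes "ring R" "\<And>j. j \<in> J \<Longrightarrow> left_module R (M j)"
  shows "left_module R (dsum J M)"
proof -
  note m = assms(2)[THEN left_module.axioms(2)] 
  note ax = abelian_groupE[OF m] left_module.smult_closed[OF assms(2)]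
    left_module.smult_l_distr[OF assms(2)] left_module.smult_r_distr[OF assms(2)]
    left_module.smult_assoc1[OF assms(2)] left_module.smult_one[OF assms(2)] left_module.zero_smult[OF assms(2)]
  show ?thesis
    by (rule left_moduleI)
      (auto simp: dsum_def restrict_def PiE_iff extensional_def fun_eq_iff assms(1)
        intro!: ax)
qed


text \<open>These are the left linear maps into the ring itself. They are not an instance of
  \<open>left_linear\<close>, because a ring record has multiplication but no scalar
  multiplication.\<close>

definition functionals :: "('k, 'm) ring_scheme \<Rightarrow> ('k, 'v, 'n) module_scheme \<Rightarrow> ('v \<Rightarrow> 'k) set" where
  "functionals R M = {f \<in> carrier M \<rightarrow> carrier R.
     (\<forall>x\<in>carrier M. \<forall>y\<in>carrier M. f (x \<oplus>\<^bsub>M\<^esub> y) = f x \<oplus>\<^bsub>R\<^esub> f y) \<and>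
     (\<forall>r\<in>carrier R. \<forall>x\<in>carrier M. f (r \<odot>\<^bsub>M\<^esub> x) = r \<otimes>\<^bsub>R\<^esub> f x)}"

lemma functionalsD:
  assumes "f \<in> functionals R M"
  shows "x \<in> carrier M \<Longrightarrow> f x \<in> carrier R"
    "x \<in> carrier M \<Longrightarrow> y \<in> carrier M \<Longrightarrow> f (x \<oplus>\<^bsub>M\<^esub> y) = f x \<oplus>\<^bsub>R\<^esub> f y"
    "r \<in> carrier R \<Longrightarrow> x \<in> carrier M \<Longrightarrow> f (r \<odot>\<^bsub>M\<^esub> x) = r \<otimes>\<^bsub>R\<^esub> f x"
  using assms by (auto simp: functionals_def)

text \<open>A maximal submodule among those that contain \<open>U\<close> but not \<open>b\<close> is a complement of the line through \<open>b\<close>.\<close>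

lemma functional_extension:
  assumes "skew_field R" "left_module R M" "submodule U R M" "b \<in> carrier M" "b \<notin> U"
  obtains \<phi> where "\<phi> \<in> functionals R M" "\<And>x. x \<in> U \<Longrightarrow> \<phi> x = \<zero>\<^bsub>R\<^esub>" "\<phi> b = \<one>\<^bsub>R\<^esub>"
proof -
  interpret R: skew_field R by fact
  interpret M: left_module R M by fact
  define Ws where "Ws = {W. submodule W R M \<and> U \<subseteq> W \<and> b \<notin> W}"
  have "\<exists>W\<in>Ws. \<forall>Z\<in>Ws. W \<subseteq> Z \<longrightarrow> Z = W"
  proof (rule subset_Zorn_nonempty)
    fix C assume "C \<noteq> {}" and C: "subset.chain Ws C"
    then have CA: "C \<subseteq> Ws" by (simp add: subset_chain_def)
    show "\<Union>C \<in> Ws"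
    proof -
      have sub: "submodule W R M" if "W \<in> C" for W
        using CA that by (auto simp: Ws_def)
      have "submodule (\<Union>C) R M"
      proof (rule M.submoduleI)
        show "\<Union>C \<subseteq> carrier M" "\<zero>\<^bsub>M\<^esub> \<in> \<Union>C"
          using M.submoduleD(1,2)[OF sub] \<open>C \<noteq> {}\<close> by blast+
        show "a \<odot>\<^bsub>M\<^esub> x \<in> \<Union>C" if "a \<in> carrier R" "x \<in> \<Union>C" for a x
          using M.submoduleD(4)[OF sub] that by blast
        fix x y assume "x \<in> \<Union>C" "y \<in> \<Union>C"
        then obtain Z Y where XY: "Z \<in> C" "Y \<in> C" "x \<in> Z" "y \<in> Y" by blast
        then have "Z \<subseteq> Y \<or> Y \<subseteq> Z"
          using C by (auto simp: subset_chain_def)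
        then show "x \<oplus>\<^bsub>M\<^esub> y \<in> \<Union>C"
          using M.submoduleD(3)[OF sub] XY by blast
      qed
      then show ?thesis
        using CA \<open>C \<noteq> {}\<close> by (auto simp: Ws_def)
    qed
  next
    show "Ws \<noteq> {}"
      using assms(3,5) by (auto simp: Ws_def)
  qed
  then obtain W where "W \<in> Ws" and maxW: "\<forall>Z\<in>Ws. W \<subseteq> Z \<longrightarrow> Z = W" ..
  then have W: "submodule W R M" "U \<subseteq> W" "b \<notin> W"
    by (simp_all add: Ws_def)
  have max: "Z = W" if "submodule Z R M" "W \<subseteq> Z" "b \<notin> Z" for Z
    using maxW that W(2) by (simp add: Ws_def)
  note Wd = M.submoduleD[OF W(1)]
  have unit: "\<exists>s\<in>carrier R. s \<otimes>\<^bsub>R\<^esub> r = \<one>\<^bsub>R\<^esub>" if "r \<in> carrier R" "r \<noteq> \<zero>\<^bsub>R\<^esub>" for r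
  proof -
    have "r \<in> Units R"
      using that R.Units_eq by blast
    then show ?thesis
      by (intro bexI[of _ "inv\<^bsub>R\<^esub> r"]) auto
  qed
  \<comment> \<open>Every \<open>x\<close> has a coordinate along \<open>b\<close> modulo
    \<open>W\<close>. If \<open>x\<close> is not in \<open>W\<close>, then \<open>W\<close> +
    \<open>R\<close> \<open>x\<close> contains \<open>b\<close> by maximality. In b = w + r x the
    coefficient \<open>r\<close> is nonzero because \<open>b\<close> is not in \<open>W\<close>, and
    the equation can be solved for \<open>x\<close>.\<close>
  have ex: "\<exists>r\<in>carrier R. x \<oplus>\<^bsub>M\<^esub> \<ominus>\<^bsub>M\<^esub> (r \<odot>\<^bsub>M\<^esub> b) \<in> W" if x: "x \<in> carrier M" for x
  proof (cases "x \<in> W")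
    case True
    then show ?thesis
      using assms(4) x by (intro bexI[of _ "\<zero>\<^bsub>R\<^esub>"]) (auto simp: M.zero_smult M.minus_zero_eq)
  next
    case False
    define Z where "Z = {w \<oplus>\<^bsub>M\<^esub> r \<odot>\<^bsub>M\<^esub> x | w r. w \<in> W \<and> r \<in> carrier R}"
    have "submodule Z R M"
    proof (rule M.submoduleI)
      show "Z \<subseteq> carrier M"
        using Wd(1) x by (auto simp: Z_def intro!: M.smult_closed)
      show "\<zero>\<^bsub>M\<^esub> \<in> Z"
        using Wd(2) x by (auto simp: Z_def M.zero_smult intro!: exI[of _ "\<zero>\<^bsub>M\<^esub>"] exI[of _ "\<zero>\<^bsub>R\<^esub>"])
    next
      fix a y assume a: "a \<in> carrier R" "y \<in> Z"
      then obtain w r where "w \<in> W" "r \<in> carrier R" "y = w \<oplus>\<^bsub>M\<^esub> r \<odot>\<^bsub>M\<^esub> x"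
        by (auto simp: Z_def)
      then have "a \<odot>\<^bsub>M\<^esub> y = a \<odot>\<^bsub>M\<^esub> w \<oplus>\<^bsub>M\<^esub> (a \<otimes>\<^bsub>R\<^esub> r) \<odot>\<^bsub>M\<^esub> x"
        using Wd(1) x a by (auto simp: M.smult_r_distr M.smult_assoc1 M.smult_closed subsetD)
      then show "a \<odot>\<^bsub>M\<^esub> y \<in> Z"
        unfolding Z_def using a \<open>w \<in> W\<close> \<open>r \<in> carrier R\<close> Wd(4) by blast
    next
      fix y z assume "y \<in> Z" "z \<in> Z"
      then obtain w r v s where *: "w \<in> W" "r \<in> carrier R" "y = w \<oplus>\<^bsub>M\<^esub> r \<odot>\<^bsub>M\<^esub> x"
        "v \<in> W" "s \<in> carrier R" "z = v \<oplus>\<^bsub>M\<^esub> s \<odot>\<^bsub>M\<^esub> x"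
        by (auto simp: Z_def)
      then have "w \<in> carrier M" "v \<in> carrier M" "r \<odot>\<^bsub>M\<^esub> x \<in> carrier M" "s \<odot>\<^bsub>M\<^esub> x \<in> carrier M"
        using Wd(1) x by (auto intro: M.smult_closed)
      then have "y \<oplus>\<^bsub>M\<^esub> z = (w \<oplus>\<^bsub>M\<^esub> v) \<oplus>\<^bsub>M\<^esub> (r \<oplus>\<^bsub>R\<^esub> s) \<odot>\<^bsub>M\<^esub> x"
        using * x by (simp add: M.smult_l_distr M.a_ac)
      then show "y \<oplus>\<^bsub>M\<^esub> z \<in> Z"
        unfolding Z_def using * Wd(3) by blast
    qed
    moreover have "W \<subseteq> Z"
    proof
      fix w assume "w \<in> W"
      then have "w = w \<oplus>\<^bsub>M\<^esub> \<zero>\<^bsub>R\<^esub> \<odot>\<^bsub>M\<^esub> x"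
        using Wd(1) x by (auto simp: M.zero_smult)
      then show "w \<in> Z"
        unfolding Z_def using \<open>w \<in> W\<close> by blast
    qed
    moreover have "x = \<zero>\<^bsub>M\<^esub> \<oplus>\<^bsub>M\<^esub> \<one>\<^bsub>R\<^esub> \<odot>\<^bsub>M\<^esub> x"
      using x by (simp add: M.smult_one)
    then have "x \<in> Z"
      unfolding Z_def using Wd(2) by blast
    ultimately have "b \<in> Z"
      using max False by blast
    then obtain w r where wr: "w \<in> W" "r \<in> carrier R" "b = w \<oplus>\<^bsub>M\<^esub> r \<odot>\<^bsub>M\<^esub> x"
      by (auto simp: Z_def)
    have wc: "w \<in> carrier M" using wr Wd(1) by auto
    have "r \<noteq> \<zero>\<^bsub>R\<^esub>"
      using wr W(3) wc x by (auto simp: M.zero_smult)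
    then obtain s where s: "s \<in> carrier R" "s \<otimes>\<^bsub>R\<^esub> r = \<one>\<^bsub>R\<^esub>"
      using unit wr by blast
    have "s \<odot>\<^bsub>M\<^esub> b = s \<odot>\<^bsub>M\<^esub> w \<oplus>\<^bsub>M\<^esub> x"
      using s wr wc x by (simp add: M.smult_r_distr M.smult_closed M.smult_one flip: M.smult_assoc1)
    then have "x \<oplus>\<^bsub>M\<^esub> \<ominus>\<^bsub>M\<^esub> (s \<odot>\<^bsub>M\<^esub> b) = \<ominus>\<^bsub>M\<^esub> (s \<odot>\<^bsub>M\<^esub> w)"
      using s wc x by (simp add: M.minus_add M.smult_closed M.r_neg2 M.a_comm M.r_neg1 M.a_lcomm)
    moreover have "\<ominus>\<^bsub>M\<^esub> (s \<odot>\<^bsub>M\<^esub> w) \<in> W"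
      using s(1) wr(1) Wd(4,5) by blast
    ultimately show ?thesis
      using s(1) by metis
  qed
  \<comment> \<open>Two different coordinates of the same \<open>x\<close> would put a nonzero
    multiple of \<open>b\<close>, and hence \<open>b\<close>, into \<open>W\<close>.\<close>
  have uniq: "r = s" if "r \<in> carrier R" "s \<in> carrier R" "x \<in> carrier M"
    "x \<oplus>\<^bsub>M\<^esub> \<ominus>\<^bsub>M\<^esub> (r \<odot>\<^bsub>M\<^esub> b) \<in> W" "x \<oplus>\<^bsub>M\<^esub> \<ominus>\<^bsub>M\<^esub> (s \<odot>\<^bsub>M\<^esub> b) \<in> W" for r s x
  proof (rule ccontr)
    assume "r \<noteq> s"
    let ?d = "r \<oplus>\<^bsub>R\<^esub> \<ominus>\<^bsub>R\<^esub> s"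
    have d: "?d \<in> carrier R" "?d \<noteq> \<zero>\<^bsub>R\<^esub>"
      using that \<open>r \<noteq> s\<close> by (auto simp: R.r_right_minus_eq simp flip: R.minus_eq)
    have c: "r \<odot>\<^bsub>M\<^esub> b \<in> carrier M" "s \<odot>\<^bsub>M\<^esub> b \<in> carrier M"
      using that assms(4) by (auto intro: M.smult_closed)
    have "(x \<oplus>\<^bsub>M\<^esub> \<ominus>\<^bsub>M\<^esub> (s \<odot>\<^bsub>M\<^esub> b)) \<oplus>\<^bsub>M\<^esub> \<ominus>\<^bsub>M\<^esub> (x \<oplus>\<^bsub>M\<^esub> \<ominus>\<^bsub>M\<^esub> (r \<odot>\<^bsub>M\<^esub> b)) \<in> W"
      using Wd(3,5) that by blast
    also have "(x \<oplus>\<^bsub>M\<^esub> \<ominus>\<^bsub>M\<^esub> (s \<odot>\<^bsub>M\<^esub> b)) \<oplus>\<^bsub>M\<^esub> \<ominus>\<^bsub>M\<^esub> (x \<oplus>\<^bsub>M\<^esub> \<ominus>\<^bsub>M\<^esub> (r \<odot>\<^bsub>M\<^esub> b)) = ?d \<odot>\<^bsub>M\<^esub> b"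
      using that(1-3) c assms(4)
      by (simp add: M.minus_add M.smult_l_distr M.minus_smult M.a_ac M.r_neg1 M.r_neg2)
    finally have "?d \<odot>\<^bsub>M\<^esub> b \<in> W" .
    moreover obtain t where "t \<in> carrier R" "t \<otimes>\<^bsub>R\<^esub> ?d = \<one>\<^bsub>R\<^esub>"
      using unit d by blast
    ultimately have "b \<in> W"
      using Wd(4)[of t "?d \<odot>\<^bsub>M\<^esub> b"] d assms(4) by (simp add: M.smult_one flip: M.smult_assoc1)
    with W show False by simp
  qed
  define \<phi> where "\<phi> x = (THE r. r \<in> carrier R \<and> x \<oplus>\<^bsub>M\<^esub> \<ominus>\<^bsub>M\<^esub> (r \<odot>\<^bsub>M\<^esub> b) \<in> W)" for x
  have phi_eq: "\<phi> x = r" if "x \<in> carrier M" "r \<in> carrier R" "x \<oplus>\<^bsub>M\<^esub> \<ominus>\<^bsub>M\<^esub> (r \<odot>\<^bsub>M\<^esub> b) \<in> W" for x r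
    unfolding \<phi>_def using that uniq by (intro the_equality) blast+
  have phi: "\<phi> x \<in> carrier R" "x \<oplus>\<^bsub>M\<^esub> \<ominus>\<^bsub>M\<^esub> (\<phi> x \<odot>\<^bsub>M\<^esub> b) \<in> W" if "x \<in> carrier M" for x
    using ex[OF that] phi_eq[OF that] by auto
  have add: "\<phi> (x \<oplus>\<^bsub>M\<^esub> y) = \<phi> x \<oplus>\<^bsub>R\<^esub> \<phi> y" if "x \<in> carrier M" "y \<in> carrier M" for x y
  proof (rule phi_eq)
    have c: "\<phi> x \<odot>\<^bsub>M\<^esub> b \<in> carrier M" "\<phi> y \<odot>\<^bsub>M\<^esub> b \<in> carrier M"
      using that assms(4) phi by (auto intro: M.smult_closed)
    have "(x \<oplus>\<^bsub>M\<^esub> y) \<oplus>\<^bsub>M\<^esub> \<ominus>\<^bsub>M\<^esub> ((\<phi> x \<oplus>\<^bsub>R\<^esub> \<phi> y) \<odot>\<^bsub>M\<^esub> b) =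
      (x \<oplus>\<^bsub>M\<^esub> \<ominus>\<^bsub>M\<^esub> (\<phi> x \<odot>\<^bsub>M\<^esub> b)) \<oplus>\<^bsub>M\<^esub> (y \<oplus>\<^bsub>M\<^esub> \<ominus>\<^bsub>M\<^esub> (\<phi> y \<odot>\<^bsub>M\<^esub> b))"
      using that assms(4) phi c by (simp add: M.smult_l_distr M.minus_add M.a_ac)
    then show "(x \<oplus>\<^bsub>M\<^esub> y) \<oplus>\<^bsub>M\<^esub> \<ominus>\<^bsub>M\<^esub> ((\<phi> x \<oplus>\<^bsub>R\<^esub> \<phi> y) \<odot>\<^bsub>M\<^esub> b) \<in> W"
      using phi that Wd(3) by simp
  qed (use that phi in auto)
  have smult: "\<phi> (r \<odot>\<^bsub>M\<^esub> x) = r \<otimes>\<^bsub>R\<^esub> \<phi> x" if "r \<in> carrier R" "x \<in> carrier M" for r x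
  proof (rule phi_eq)
    have c: "\<phi> x \<odot>\<^bsub>M\<^esub> b \<in> carrier M"
      using that assms(4) phi by (auto intro: M.smult_closed)
    have "(r \<odot>\<^bsub>M\<^esub> x) \<oplus>\<^bsub>M\<^esub> \<ominus>\<^bsub>M\<^esub> ((r \<otimes>\<^bsub>R\<^esub> \<phi> x) \<odot>\<^bsub>M\<^esub> b) = r \<odot>\<^bsub>M\<^esub> (x \<oplus>\<^bsub>M\<^esub> \<ominus>\<^bsub>M\<^esub> (\<phi> x \<odot>\<^bsub>M\<^esub> b))"
      using that c phi assms(4) by (simp add: M.smult_r_distr M.smult_minus M.smult_assoc1)
    then show "(r \<odot>\<^bsub>M\<^esub> x) \<oplus>\<^bsub>M\<^esub> \<ominus>\<^bsub>M\<^esub> ((r \<otimes>\<^bsub>R\<^esub> \<phi> x) \<odot>\<^bsub>M\<^esub> b) \<in> W"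
      using phi that Wd(4) by simp
  qed (use that phi in \<open>auto intro: M.smult_closed\<close>)
  show thesis
  proof (rule that)
    show "\<phi> x = \<zero>\<^bsub>R\<^esub>" if "x \<in> U" for x
    proof -
      have "x \<in> W" "x \<in> carrier M"
        using that W(2) Wd(1) by auto
      then show ?thesis
        using assms(4) by (intro phi_eq) (auto simp: M.zero_smult M.minus_zero_eq)
    qed
    show "\<phi> b = \<one>\<^bsub>R\<^esub>"
      using assms(4) Wd(2) by (intro phi_eq) (auto simp: M.smult_one M.r_neg)
    show "\<phi> \<in> functionals R M"
      using phi(1) add smult by (auto simp: functionals_def)
  qed
qed

section \<open>Tensor products\<close>

text \<open>The sum inside \<open>tensor_lift\<close> before a representative is chosen: the
  homomorphism from the free abelian group that extends \<open>\<beta>\<close>.\<close>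

definition frag_eval :: "('w, 'm) ring_scheme \<Rightarrow> ('a \<Rightarrow> 'w) \<Rightarrow> ('a \<Rightarrow>\<^sub>0 int) \<Rightarrow> 'w" where
  "frag_eval M \<beta> c = finsum M (\<lambda>p. [Poly_Mapping.lookup c p] \<cdot>\<^bsub>M\<^esub> \<beta> p) (Poly_Mapping.keys c)"

context abelian_group
begin

lemma frag_eval_superset:
  assumes "finite A" "Poly_Mapping.keys c \<subseteq> A" "\<beta> \<in> A \<rightarrow> carrier G"
  shows "frag_eval G \<beta> c = finsum G (\<lambda>p. [Poly_Mapping.lookup c p] \<cdot> \<beta> p) A"
proof -
  have "add_pow G (0::int) x = \<zero>" for x
    by (simp add: add_pow_def)
  then show ?thesis
    unfolding frag_eval_def
    using assms by (intro add.finprod_mono_neutral_cong_left) (auto simp: in_keys_iff Pi_iff)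
qed

lemma frag_eval_hom:
  assumes "\<beta> \<in> S \<rightarrow> carrier G"
  shows "frag_eval G \<beta> \<in> hom (free_Abelian_group S) (add_monoid G)"
proof (rule homI)
  fix c assume "c \<in> carrier (free_Abelian_group S)"
  then show "frag_eval G \<beta> c \<in> carrier (add_monoid G)"
    using assms unfolding frag_eval_def by (auto intro!: finsum_closed)
next
  fix c d assume cd: "c \<in> carrier (free_Abelian_group S)" "d \<in> carrier (free_Abelian_group S)"
  let ?A = "Poly_Mapping.keys c \<union> Poly_Mapping.keys d"
  have \<beta>: "\<beta> \<in> ?A \<rightarrow> carrier G"
    using assms cd by auto
  have "frag_eval G \<beta> (c + d) = finsum G (\<lambda>p. [Poly_Mapping.lookup (c + d) p] \<cdot> \<beta> p) ?A"
    using \<beta> keys_add[of c d] by (intro frag_eval_superset) auto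
  also have "\<dots> = finsum G (\<lambda>p. [Poly_Mapping.lookup c p] \<cdot> \<beta> p \<oplus> [Poly_Mapping.lookup d p] \<cdot> \<beta> p) ?A"
    using \<beta> by (intro add.finprod_cong') (auto simp: lookup_add add.int_pow_mult Pi_iff)
  also have "\<dots> = finsum G (\<lambda>p. [Poly_Mapping.lookup c p] \<cdot> \<beta> p) ?A \<oplus> finsum G (\<lambda>p. [Poly_Mapping.lookup d p] \<cdot> \<beta> p) ?A"
    using \<beta> by (intro add.finprod_multf) (auto simp: Pi_iff)
  also have "\<dots> = frag_eval G \<beta> c \<oplus> frag_eval G \<beta> d"
    using \<beta> by (simp add: frag_eval_superset[of ?A])
  finally show "frag_eval G \<beta> (c \<otimes>\<^bsub>free_Abelian_group S\<^esub> d) = frag_eval G \<beta> c \<otimes>\<^bsub>add_monoid G\<^esub> frag_eval G \<beta> d"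
    by simp
qed

lemma frag_eval_of: "\<beta> p \<in> carrier G \<Longrightarrow> frag_eval G \<beta> (frag_of p) = \<beta> p"
  by (simp add: frag_eval_def)

lemma frag_eval_add:
  assumes "\<beta> \<in> S \<rightarrow> carrier G" "Poly_Mapping.keys c \<subseteq> S" "Poly_Mapping.keys d \<subseteq> S"
  shows "frag_eval G \<beta> (c + d) = frag_eval G \<beta> c \<oplus> frag_eval G \<beta> d"
  using hom_mult[OF frag_eval_hom[OF assms(1)], of c d] assms by simp

lemma frag_eval_closed:
  assumes "\<beta> \<in> S \<rightarrow> carrier G" "Poly_Mapping.keys c \<subseteq> S"
  shows "frag_eval G \<beta> c \<in> carrier G"
  using hom_in_carrier[OF frag_eval_hom[OF assms(1)], of c] assms by simp

lemma frag_eval_diff: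
  assumes "\<beta> \<in> S \<rightarrow> carrier G" "Poly_Mapping.keys c \<subseteq> S" "Poly_Mapping.keys d \<subseteq> S"
  shows "frag_eval G \<beta> (c - d) = frag_eval G \<beta> c \<ominus> frag_eval G \<beta> d"
proof -
  have k: "Poly_Mapping.keys (c - d) \<subseteq> S"
    using assms keys_diff[of c d] by auto
  have "frag_eval G \<beta> (c - d) \<oplus> frag_eval G \<beta> d = frag_eval G \<beta> c"
    using frag_eval_add[OF assms(1) k assms(3)] by simp
  then show ?thesis
    using frag_eval_closed[OF assms(1)] k assms
    by (metis add.inv_solve_right' minus_eq)
qed

lemma hom_free_eqI:
  assumes "f \<in> hom (free_Abelian_group S) (add_monoid G)" "g \<in> hom (free_Abelian_group S) (add_monoid G)"
    and "\<And>p. p \<in> S \<Longrightarrow> f (frag_of p) = g (frag_of p)" "Poly_Mapping.keys c \<subseteq> S"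
  shows "f c = g c"
proof -
  interpret f: group_hom "free_Abelian_group S" "add_monoid G" f
    using assms(1) by (simp add: group_hom_def group_hom_axioms_def a_group)
  interpret g: group_hom "free_Abelian_group S" "add_monoid G" g
    using assms(2) by (simp add: group_hom_def group_hom_axioms_def a_group)
  from assms(4) show ?thesis
  proof (induction c rule: free_Abelian_group_induct[consumes 1])
    case 1
    then show ?case using f.hom_one g.hom_one by simp
  next
    case (2 x y)
    have "f (x - y) = f x \<oplus> inv\<^bsub>add_monoid G\<^esub> f y" "g (x - y) = g x \<oplus> inv\<^bsub>add_monoid G\<^esub> g y"
      using f.hom_mult[of x "- y"] f.hom_inv[of y] g.hom_mult[of x "- y"] g.hom_inv[of y] 2 by simp_all
    with 2 show ?case by simp
  qed (rule assms(3))
qed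

end

section \<open>The tensor product and its universal property\<close>

locale tensor_product = B: bimodule L R B + V: left_module R V
  for L R :: "'k ring" and B :: "('k, 'b) bimodule" and V :: "('k, 'v) module"
begin

abbreviation "S \<equiv> carrier B \<times> carrier V"
abbreviation "F \<equiv> tensor_free B V"
abbreviation "H \<equiv> tensor_rels R B V"
abbreviation "T \<equiv> tensor R B V"
abbreviation "q \<equiv> tensor_class R B V"
abbreviation "tau b v \<equiv> tensor_class R B V (frag_of (b, v))"

definition balanced :: "('w, 'm) ring_scheme \<Rightarrow> ('b \<times> 'v \<Rightarrow> 'w) \<Rightarrow> bool" where
  "balanced M \<beta> \<longleftrightarrow> abelian_group M \<and> \<beta> \<in> S \<rightarrow> carrier M \<and>
    (\<forall>x\<in>carrier B. \<forall>y\<in>carrier B. \<forall>v\<in>carrier V. \<beta> (x \<oplus>\<^bsub>B\<^esub> y, v) = \<beta> (x, v) \<oplus>\<^bsub>M\<^esub> \<beta> (y, v)) \<and>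
    (\<forall>x\<in>carrier B. \<forall>v\<in>carrier V. \<forall>w\<in>carrier V. \<beta> (x, v \<oplus>\<^bsub>V\<^esub> w) = \<beta> (x, v) \<oplus>\<^bsub>M\<^esub> \<beta> (x, w)) \<and>
    (\<forall>x\<in>carrier B. \<forall>r\<in>carrier R. \<forall>v\<in>carrier V. \<beta> (rsmult B x r, v) = \<beta> (x, r \<odot>\<^bsub>V\<^esub> v))"

lemma F_eq: "F = free_Abelian_group S"
  by (simp add: tensor_free_def)

lemma group_F: "comm_group F"
  by (simp add: F_eq abelian_free_Abelian_group)

lemma keys_diff': "Poly_Mapping.keys a \<subseteq> A \<Longrightarrow> Poly_Mapping.keys b \<subseteq> A \<Longrightarrow> Poly_Mapping.keys (a - b) \<subseteq> A"
  using keys_diff[of a b] by auto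

lemma keys_add': "Poly_Mapping.keys a \<subseteq> A \<Longrightarrow> Poly_Mapping.keys b \<subseteq> A \<Longrightarrow> Poly_Mapping.keys (a + b) \<subseteq> A"
  using keys_add[of a b] by auto

abbreviation "gens \<equiv> {frag_of (x \<oplus>\<^bsub>B\<^esub> y, v) - frag_of (x, v) - frag_of (y, v) | x y v.
         x \<in> carrier B \<and> y \<in> carrier B \<and> v \<in> carrier V} \<union>
      {frag_of (x, v \<oplus>\<^bsub>V\<^esub> w) - frag_of (x, v) - frag_of (x, w) | x v w.
         x \<in> carrier B \<and> v \<in> carrier V \<and> w \<in> carrier V} \<union>
      {frag_of (rsmult B x r, v) - frag_of (x, r \<odot>\<^bsub>V\<^esub> v) | x r v.
         x \<in> carrier B \<and> r \<in> carrier R \<and> v \<in> carrier V}"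

lemma H_eq: "H = generate F gens"
  by (simp only: tensor_rels_def)

lemma gens_carrier: "gens \<subseteq> carrier F"
  unfolding F_eq
  by (intro Un_least subsetI; elim CollectE exE conjE; simp add: keys_diff' V.smult_closed B.rsmult_closed)

lemma subgroup_H: "subgroup H F"
  unfolding H_eq using gens_carrier group_F
  by (intro group.generate_is_subgroup) (auto simp: comm_group_def)

lemma normal_H: "H \<lhd> F"
  using subgroup_H group_F by (simp add: comm_group.normal_iff_subgroup)

lemma carrier_T: "carrier T = q ` carrier F"
  by (simp add: tensor_def Let_def carrier_FactGroup tensor_class_def image_def)

lemma T_simps: "carrier T = carrier (F Mod H)" "s \<oplus>\<^bsub>T\<^esub> t = s \<otimes>\<^bsub>F Mod H\<^esub> t" "\<zero>\<^bsub>T\<^esub> = \<one>\<^bsub>F Mod H\<^esub>"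
  by (simp_all add: tensor_def Let_def)

lemma abelian_group_T: "abelian_group T"
proof -
  interpret Q: comm_group "F Mod H"
    by (rule comm_group.abelian_FactGroup[OF group_F subgroup_H])
  show ?thesis
    by (rule abelian_groupI; unfold T_simps) ((rule Q.m_closed Q.one_closed Q.m_assoc Q.m_comm Q.l_one Q.l_inv_ex; assumption)+)
qed

lemma q_hom: "q \<in> hom F (add_monoid T)"
  using normal.r_coset_hom_Mod[OF normal_H] by (simp add: tensor_class_def[abs_def] hom_def T_simps)

lemma q_add:
  assumes "Poly_Mapping.keys c \<subseteq> S" "Poly_Mapping.keys d \<subseteq> S"
  shows "q (c + d) = q c \<oplus>\<^bsub>T\<^esub> q d"
  using hom_mult[OF q_hom, of c d] assms by (simp add: F_eq)

lemma q_closed: "Poly_Mapping.keys c \<subseteq> S \<Longrightarrow> q c \<in> carrier T"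
  by (auto simp: carrier_T F_eq)

lemma q_zero: "q 0 = \<zero>\<^bsub>T\<^esub>"
proof -
  interpret T: abelian_group T by (rule abelian_group_T)
  show ?thesis
    using q_add[of 0 0] q_closed[of 0] by (metis T.add.r_cancel_one' add.right_neutral keys_zero bot.extremum)
qed

lemma q_diff:
  assumes "Poly_Mapping.keys c \<subseteq> S" "Poly_Mapping.keys d \<subseteq> S"
  shows "q (c - d) = q c \<ominus>\<^bsub>T\<^esub> q d"
proof -
  interpret T: abelian_group T by (rule abelian_group_T)
  have "q (c - d) \<oplus>\<^bsub>T\<^esub> q d = q c"
    using q_add[OF keys_diff'[OF assms] assms(2)] by simp
  then show ?thesis
    using assms q_closed keys_diff'[OF assms] by (metis T.add.inv_solve_right' T.minus_eq)
qed

lemma q_eqI: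
  assumes "Poly_Mapping.keys c \<subseteq> S" "Poly_Mapping.keys d \<subseteq> S" "c - d \<in> gens"
  shows "q c = q d"
proof -
  interpret T: abelian_group T by (rule abelian_group_T)
  have "c - d \<in> carrier F"
    using gens_carrier assms(3) by (rule subsetD)
  moreover have "c - d \<in> H"
    unfolding H_eq using assms(3) by (rule generate.incl)
  ultimately have "q (c - d) = \<zero>\<^bsub>T\<^esub>"
    unfolding tensor_class_def using group_F subgroup_H
    by (subst group.coset_join2) (auto simp: comm_group_def tensor_def Let_def)
  then have "q ((c - d) + d) = \<zero>\<^bsub>T\<^esub> \<oplus>\<^bsub>T\<^esub> q d"
    using q_add[OF keys_diff'[OF assms(1,2)] assms(2)] by simp
  then show ?thesis
    using q_closed[OF assms(2)] by simp
qed

lemma mem_tensor: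
  assumes "t \<in> carrier T" "c \<in> t"
  shows "Poly_Mapping.keys c \<subseteq> S" "t = q c"
proof -
  obtain d where d: "d \<in> carrier F" "t = H #>\<^bsub>F\<^esub> d"
    using assms(1) by (auto simp: carrier_T tensor_class_def)
  have g: "group F" using group_F by (simp add: comm_group_def)
  show "t = q c"
    using group.repr_independence[OF g _ d(1) subgroup_H] assms(2) d(2) by (simp add: tensor_class_def)
  have "c \<in> carrier F"
    using assms(2) d subgroup.elemrcos_carrier[OF subgroup_H g] by blast
  then show "Poly_Mapping.keys c \<subseteq> S" by (simp add: F_eq)
qed

lemma mem_q: "Poly_Mapping.keys c \<subseteq> S \<Longrightarrow> c \<in> q c"
  unfolding tensor_class_def using group_F subgroup_H
  by (intro group.rcos_self) (auto simp: comm_group_def F_eq)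

lemma some_mem: 
  assumes "t \<in> carrier T"
  shows "Poly_Mapping.keys (SOME c. c \<in> t) \<subseteq> S" "q (SOME c. c \<in> t) = t"
proof -
  obtain d where "Poly_Mapping.keys d \<subseteq> S" "t = q d"
    using assms by (auto simp: carrier_T F_eq)
  then have "(SOME c. c \<in> t) \<in> t"
    using mem_q someI by metis
  then show "Poly_Mapping.keys (SOME c. c \<in> t) \<subseteq> S" "q (SOME c. c \<in> t) = t"
    using mem_tensor assms by auto
qed

lemma tau_closed: "b \<in> carrier B \<Longrightarrow> v \<in> carrier V \<Longrightarrow> tau b v \<in> carrier T"
  by (intro q_closed) auto

lemma tau_add_left:
  assumes "b \<in> carrier B" "c \<in> carrier B" "v \<in> carrier V"
  shows "tau (b \<oplus>\<^bsub>B\<^esub> c) v = tau b v \<oplus>\<^bsub>T\<^esub> tau c v"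
proof -
  have "tau (b \<oplus>\<^bsub>B\<^esub> c) v = q (frag_of (b, v) + frag_of (c, v))"
    by (rule q_eqI) (use assms in \<open>auto simp: keys_add' diff_diff_eq[symmetric]\<close>)
  then show ?thesis
    using assms by (simp add: q_add)
qed

lemma tau_add_right:
  assumes "b \<in> carrier B" "v \<in> carrier V" "w \<in> carrier V"
  shows "tau b (v \<oplus>\<^bsub>V\<^esub> w) = tau b v \<oplus>\<^bsub>T\<^esub> tau b w"
proof -
  have "tau b (v \<oplus>\<^bsub>V\<^esub> w) = q (frag_of (b, v) + frag_of (b, w))"
    by (rule q_eqI) (use assms in \<open>auto simp: keys_add' diff_diff_eq[symmetric]\<close>)
  then show ?thesis
    using assms by (simp add: q_add)
qed

lemma tau_balanced:
  assumes "b \<in> carrier B" "r \<in> carrier R" "v \<in> carrier V"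
  shows "tau (rsmult B b r) v = tau b (r \<odot>\<^bsub>V\<^esub> v)"
  by (rule q_eqI) (use assms in \<open>auto simp: B.rsmult_closed V.smult_closed\<close>)

lemma tau_zero_left:
  assumes "v \<in> carrier V"
  shows "tau \<zero>\<^bsub>B\<^esub> v = \<zero>\<^bsub>T\<^esub>"
proof -
  interpret T: abelian_group T by (rule abelian_group_T)
  have "tau \<zero>\<^bsub>B\<^esub> v \<oplus>\<^bsub>T\<^esub> tau \<zero>\<^bsub>B\<^esub> v = tau \<zero>\<^bsub>B\<^esub> v"
    using tau_add_left[of "\<zero>\<^bsub>B\<^esub>" "\<zero>\<^bsub>B\<^esub>" v] assms by simp
  then show ?thesis
    using assms by (simp add: T.add.l_cancel_one tau_closed)
qed

lemma tau_zero_right: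
  assumes "b \<in> carrier B"
  shows "tau b \<zero>\<^bsub>V\<^esub> = \<zero>\<^bsub>T\<^esub>"
proof -
  interpret T: abelian_group T by (rule abelian_group_T)
  have "tau b \<zero>\<^bsub>V\<^esub> \<oplus>\<^bsub>T\<^esub> tau b \<zero>\<^bsub>V\<^esub> = tau b \<zero>\<^bsub>V\<^esub>"
    using tau_add_right[of b "\<zero>\<^bsub>V\<^esub>" "\<zero>\<^bsub>V\<^esub>"] assms by simp
  then show ?thesis
    using assms by (simp add: T.add.l_cancel_one tau_closed)
qed

lemma tau_minus:
  assumes "b \<in> carrier B" "v \<in> carrier V"
  shows "tau (\<ominus>\<^bsub>B\<^esub> b) v = \<ominus>\<^bsub>T\<^esub> tau b v"
proof -
  interpret T: abelian_group T by (rule abelian_group_T)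
  have "tau (\<ominus>\<^bsub>B\<^esub> b) v \<oplus>\<^bsub>T\<^esub> tau b v = \<zero>\<^bsub>T\<^esub>"
    using tau_add_left[of "\<ominus>\<^bsub>B\<^esub> b" b v] assms tau_zero_left by (simp add: B.M.l_neg)
  then show ?thesis
    using assms T.minus_equality tau_closed by simp
qed

lemma frag_sum_keys: "set ps \<subseteq> A \<Longrightarrow> Poly_Mapping.keys (sum_list (map frag_of ps)) \<subseteq> A"
  by (induction ps) (simp_all add: keys_add')

lemma q_list_minus:
  assumes "set ps \<subseteq> S"
  shows "q (sum_list (map frag_of (map (\<lambda>(b, v). (\<ominus>\<^bsub>B\<^esub> b, v)) ps))) = \<ominus>\<^bsub>T\<^esub> q (sum_list (map frag_of ps))"
  using assms
proof (induction ps)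
  interpret T: abelian_group T by (rule abelian_group_T)
  case Nil
  show ?case by (subst eq_commute) (simp add: q_zero)
next
  interpret T: abelian_group T by (rule abelian_group_T)
  case (Cons p ps)
  obtain b v where p: "p = (b, v)" by fastforce
  have k: "Poly_Mapping.keys (sum_list (map frag_of ps)) \<subseteq> S"
    using Cons.prems by (intro frag_sum_keys) auto
  have k': "Poly_Mapping.keys (sum_list (map frag_of (map (\<lambda>(b, v). (\<ominus>\<^bsub>B\<^esub> b, v)) ps))) \<subseteq> S"
    using Cons.prems by (intro frag_sum_keys) auto
  show ?case
    using Cons p k k' by (simp add: q_add tau_minus tau_closed q_closed T.minus_add del: map_map)
qed

lemma q_list:
  assumes "Poly_Mapping.keys c \<subseteq> S"
  shows "\<exists>ps. set ps \<subseteq> S \<and> q c = q (sum_list (map frag_of ps))"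
  using assms
proof (induction c rule: free_Abelian_group_induct[consumes 1])
  case 1
  then show ?case by (intro exI[of _ "[]"]) simp
next
  case (2 x y)
  interpret T: abelian_group T by (rule abelian_group_T)
  obtain ps rs where *: "set ps \<subseteq> S" "q x = q (sum_list (map frag_of ps))"
    "set rs \<subseteq> S" "q y = q (sum_list (map frag_of rs))"
    using 2 by blast
  let ?rs = "map (\<lambda>(b, v). (\<ominus>\<^bsub>B\<^esub> b, v)) rs"
  have rs: "set ?rs \<subseteq> S" using * by auto
  have "q (sum_list (map frag_of (ps @ ?rs))) = q (sum_list (map frag_of ps)) \<oplus>\<^bsub>T\<^esub> q (sum_list (map frag_of ?rs))"
    using q_add[OF frag_sum_keys[OF *(1)] frag_sum_keys[OF rs]] by (simp del: map_map)
  also have "\<dots> = q (x - y)"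
    using * 2 by (simp add: q_list_minus q_diff T.minus_eq del: map_map)
  finally show ?case
    using * rs by (intro exI[of _ "ps @ ?rs"]) (simp del: map_map)
next
  case (3 a)
  then show ?case by (intro exI[of _ "[a]"]) simp
qed

text \<open>This ensures that the choice made in \<open>encode\<close> finds a list. Signs are
  absorbed into the first factors, so a list without coefficients is enough.\<close>

lemma tensor_list:
  assumes "t \<in> carrier T"
  obtains ps where "set ps \<subseteq> S" "t = q (sum_list (map frag_of ps))" "sum_list (map frag_of ps) \<in> t"
proof -
  obtain c where "Poly_Mapping.keys c \<subseteq> S" "t = q c"
    using assms by (auto simp: carrier_T F_eq)
  then show thesis
    using q_list that mem_q frag_sum_keys by metis
qed

lemma tensor_induct [consumes 1, case_names zero tau add]:
  assumes "t \<in> carrier T" "P \<zero>\<^bsub>T\<^esub>" "\<And>b v. b \<in> carrier B \<Longrightarrow> v \<in> carrier V \<Longrightarrow> P (tau b v)"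
    and "\<And>s t. s \<in> carrier T \<Longrightarrow> t \<in> carrier T \<Longrightarrow> P s \<Longrightarrow> P t \<Longrightarrow> P (s \<oplus>\<^bsub>T\<^esub> t)"
  shows "P t"
proof -
  have "P (q (sum_list (map frag_of ps)))" if "set ps \<subseteq> S" for ps
    using that
  proof (induction ps)
    case Nil
    then show ?case using assms(2) by (simp add: q_zero)
  next
    case (Cons p ps)
    then have "Poly_Mapping.keys (sum_list (map frag_of ps)) \<subseteq> S"
      by (intro frag_sum_keys) auto
    with Cons show ?case
      using assms(3,4) by (auto simp: q_add tau_closed q_closed)
  qed
  with tensor_list[OF assms(1)] show ?thesis by metis
qed

text \<open>The kernel of a homomorphism is a subgroup, so it contains all relations once it
  contains the generating ones. For these, vanishing is biadditivity or balance of
  \<open>\<beta>\<close>.\<close>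

lemma frag_eval_rel:
  assumes "balanced M \<beta>" "c \<in> H"
  shows "frag_eval M \<beta> c = \<zero>\<^bsub>M\<^esub>"
proof -
  interpret M: abelian_group M using assms(1) by (simp add: balanced_def)
  have \<beta>: "\<beta> \<in> S \<rightarrow> carrier M" using assms(1) by (simp add: balanced_def)
  have "group_hom F (add_monoid M) (frag_eval M \<beta>)"
    using M.frag_eval_hom[OF \<beta>] group_F by (simp add: group_hom_def group_hom_axioms_def F_eq M.a_group comm_group_def)
  then have sub: "subgroup (kernel F (add_monoid M) (frag_eval M \<beta>)) F"
    by (rule group_hom.subgroup_kernel)
  have diff0: "x \<ominus>\<^bsub>M\<^esub> x = \<zero>\<^bsub>M\<^esub>" if "x \<in> carrier M" for x
    using that by (simp add: M.minus_eq M.r_neg)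
  have diff1: "(x \<oplus>\<^bsub>M\<^esub> y) \<ominus>\<^bsub>M\<^esub> x \<ominus>\<^bsub>M\<^esub> y = \<zero>\<^bsub>M\<^esub>" if "x \<in> carrier M" "y \<in> carrier M" for x y
  proof -
    have "(x \<oplus>\<^bsub>M\<^esub> y) \<ominus>\<^bsub>M\<^esub> x \<ominus>\<^bsub>M\<^esub> y = (x \<oplus>\<^bsub>M\<^esub> y) \<oplus>\<^bsub>M\<^esub> \<ominus>\<^bsub>M\<^esub> (x \<oplus>\<^bsub>M\<^esub> y)"
      using that by (simp add: M.minus_eq M.minus_add M.a_assoc)
    with that show ?thesis by (simp add: M.r_neg)
  qed
  have 1: "frag_eval M \<beta> (frag_of a - frag_of b) = \<beta> a \<ominus>\<^bsub>M\<^esub> \<beta> b" if "a \<in> S" "b \<in> S" for a b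
    using that funcset_mem[OF \<beta>] by (subst M.frag_eval_diff[OF \<beta>]) (simp_all add: M.frag_eval_of)
  have 2: "frag_eval M \<beta> (frag_of a - frag_of b - frag_of d) = \<beta> a \<ominus>\<^bsub>M\<^esub> \<beta> b \<ominus>\<^bsub>M\<^esub> \<beta> d"
    if "a \<in> S" "b \<in> S" "d \<in> S" for a b d
    using that funcset_mem[OF \<beta>] by (subst M.frag_eval_diff[OF \<beta>]) (simp_all add: 1 M.frag_eval_of keys_diff')
  have "frag_eval M \<beta> g = \<zero>\<^bsub>M\<^esub>" if "g \<in> gens" for g
    using that
  proof (elim UnE CollectE exE conjE)
    fix x y v assume g: "g = frag_of (x \<oplus>\<^bsub>B\<^esub> y, v) - frag_of (x, v) - frag_of (y, v)"
      "x \<in> carrier B" "y \<in> carrier B" "v \<in> carrier V"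
    then show ?thesis
      using assms(1) diff1[of "\<beta> (x, v)" "\<beta> (y, v)"] \<beta>
      by (auto simp: 2 balanced_def Pi_iff)
  next
    fix x v w assume g: "g = frag_of (x, v \<oplus>\<^bsub>V\<^esub> w) - frag_of (x, v) - frag_of (x, w)"
      "x \<in> carrier B" "v \<in> carrier V" "w \<in> carrier V"
    then show ?thesis
      using assms(1) diff1[of "\<beta> (x, v)" "\<beta> (x, w)"] \<beta>
      by (auto simp: 2 balanced_def Pi_iff)
  next
    fix x r v assume g: "g = frag_of (rsmult B x r, v) - frag_of (x, r \<odot>\<^bsub>V\<^esub> v)"
      "x \<in> carrier B" "r \<in> carrier R" "v \<in> carrier V"
    then show ?thesis
      using assms(1) diff0[of "\<beta> (rsmult B x r, v)"] \<beta>
      by (auto simp: 1 balanced_def Pi_iff B.rsmult_closed V.smult_closed)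
  qed
  then have "gens \<subseteq> kernel F (add_monoid M) (frag_eval M \<beta>)"
    unfolding kernel_def by (intro subsetI CollectI conjI subsetD[OF gens_carrier]) simp_all
  then have "H \<subseteq> kernel F (add_monoid M) (frag_eval M \<beta>)"
    unfolding H_eq using group.generate_subgroup_incl[OF _ _ sub] group_F by (simp add: comm_group_def)
  with assms(2) show ?thesis by (auto simp: kernel_def)
qed

text \<open>The representative chosen in \<open>tensor_lift\<close> differs from \<open>c\<close> by
  a relation, where \<open>frag_eval\<close> is zero.\<close>

lemma tensor_lift_q:
  assumes "balanced M \<beta>" "Poly_Mapping.keys c \<subseteq> S"
  shows "tensor_lift M \<beta> (q c) = frag_eval M \<beta> c"
proof -
  interpret M: abelian_group M using assms(1) by (simp add: balanced_def)
  have \<beta>: "\<beta> \<in> S \<rightarrow> carrier M" using assms(1) by (simp add: balanced_def)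
  define d where "d = (SOME d. d \<in> q c)"
  have d: "Poly_Mapping.keys d \<subseteq> S" "q d = q c"
    using some_mem[OF q_closed[OF assms(2)]] by (auto simp: d_def)
  have "d \<in> q c"
    using mem_q d by metis
  then obtain h where h: "h \<in> H" "d = h + c"
    by (auto simp: tensor_class_def r_coset_def F_eq)
  have "Poly_Mapping.keys h \<subseteq> S"
    using subsetD[OF subgroup.subset[OF subgroup_H] h(1)] by (simp add: F_eq)
  then have "frag_eval M \<beta> d = frag_eval M \<beta> c"
    using h assms M.frag_eval_add[OF \<beta>, of h c] frag_eval_rel[OF assms(1) h(1)] M.frag_eval_closed[OF \<beta>] by simp
  then show ?thesis
    unfolding tensor_lift_def Let_def d_def[symmetric] by (simp add: frag_eval_def)
qed

lemma tensor_lift_closed: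
  assumes "balanced M \<beta>" "t \<in> carrier T"
  shows "tensor_lift M \<beta> t \<in> carrier M"
  using assms abelian_group.frag_eval_closed[of M \<beta> S]
  by (auto simp: carrier_T F_eq tensor_lift_q balanced_def)

lemma tensor_lift_add:
  assumes "balanced M \<beta>" "s \<in> carrier T" "t \<in> carrier T"
  shows "tensor_lift M \<beta> (s \<oplus>\<^bsub>T\<^esub> t) = tensor_lift M \<beta> s \<oplus>\<^bsub>M\<^esub> tensor_lift M \<beta> t"
proof -
  obtain c d where "Poly_Mapping.keys c \<subseteq> S" "s = q c" "Poly_Mapping.keys d \<subseteq> S" "t = q d"
    using assms by (auto simp: carrier_T F_eq)
  then show ?thesis
    using assms abelian_group.frag_eval_add[of M \<beta> S c d]
    by (auto simp: tensor_lift_q keys_add' balanced_def simp flip: q_add)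
qed

lemma tensor_lift_tau:
  assumes "balanced M \<beta>" "b \<in> carrier B" "v \<in> carrier V"
  shows "tensor_lift M \<beta> (tau b v) = \<beta> (b, v)"
  using assms abelian_group.frag_eval_of[of M \<beta> "(b, v)"]
  by (auto simp: tensor_lift_q balanced_def)

lemma tensor_lift_zero:
  assumes "balanced M \<beta>"
  shows "tensor_lift M \<beta> \<zero>\<^bsub>T\<^esub> = \<zero>\<^bsub>M\<^esub>"
  using assms by (simp add: tensor_lift_q frag_eval_def abelian_monoid.finsum_empty balanced_def abelian_group.axioms(1) flip: q_zero)

lemma balanced_smult:
  assumes "a \<in> carrier L"
  shows "balanced T (\<lambda>(x, v). tau (a \<odot>\<^bsub>B\<^esub> x) v)"
  unfolding balanced_def using assms
  by (auto simp: abelian_group_T tau_closed B.smult_closed B.smult_r_distr tau_add_left tau_add_right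
      B.smult_rsmult[symmetric] tau_balanced)

text \<open>The scalar action of \<open>tensor\<close> is defined through a chosen representative.
  Written as a lift it falls under the universal property, from which the module axioms
  follow.\<close>

lemma smult_T:
  assumes "a \<in> carrier L" "t \<in> carrier T"
  shows "a \<odot>\<^bsub>T\<^esub> t = tensor_lift T (\<lambda>(x, v). tau (a \<odot>\<^bsub>B\<^esub> x) v) t"
proof -
  interpret T: abelian_group T by (rule abelian_group_T)
  let ?g = "\<lambda>(x, v). frag_of (a \<odot>\<^bsub>B\<^esub> x, v)" and ?\<beta> = "\<lambda>(x, v). tau (a \<odot>\<^bsub>B\<^esub> x) v"
  define c where "c = (SOME c. c \<in> t)"
  have c: "Poly_Mapping.keys c \<subseteq> S"
    using some_mem[OF assms(2)] by (simp add: c_def)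
  have \<beta>: "?\<beta> \<in> S \<rightarrow> carrier T"
    using balanced_smult[OF assms(1)] by (simp add: balanced_def)
  have k: "Poly_Mapping.keys (frag_extend ?g d) \<subseteq> S" if "Poly_Mapping.keys d \<subseteq> S" for d
    using keys_frag_extend[of ?g d] that assms(1) by (fastforce simp: B.smult_closed)
  have "(\<lambda>c. q (frag_extend ?g c)) \<in> hom (free_Abelian_group S) (add_monoid T)"
    by (rule homI) (simp_all add: q_closed k frag_extend_add q_add)
  then have "q (frag_extend ?g c) = frag_eval T ?\<beta> c"
    by (rule T.hom_free_eqI[OF _ T.frag_eval_hom[OF \<beta>] _ c]) (use \<beta> in \<open>auto simp: T.frag_eval_of Pi_iff\<close>)
  then show ?thesis
    by (simp add: tensor_def Let_def tensor_lift_def frag_eval_def c_def)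
qed

lemma smult_tau:
  assumes "a \<in> carrier L" "b \<in> carrier B" "v \<in> carrier V"
  shows "a \<odot>\<^bsub>T\<^esub> tau b v = tau (a \<odot>\<^bsub>B\<^esub> b) v"
  using assms tensor_lift_tau[OF balanced_smult] by (simp add: smult_T tau_closed)

lemma left_module_T: "left_module L T"
proof -
  interpret T: abelian_group T by (rule abelian_group_T)
  have closed: "a \<odot>\<^bsub>T\<^esub> t \<in> carrier T" if "a \<in> carrier L" "t \<in> carrier T" for a t
    using that tensor_lift_closed[OF balanced_smult] by (simp add: smult_T)
  have add: "a \<odot>\<^bsub>T\<^esub> (s \<oplus>\<^bsub>T\<^esub> t) = a \<odot>\<^bsub>T\<^esub> s \<oplus>\<^bsub>T\<^esub> a \<odot>\<^bsub>T\<^esub> t" if "a \<in> carrier L" "s \<in> carrier T" "t \<in> carrier T" for a s t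
    using that tensor_lift_add[OF balanced_smult] by (simp add: smult_T)
  have zero: "a \<odot>\<^bsub>T\<^esub> \<zero>\<^bsub>T\<^esub> = \<zero>\<^bsub>T\<^esub>" if "a \<in> carrier L" for a
    using that tensor_lift_zero[OF balanced_smult] by (simp add: smult_T)
  note c = closed B.smult_closed tau_closed
  show ?thesis
  proof (intro left_module.intro left_module_axioms.intro abelian_group_T B.R.ring_axioms closed add)
    fix a b x assume ab: "a \<in> carrier L" "b \<in> carrier L" and x: "x \<in> carrier T"
    show "(a \<oplus>\<^bsub>L\<^esub> b) \<odot>\<^bsub>T\<^esub> x = a \<odot>\<^bsub>T\<^esub> x \<oplus>\<^bsub>T\<^esub> b \<odot>\<^bsub>T\<^esub> x"
      using x by (induction x rule: tensor_induct)
        (use ab in \<open>simp_all add: zero smult_tau tau_add_left B.smult_l_distr add c T.a_ac\<close>)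
    show "(a \<otimes>\<^bsub>L\<^esub> b) \<odot>\<^bsub>T\<^esub> x = a \<odot>\<^bsub>T\<^esub> (b \<odot>\<^bsub>T\<^esub> x)"
      using x by (induction x rule: tensor_induct)
        (use ab in \<open>simp_all add: zero smult_tau B.smult_assoc1 add c\<close>)
  next
    fix x assume x: "x \<in> carrier T"
    show "\<one>\<^bsub>L\<^esub> \<odot>\<^bsub>T\<^esub> x = x"
      using x by (induction x rule: tensor_induct) (simp_all add: zero smult_tau B.smult_one add c)
  qed
qed

lemma tensor_lift_linear:
  fixes N :: "('k, 'w, 'n) module_scheme"
  assumes "balanced N \<beta>" "left_module L N"
    and "\<And>a x v. a \<in> carrier L \<Longrightarrow> x \<in> carrier B \<Longrightarrow> v \<in> carrier V \<Longrightarrow> \<beta> (a \<odot>\<^bsub>B\<^esub> x, v) = a \<odot>\<^bsub>N\<^esub> \<beta> (x, v)"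
  shows "tensor_lift N \<beta> \<in> left_linear L T N"
proof (rule left_linearI)
  interpret T: left_module L T by (rule left_module_T)
  interpret N: left_module L N by fact
  fix a t assume a: "a \<in> carrier L" and t: "t \<in> carrier T"
  show "tensor_lift N \<beta> (a \<odot>\<^bsub>T\<^esub> t) = a \<odot>\<^bsub>N\<^esub> tensor_lift N \<beta> t"
    using t by (induction t rule: tensor_induct)
      (use a assms in \<open>simp_all add: T.smult_zero N.smult_zero tensor_lift_zero smult_tau tensor_lift_tau
        B.smult_closed T.smult_r_distr N.smult_r_distr tensor_lift_add T.smult_closed tensor_lift_closed\<close>)
qed (fact tensor_lift_closed[OF assms(1)] tensor_lift_add[OF assms(1)])+

lemma linear_eqI:
  assumes "f \<in> left_linear L T N" "g \<in> left_linear L T N" "left_module L N"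
    and "\<And>b v. b \<in> carrier B \<Longrightarrow> v \<in> carrier V \<Longrightarrow> f (tau b v) = g (tau b v)" "t \<in> carrier T"
  shows "f t = g t"
  using assms(5)
proof (induction t rule: tensor_induct)
  case zero
  then show ?case
    using left_linear_zero[OF _ left_module_T] assms by metis
next
  case (add s t)
  then show ?case
    using assms(1,2) by (simp add: left_linearD)
qed (use assms in auto)


section \<open>Functionals on the bimodule separate tensors\<close>

abbreviation ev :: "('b \<Rightarrow> 'k) \<Rightarrow> ('b, 'v) tens \<Rightarrow> 'v" where
  "ev \<phi> \<equiv> tensor_lift V (\<lambda>(b, v). \<phi> b \<odot>\<^bsub>V\<^esub> v)"

lemma right_dualD:
  assumes "\<phi> \<in> carrier (right_dual L R B)"
  shows "x \<in> carrier B \<Longrightarrow> \<phi> x \<in> carrier R"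
    "x \<in> carrier B \<Longrightarrow> y \<in> carrier B \<Longrightarrow> \<phi> (x \<oplus>\<^bsub>B\<^esub> y) = \<phi> x \<oplus>\<^bsub>R\<^esub> \<phi> y"
    "x \<in> carrier B \<Longrightarrow> r \<in> carrier R \<Longrightarrow> \<phi> (rsmult B x r) = \<phi> x \<otimes>\<^bsub>R\<^esub> r"
  using assms by (auto simp: right_dual_def)

text \<open>\<open>ev \<phi>\<close> is \<phi> \<otimes> 1 followed by the identification of R
  \<otimes> V with V. Right linearity of \<open>\<phi>\<close> is what makes it balanced.\<close>

lemma balanced_ev:
  assumes "\<phi> \<in> carrier (right_dual L R B)"
  shows "balanced V (\<lambda>(b, v). \<phi> b \<odot>\<^bsub>V\<^esub> v)"
  unfolding balanced_def using right_dualD[OF assms] V.M.abelian_group_axioms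
  by (auto simp: V.smult_closed V.smult_l_distr V.smult_r_distr V.smult_assoc1)

lemmas ev_tau = tensor_lift_tau[OF balanced_ev, simplified]
  and ev_add = tensor_lift_add[OF balanced_ev]
  and ev_zero = tensor_lift_zero[OF balanced_ev]
  and ev_closed = tensor_lift_closed[OF balanced_ev]

text \<open>A right \<open>R\<close>-space is a left space over the opposite ring, which is again a
  skew field. So \<open>functional_extension\<close> applies with the multiplication of
  \<open>R\<close> reversed.\<close>

lemma functional_extension_right:
  assumes "skew_field R" "b \<in> carrier B" "b \<notin> U" "U \<subseteq> carrier B" "\<zero>\<^bsub>B\<^esub> \<in> U"
    "\<And>x y. x \<in> U \<Longrightarrow> y \<in> U \<Longrightarrow> x \<oplus>\<^bsub>B\<^esub> y \<in> U"
    "\<And>r x. r \<in> carrier R \<Longrightarrow> x \<in> U \<Longrightarrow> rsmult B x r \<in> U"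
  obtains \<phi> where "\<phi> \<in> carrier (right_dual L R B)" "\<And>x. x \<in> U \<Longrightarrow> \<phi> x = \<zero>\<^bsub>R\<^esub>" "\<phi> b = \<one>\<^bsub>R\<^esub>"
proof -
  let ?R = "R\<lparr>monoid.mult := \<lambda>a b. b \<otimes>\<^bsub>R\<^esub> a\<rparr>"
  let ?B = "\<lparr>carrier = carrier B, monoid.mult = undefined, one = undefined, ring.zero = \<zero>\<^bsub>B\<^esub>, add = add B,
    smult = (\<lambda>r x. rsmult B x r)\<rparr>"
  interpret R: skew_field R by fact
  have "ring ?R"
  proof (rule ringI)
    show "abelian_group ?R"
    proof (rule abelian_groupI)
      fix x assume "x \<in> carrier ?R"
      then show "\<exists>y\<in>carrier ?R. y \<oplus>\<^bsub>?R\<^esub> x = \<zero>\<^bsub>?R\<^esub>"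
        by (intro bexI[of _ "\<ominus>\<^bsub>R\<^esub> x"]) (auto simp: B.S.l_neg)
    qed (auto simp: B.S.a_ac)
    show "monoid ?R"
      by (rule monoidI) (auto simp: B.S.m_assoc)
  qed (auto simp: B.S.l_distr B.S.r_distr)
  have "Units ?R = Units R"
    by (auto simp: Units_def)
  with R.Units_eq R.one_not_zero have "skew_field ?R"
    using \<open>ring ?R\<close> by (simp add: skew_field_def skew_field_axioms_def)
  have zero: "rsmult B x \<zero>\<^bsub>R\<^esub> = \<zero>\<^bsub>B\<^esub>" if x: "x \<in> carrier B" for x
  proof -
    have "rsmult B x \<zero>\<^bsub>R\<^esub> \<oplus>\<^bsub>B\<^esub> rsmult B x \<zero>\<^bsub>R\<^esub> = rsmult B x \<zero>\<^bsub>R\<^esub>"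
      using B.rsmult_r_distr[of x "\<zero>\<^bsub>R\<^esub>" "\<zero>\<^bsub>R\<^esub>"] x by simp
    then show ?thesis
      using x by (simp add: B.M.add.l_cancel_one B.rsmult_closed)
  qed
  have "left_module ?R ?B"
    by (rule left_moduleI)
      (use \<open>ring ?R\<close> in \<open>auto simp: B.M.a_ac B.rsmult_closed B.rsmult_l_distr B.rsmult_r_distr B.rsmult_assoc
        B.rsmult_one zero\<close>)
  moreover have "submodule U ?R ?B"
    by (rule left_module.submoduleI[OF \<open>left_module ?R ?B\<close>]) (use assms in auto)
  ultimately obtain \<phi> where phi: "\<phi> \<in> functionals ?R ?B" "\<And>x. x \<in> U \<Longrightarrow> \<phi> x = \<zero>\<^bsub>R\<^esub>" "\<phi> b = \<one>\<^bsub>R\<^esub>"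
    using functional_extension[OF \<open>skew_field ?R\<close>, of ?B U b] assms by auto
  show thesis
  proof (rule that)
    show "restrict \<phi> (carrier B) \<in> carrier (right_dual L R B)"
      using phi(1) by (auto simp: functionals_def right_dual_def B.rsmult_closed Pi_iff)
  qed (use phi assms in auto)
qed

text \<open>The factors are kept in two lists so that \<open>bs\<close> can be held fixed while
  \<open>vs\<close> varies. For fixed \<open>bs\<close> the values form a subgroup, into which
  further pure tensors may be absorbed.\<close>

definition pure_sum :: "'b list \<Rightarrow> 'v list \<Rightarrow> ('b, 'v) tens" where
  "pure_sum bs vs = q (sum_list (map frag_of (zip bs vs)))"

lemma pure_sum_Nil: "pure_sum [] vs = \<zero>\<^bsub>T\<^esub>"
  by (simp add: pure_sum_def q_zero)

lemma zip_keys: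
  assumes "set bs \<subseteq> carrier B" "set vs \<subseteq> carrier V"
  shows "Poly_Mapping.keys (sum_list (map frag_of (zip bs vs))) \<subseteq> S"
  using assms by (intro frag_sum_keys) (auto dest: set_zip_leftD set_zip_rightD)

lemma pure_sum_closed:
  assumes "set bs \<subseteq> carrier B" "set vs \<subseteq> carrier V"
  shows "pure_sum bs vs \<in> carrier T"
  unfolding pure_sum_def using zip_keys[OF assms] by (rule q_closed)

lemma pure_sum_Cons:
  assumes "set (b # bs) \<subseteq> carrier B" "set (v # vs) \<subseteq> carrier V"
  shows "pure_sum (b # bs) (v # vs) = tau b v \<oplus>\<^bsub>T\<^esub> pure_sum bs vs"
  using assms zip_keys[of bs vs] by (simp add: pure_sum_def q_add)

lemma pure_sum_add:
  assumes "length vs = length bs" "length ws = length bs"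
    "set bs \<subseteq> carrier B" "set vs \<subseteq> carrier V" "set ws \<subseteq> carrier V"
  shows "\<exists>us. length us = length bs \<and> set us \<subseteq> carrier V \<and> pure_sum bs us = pure_sum bs vs \<oplus>\<^bsub>T\<^esub> pure_sum bs ws"
  using assms
proof (induction bs arbitrary: vs ws)
  interpret T: abelian_group T by (rule abelian_group_T)
  case Nil
  then show ?case by (simp add: pure_sum_Nil)
next
  interpret T: abelian_group T by (rule abelian_group_T)
  case (Cons b bs)
  obtain v vs' w ws' where [simp]: "vs = v # vs'" "ws = w # ws'"
    using Cons.prems by (metis length_Suc_conv list.size(4) add.right_neutral add_Suc_right)
  obtain us where us: "length us = length bs" "set us \<subseteq> carrier V" "pure_sum bs us = pure_sum bs vs' \<oplus>\<^bsub>T\<^esub> pure_sum bs ws'"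
    using Cons.IH[of vs' ws'] Cons.prems by auto
  have "pure_sum bs vs' \<in> carrier T" "pure_sum bs ws' \<in> carrier T"
    using Cons.prems by (auto intro!: pure_sum_closed)
  then have "pure_sum (b # bs) ((v \<oplus>\<^bsub>V\<^esub> w) # us) = pure_sum (b # bs) vs \<oplus>\<^bsub>T\<^esub> pure_sum (b # bs) ws"
    using Cons.prems us by (simp add: pure_sum_Cons tau_add_right tau_closed T.a_ac)
  then show ?case
    using us Cons.prems by (intro exI[of _ "(v \<oplus>\<^bsub>V\<^esub> w) # us"]) auto
qed

lemma pure_sum_replicate_zero:
  assumes "set bs \<subseteq> carrier B"
  shows "pure_sum bs (replicate (length bs) \<zero>\<^bsub>V\<^esub>) = \<zero>\<^bsub>T\<^esub>"
  using assms
proof (induction bs)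
  interpret T: abelian_group T by (rule abelian_group_T)
  case (Cons b bs)
  then show ?case
    by (simp add: pure_sum_Cons[of b bs] set_replicate_conv_if tau_zero_right)
qed (simp add: pure_sum_Nil)

lemma pure_sum_mem:
  assumes "set bs \<subseteq> carrier B" "b \<in> set bs" "v \<in> carrier V"
  shows "\<exists>us. length us = length bs \<and> set us \<subseteq> carrier V \<and> pure_sum bs us = tau b v"
  using assms
proof (induction bs)
  interpret T: abelian_group T by (rule abelian_group_T)
  case (Cons c bs)
  show ?case
  proof (cases "b = c")
    case True
    then show ?thesis
      using Cons.prems by (intro exI[of _ "v # replicate (length bs) \<zero>\<^bsub>V\<^esub>"])
        (simp add: pure_sum_Cons set_replicate_conv_if pure_sum_replicate_zero tau_closed)
  next
    case False
    then obtain us where "length us = length bs" "set us \<subseteq> carrier V" "pure_sum bs us = tau b v"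
      using Cons by auto
    then show ?thesis
      using Cons.prems by (intro exI[of _ "\<zero>\<^bsub>V\<^esub> # us"]) (auto simp: pure_sum_Cons tau_zero_right tau_closed)
  qed
qed simp

text \<open>
  Induction on the number of pure tensors: either \<open>b \<otimes> v\<close> can be absorbed into the others for all \<open>v\<close>,
  or a functional vanishes on the other elements of \<open>B\<close> but not on \<open>b\<close>.
\<close>

lemma functionals_separate_aux:
  assumes "skew_field R" "set bs \<subseteq> carrier B" "set vs \<subseteq> carrier V" "length vs = length bs"
    and "\<And>\<phi>. \<phi> \<in> carrier (right_dual L R B) \<Longrightarrow> ev \<phi> (pure_sum bs vs) = \<zero>\<^bsub>V\<^esub>"
  shows "pure_sum bs vs = \<zero>\<^bsub>T\<^esub>"
  using assms(2-)
proof (induction bs arbitrary: vs)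
  case Nil
  then show ?case by (simp add: pure_sum_Nil)
next
  interpret T: abelian_group T by (rule abelian_group_T)
  case (Cons b bs)
  then obtain v ws where vs: "vs = v # ws" "length ws = length bs"
    by (metis length_Suc_conv)
  \<comment> \<open>The elements \<open>c\<close> of \<open>B\<close> such that every pure tensor
    starting with \<open>c\<close> can be rewritten with the first factors \<open>bs\<close>. They
    form a right subspace that contains \<open>bs\<close>.\<close>
  define U where "U = {c \<in> carrier B. \<forall>v\<in>carrier V. \<exists>us. length us = length bs \<and> set us \<subseteq> carrier V \<and> pure_sum bs us = tau c v}"
  have b: "b \<in> carrier B" "set bs \<subseteq> carrier B" "v \<in> carrier V" "set ws \<subseteq> carrier V"
    using Cons.prems vs by auto
  have eq: "pure_sum (b # bs) vs = tau b v \<oplus>\<^bsub>T\<^esub> pure_sum bs ws"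
    using b vs by (simp add: pure_sum_Cons)
  have bsU: "set bs \<subseteq> U"
    using pure_sum_mem b by (auto simp: U_def)
  show ?case
  proof (cases "b \<in> U")
    case True
    then obtain us where us: "length us = length bs" "set us \<subseteq> carrier V" "pure_sum bs us = tau b v"
      using b by (auto simp: U_def)
    obtain xs where "length xs = length bs" "set xs \<subseteq> carrier V" "pure_sum bs xs = pure_sum bs us \<oplus>\<^bsub>T\<^esub> pure_sum bs ws"
      using pure_sum_add[OF us(1) vs(2) b(2) us(2) b(4)] by blast
    then show ?thesis
      using Cons.IH[of xs] Cons.prems(4) b us eq by simp
  next
    case False
    obtain \<phi> where phi: "\<phi> \<in> carrier (right_dual L R B)" "\<And>x. x \<in> U \<Longrightarrow> \<phi> x = \<zero>\<^bsub>R\<^esub>" "\<phi> b = \<one>\<^bsub>R\<^esub>"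
    proof (rule functional_extension_right[OF assms(1) b(1) False])
      show "U \<subseteq> carrier B" by (auto simp: U_def)
      show "\<zero>\<^bsub>B\<^esub> \<in> U"
        using pure_sum_replicate_zero[OF b(2)]
        by (auto simp: U_def tau_zero_left intro!: exI[of _ "replicate (length bs) \<zero>\<^bsub>V\<^esub>"])
      show "x \<oplus>\<^bsub>B\<^esub> y \<in> U" if "x \<in> U" "y \<in> U" for x y
      proof -
        have "\<exists>us. length us = length bs \<and> set us \<subseteq> carrier V \<and> pure_sum bs us = tau (x \<oplus>\<^bsub>B\<^esub> y) v" if v: "v \<in> carrier V" for v
        proof -
          obtain us where us: "length us = length bs" "set us \<subseteq> carrier V" "pure_sum bs us = tau x v"
            using \<open>x \<in> U\<close> v by (auto simp: U_def)
          obtain ws where ws: "length ws = length bs" "set ws \<subseteq> carrier V" "pure_sum bs ws = tau y v"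
            using \<open>y \<in> U\<close> v by (auto simp: U_def)
          show ?thesis
            using pure_sum_add[OF us(1) ws(1) b(2) us(2) ws(2)] us ws v that \<open>x \<in> U\<close> \<open>y \<in> U\<close>
            by (auto simp: tau_add_left U_def)
        qed
        then show ?thesis using that by (auto simp: U_def)
      qed
      show "rsmult B x r \<in> U" if "r \<in> carrier R" "x \<in> U" for r x
        using that by (auto simp: U_def tau_balanced B.rsmult_closed V.smult_closed)
    qed blast
    have "ev \<phi> (pure_sum cs us) = \<zero>\<^bsub>V\<^esub>" if "set cs \<subseteq> U" "set us \<subseteq> carrier V" "length us = length cs" for cs us
      using that
    proof (induction cs arbitrary: us)
      case Nil
      then show ?case using phi by (simp add: pure_sum_Nil ev_zero)
    next
      case (Cons c cs)
      then obtain u us' where us: "us = u # us'" "length us' = length cs"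
        by (metis length_Suc_conv)
      have "set cs \<subseteq> carrier B" "c \<in> carrier B"
        using Cons.prems by (auto simp: U_def)
      then show ?case
        using Cons us phi by (simp add: pure_sum_Cons ev_add tau_closed pure_sum_closed ev_tau V.zero_smult)
    qed
    \<comment> \<open>As \<open>\<phi>\<close> vanishes on \<open>bs\<close> and is one at
      \<open>b\<close>, evaluation returns \<open>v\<close>. By hypothesis the result is zero, so
      the first pure tensor drops out and the induction hypothesis applies to the rest.\<close>
    from this[OF bsU b(4) vs(2)] have "ev \<phi> (pure_sum (b # bs) vs) = v"
      using b phi by (simp add: eq ev_add tau_closed pure_sum_closed ev_tau V.smult_one)
    then have "v = \<zero>\<^bsub>V\<^esub>"
      using Cons.prems(4)[OF phi(1)] by simp
    then have "pure_sum (b # bs) vs = pure_sum bs ws"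
      using eq b by (simp add: tau_zero_right pure_sum_closed)
    then show ?thesis
      using Cons.IH[of ws] Cons.prems(4) b vs by simp
  qed
qed

lemma functionals_separate:
  assumes "skew_field R" "t \<in> carrier T"
    and "\<And>\<phi>. \<phi> \<in> carrier (right_dual L R B) \<Longrightarrow> ev \<phi> t = \<zero>\<^bsub>V\<^esub>"
  shows "t = \<zero>\<^bsub>T\<^esub>"
proof -
  obtain ps where ps: "set ps \<subseteq> S" "t = q (sum_list (map frag_of ps))"
    using tensor_list[OF assms(2)] by metis
  have "t = pure_sum (map fst ps) (map snd ps)"
    using ps by (simp add: pure_sum_def zip_map_fst_snd)
  moreover have "set (map fst ps) \<subseteq> carrier B" "set (map snd ps) \<subseteq> carrier V"
    using ps(1) by auto
  ultimately show ?thesis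
    using functionals_separate_aux[OF assms(1)] assms(3) by simp
qed

lemma tensor_map_linear:
  fixes W :: "('k, 'w) module"
  assumes "left_module R W" "\<phi> \<in> left_linear R V W"
  shows "tensor_map R B W \<phi> \<in> left_linear L T (tensor R B W)"
    and "b \<in> carrier B \<Longrightarrow> v \<in> carrier V \<Longrightarrow>
      tensor_map R B W \<phi> (tau b v) = tensor_class R B W (frag_of (b, \<phi> v))"
proof -
  interpret W: tensor_product L R B W
    using assms B.bimodule_axioms by (simp add: tensor_product_def)
  note lin = left_linearD[OF assms(2)]
  have bal: "balanced W.T (\<lambda>(x, v). W.tau x (\<phi> v))"
    unfolding balanced_def
    by (auto simp: W.abelian_group_T W.tau_closed lin W.tau_add_left W.tau_add_right W.tau_balanced)
  show "tensor_map R B W \<phi> \<in> left_linear L T (tensor R B W)"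
    unfolding tensor_map_def
    by (rule tensor_lift_linear[OF bal W.left_module_T]) (simp add: W.smult_tau lin)
  show "tensor_map R B W \<phi> (tau b v) = tensor_class R B W (frag_of (b, \<phi> v))" if "b \<in> carrier B" "v \<in> carrier V"
    unfolding tensor_map_def using tensor_lift_tau[OF bal that] by simp
qed

text \<open>Naturality of \<phi> \<otimes> 1 in the second factor. It makes reflected arrows commute
  with morphisms and carries injectivity through tensor products.\<close>

lemma ev_tensor_map:
  fixes W :: "('k, 'w) module"
  assumes "left_module R W" "\<psi> \<in> left_linear R V W" "\<phi> \<in> carrier (right_dual L R B)" "t \<in> carrier T"
  shows "tensor_lift W (\<lambda>(b, v). \<phi> b \<odot>\<^bsub>W\<^esub> v) (tensor_map R B W \<psi> t) = \<psi> (ev \<phi> t)"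
  using assms(4)
proof (induction t rule: tensor_induct)
  interpret W: tensor_product L R B W
    using assms B.bimodule_axioms by (simp add: tensor_product_def)
  note lin = left_linearD[OF assms(2)]
  note map = tensor_map_linear[OF assms(1,2)]
  {
    case zero
    then show ?case
      using left_linear_zero[OF map(1) left_module_T W.left_module_T] left_linear_zero[OF assms(2)] assms
      by (simp add: ev_zero W.ev_zero V.left_module_axioms)
  next
    case (tau b v)
    then show ?case
      using assms by (simp add: map lin W.ev_tau ev_tau right_dualD)
  next
    case (add s t)
    then show ?case
      using assms left_linearD[OF map(1)] by (simp add: lin ev_add W.ev_add ev_closed)
  }
qed

end

section \<open>Reflections\<close>

text \<open>Finite dimension plays no role for reflections, so it is not tracked through them.\<close>

definition wrep ::
    "('i, 'k, 'b, 'c) modulation \<Rightarrow> ('i \<times> 'i) set \<Rightarrow> ('i, 'k, 'b, 'v) rep \<Rightarrow> bool" where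
  "wrep G \<Lambda> M \<longleftrightarrow> (\<forall>i. left_module (dring G i) (space M i)) \<and>
     (\<forall>(i, j)\<in>\<Lambda>. arrow_map M i j \<in> left_linear (dring G j) (ten G j i (space M i)) (space M j))"

lemma is_rep_wrep: "is_rep G \<Lambda> M \<Longrightarrow> wrep G \<Lambda> M"
  by (auto simp: is_rep_def wrep_def)

abbreviation pure ::
    "('i, 'k, 'b, 'c) modulation \<Rightarrow> 'i \<Rightarrow> 'i \<Rightarrow> ('k, 'v) module \<Rightarrow> 'b \<Rightarrow> 'v \<Rightarrow> ('b, 'v) tens" where
  "pure G i j V b v \<equiv> tensor_class (dring G j) (bimod G i j) V (frag_of (b, v))"

abbreviation dual_ev ::
    "('i, 'k, 'b, 'c) modulation \<Rightarrow> 'i \<Rightarrow> 'i \<Rightarrow> ('k, 'v) module \<Rightarrow> 'b \<Rightarrow> ('b, 'v) tens \<Rightarrow> 'v" where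
  "dual_ev G x y V c \<equiv> tensor_lift V (\<lambda>(b, v). rdual_iso G x y c b \<odot>\<^bsub>V\<^esub> v)"

abbreviation act ::
    "('i, 'k, 'b, 'c) modulation \<Rightarrow> ('i, 'k, 'b, 'v) rep \<Rightarrow> 'i \<Rightarrow> 'i \<Rightarrow> 'b \<Rightarrow> 'v \<Rightarrow> 'v" where
  "act G M i j b v \<equiv> arrow_map M i j (pure G j i (space M i) b v)"

text \<open>The map h whose kernel is \<open>reflection_ker\<close>, isolated so that its image can
  be studied as well.\<close>

definition sink_map :: "('i \<times> 'i) set \<Rightarrow> 'i \<Rightarrow> ('i, 'k, 'b, 'v) rep \<Rightarrow> ('i \<Rightarrow> ('b, 'v) tens) \<Rightarrow> 'v" where
  "sink_map \<Lambda> x M t = finsum (space M x) (\<lambda>y. arrow_map M y x (t y)) {y. (y, x) \<in> \<Lambda>}"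

abbreviation in_sum ::
    "('i, 'k, 'b, 'c) modulation \<Rightarrow> ('i \<times> 'i) set \<Rightarrow> 'i \<Rightarrow> ('i, 'k, 'b, 'v) rep \<Rightarrow> ('k, 'i \<Rightarrow> ('b, 'v) tens) module" where
  "in_sum G \<Lambda> x M \<equiv> dsum {y. (y, x) \<in> \<Lambda>} (\<lambda>y. ten G x y (space M y))"

abbreviation decode ::
    "('i, 'k, 'b, 'c) modulation \<Rightarrow> ('i \<times> 'i) set \<Rightarrow> 'i \<Rightarrow> ('i, 'k, 'b, ('i, 'b, 'v) elem) rep
      \<Rightarrow> ('i, 'b, 'v) elem \<Rightarrow> 'i \<Rightarrow> ('b, ('i, 'b, 'v) elem) tens" where
  "decode G \<Lambda> x M \<equiv> inv_into (carrier (reflection_ker G \<Lambda> x M)) encode"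

lemma reflection_ker_eq:
  "reflection_ker G \<Lambda> x M =
    (in_sum G \<Lambda> x M)\<lparr>carrier := {t \<in> carrier (in_sum G \<Lambda> x M). sink_map \<Lambda> x M t = \<zero>\<^bsub>space M x\<^esub>}\<rparr>"
  by (simp add: reflection_ker_def Let_def sink_map_def)

section \<open>Tensor products along edges and the adjunction\<close>

context modulated_graph
begin

lemma tensor_product:
  assumes "val G i j \<noteq> 0" "left_module (dring G j) V"
  shows "tensor_product (dring G i) (dring G j) (bimod G i j) V"
  using bimod[OF assms(1)] assms(2) by (simp add: tensor_product_def)

lemma left_module_ten:
  assumes "val G i j \<noteq> 0" "left_module (dring G j) V"
  shows "left_module (dring G i) (ten G i j V)"
  using tensor_product.left_module_T[OF tensor_product[OF assms]] .

lemma pure_closed: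
  assumes "val G i j \<noteq> 0" "left_module (dring G j) V" "b \<in> carrier (bimod G i j)" "v \<in> carrier V"
  shows "pure G i j V b v \<in> carrier (ten G i j V)"
  using tensor_product.tau_closed[OF tensor_product[OF assms(1,2)] assms(3,4)] .

lemma ten_map_linear:
  assumes "val G i j \<noteq> 0" "left_module (dring G j) V" "left_module (dring G j) W" "\<phi> \<in> left_linear (dring G j) V W"
  shows "ten_map G i j W \<phi> \<in> left_linear (dring G i) (ten G i j V) (ten G i j W)"
  using tensor_product.tensor_map_linear(1)[OF tensor_product[OF assms(1,2)] assms(3,4)] .

lemma ten_map_pure:
  assumes "val G i j \<noteq> 0" "left_module (dring G j) V" "left_module (dring G j) W" "\<phi> \<in> left_linear (dring G j) V W"
    "b \<in> carrier (bimod G i j)" "v \<in> carrier V"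
  shows "ten_map G i j W \<phi> (pure G i j V b v) = pure G i j W b (\<phi> v)"
  using tensor_product.tensor_map_linear(2)[OF tensor_product[OF assms(1,2)] assms(3,4,5,6)] .

lemma ten_eqI:
  assumes "val G i j \<noteq> 0" "left_module (dring G j) V" "left_module (dring G i) N"
    "f \<in> left_linear (dring G i) (ten G i j V) N" "g \<in> left_linear (dring G i) (ten G i j V) N"
    "\<And>b v. b \<in> carrier (bimod G i j) \<Longrightarrow> v \<in> carrier V \<Longrightarrow> f (pure G i j V b v) = g (pure G i j V b v)"
    "t \<in> carrier (ten G i j V)"
  shows "f t = g t"
  using tensor_product.linear_eqI[OF tensor_product[OF assms(1,2)] assms(4,5,3,6,7)] .

lemma ten_map_cong:
  assumes "val G i j \<noteq> 0" "left_module (dring G j) V" "left_module (dring G j) W" "\<phi> \<in> left_linear (dring G j) V W"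
    "\<psi> \<in> left_linear (dring G j) V W" "\<And>v. v \<in> carrier V \<Longrightarrow> \<phi> v = \<psi> v" "t \<in> carrier (ten G i j V)"
  shows "ten_map G i j W \<phi> t = ten_map G i j W \<psi> t"
proof -
  have "ten_map G i j W \<phi> (pure G i j V b v) = ten_map G i j W \<psi> (pure G i j V b v)"
    if "b \<in> carrier (bimod G i j)" "v \<in> carrier V" for b v
    using that ten_map_pure[OF assms(1,2,3,4)] ten_map_pure[OF assms(1,2,3,5)] assms(6) by simp
  from ten_eqI[OF assms(1,2) left_module_ten[OF assms(1,3)] ten_map_linear[OF assms(1-4)]
        ten_map_linear[OF assms(1-3,5)] this assms(7)]
  show ?thesis .
qed

lemma rdual_iso_mem:
  assumes "val G x y \<noteq> 0" "c \<in> carrier (bimod G y x)"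
  shows "rdual_iso G x y c \<in> carrier (right_dual (dring G x) (dring G y) (bimod G x y))"
  using rdual_iso[OF assms(1)] assms(2) by (auto simp: bimodule_iso_def dest: left_linearD(1))

lemma dual_ev_linear:
  assumes "val G x y \<noteq> 0" "val G y x \<noteq> 0" "left_module (dring G y) V" "c \<in> carrier (bimod G y x)"
  shows "t \<in> carrier (ten G x y V) \<Longrightarrow> dual_ev G x y V c t \<in> carrier V"
    "s \<in> carrier (ten G x y V) \<Longrightarrow> t \<in> carrier (ten G x y V) \<Longrightarrow>
      dual_ev G x y V c (s \<oplus>\<^bsub>ten G x y V\<^esub> t) = dual_ev G x y V c s \<oplus>\<^bsub>V\<^esub> dual_ev G x y V c t"
    "b \<in> carrier (bimod G x y) \<Longrightarrow> v \<in> carrier V \<Longrightarrow>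
      dual_ev G x y V c (pure G x y V b v) = rdual_iso G x y c b \<odot>\<^bsub>V\<^esub> v"
    "dual_ev G x y V c \<zero>\<^bsub>ten G x y V\<^esub> = \<zero>\<^bsub>V\<^esub>"
  by (fact tensor_product.ev_closed[OF tensor_product[OF assms(1,3)] rdual_iso_mem[OF assms(1,4)]]
    tensor_product.ev_add[OF tensor_product[OF assms(1,3)] rdual_iso_mem[OF assms(1,4)]]
    tensor_product.ev_tau[OF tensor_product[OF assms(1,3)] rdual_iso_mem[OF assms(1,4)]]
    tensor_product.ev_zero[OF tensor_product[OF assms(1,3)] rdual_iso_mem[OF assms(1,4)]])+

lemma dual_ev_ten_map:
  assumes "val G x y \<noteq> 0" "left_module (dring G y) V" "left_module (dring G y) W"
    "\<phi> \<in> left_linear (dring G y) V W" "c \<in> carrier (bimod G y x)" "t \<in> carrier (ten G x y V)"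
  shows "dual_ev G x y W c (ten_map G x y W \<phi> t) = \<phi> (dual_ev G x y V c t)"
  using tensor_product.ev_tensor_map[OF tensor_product[OF assms(1,2)] assms(3,4) rdual_iso_mem[OF assms(1,5)] assms(6)] .

text \<open>Since \<open>rdual_iso\<close> is onto the right dual, the elements \<open>c\<close>
  account for all functionals, and \<open>functionals_separate\<close> applies. In the later
  arguments this says that a tensor is determined by what the reflected arrow makes of it.\<close>

lemma dual_ev_separates:
  assumes "val G x y \<noteq> 0" "left_module (dring G y) V" "t \<in> carrier (ten G x y V)"
    "\<And>c. c \<in> carrier (bimod G y x) \<Longrightarrow> dual_ev G x y V c t = \<zero>\<^bsub>V\<^esub>"
  shows "t = \<zero>\<^bsub>ten G x y V\<^esub>"
proof (rule tensor_product.functionals_separate[OF tensor_product[OF assms(1,2)] dring assms(3)])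
  fix \<phi> assume "\<phi> \<in> carrier (right_dual (dring G x) (dring G y) (bimod G x y))"
  then obtain c where "c \<in> carrier (bimod G y x)" "\<phi> = rdual_iso G x y c"
    using rdual_iso[OF assms(1)] unfolding bimodule_iso_def bij_betw_def by blast
  then show "tensor_lift V (\<lambda>(b, v). \<phi> b \<odot>\<^bsub>V\<^esub> v) t = \<zero>\<^bsub>V\<^esub>"
    using assms(4) by simp
qed

lemma dual_ev_eqI:
  assumes "val G x y \<noteq> 0" "val G y x \<noteq> 0" "left_module (dring G y) V" "s \<in> carrier (ten G x y V)" "t \<in> carrier (ten G x y V)"
    "\<And>c. c \<in> carrier (bimod G y x) \<Longrightarrow> dual_ev G x y V c s = dual_ev G x y V c t"
  shows "s = t"
proof -
  interpret V: left_module "dring G y" V by fact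
  interpret T: left_module "dring G x" "ten G x y V" by (rule left_module_ten[OF assms(1,3)])
  let ?d = "s \<oplus>\<^bsub>ten G x y V\<^esub> \<ominus>\<^bsub>ten G x y V\<^esub> t"
  have d: "?d \<oplus>\<^bsub>ten G x y V\<^esub> t = s"
    using assms by (simp add: T.a_assoc T.l_neg)
  have "dual_ev G x y V c ?d = \<zero>\<^bsub>V\<^esub>" if c: "c \<in> carrier (bimod G y x)" for c
  proof -
    note ev = dual_ev_linear[OF assms(1-3) c]
    have "dual_ev G x y V c ?d \<oplus>\<^bsub>V\<^esub> dual_ev G x y V c t = dual_ev G x y V c (?d \<oplus>\<^bsub>ten G x y V\<^esub> t)"
      using ev assms by simp
    also note d
    finally show ?thesis
      using assms ev c by (simp add: V.add.r_cancel_one)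
  qed
  then have "?d = \<zero>\<^bsub>ten G x y V\<^esub>"
    using assms by (intro dual_ev_separates) auto
  with d show ?thesis
    using assms by simp
qed

text \<open>The three properties of the bimodule isomorphism \<open>rdual_iso\<close> correspond to
  what the outer lift requires: additivity in \<open>c\<close>, compatibility with the left action
  for linearity, and compatibility with the right action for balance.\<close>

lemma adjoint_map_linear:
  fixes W :: "('k, 'w) module"
  assumes "val G x y \<noteq> 0" "val G y x \<noteq> 0" "left_module (dring G y) V" "left_module (dring G x) W"
    and "\<theta> \<in> left_linear (dring G x) W (ten G x y V)"
  shows "adjoint_map G x y V \<theta> \<in> left_linear (dring G y) (ten G y x W) V"
    "c \<in> carrier (bimod G y x) \<Longrightarrow> w \<in> carrier W \<Longrightarrow>
      adjoint_map G x y V \<theta> (pure G y x W c w) = dual_ev G x y V c (\<theta> w)"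
proof -
  interpret V: left_module "dring G y" V by fact
  interpret T: tensor_product "dring G x" "dring G y" "bimod G x y" V
    using tensor_product[OF assms(1,3)] .
  interpret W: tensor_product "dring G y" "dring G x" "bimod G y x" W
    using tensor_product[OF assms(2,4)] .
  note lin = left_linearD[OF assms(5)]
  note ev = dual_ev_linear[OF assms(1-3)]
  interpret TT: left_module "dring G x" T.T by (rule T.left_module_T)
  let ?\<beta> = "\<lambda>(c, w). dual_ev G x y V c (\<theta> w)"
  have iso: "c \<in> carrier (bimod G y x) \<Longrightarrow> d \<in> carrier (bimod G y x) \<Longrightarrow> b \<in> carrier (bimod G x y) \<Longrightarrow>
      rdual_iso G x y (c \<oplus>\<^bsub>bimod G y x\<^esub> d) b = rdual_iso G x y c b \<oplus>\<^bsub>dring G y\<^esub> rdual_iso G x y d b"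
    "s \<in> carrier (dring G y) \<Longrightarrow> c \<in> carrier (bimod G y x) \<Longrightarrow> b \<in> carrier (bimod G x y) \<Longrightarrow>
      rdual_iso G x y (s \<odot>\<^bsub>bimod G y x\<^esub> c) b = s \<otimes>\<^bsub>dring G y\<^esub> rdual_iso G x y c b"
    "r \<in> carrier (dring G x) \<Longrightarrow> c \<in> carrier (bimod G y x) \<Longrightarrow> b \<in> carrier (bimod G x y) \<Longrightarrow>
      rdual_iso G x y (rsmult (bimod G y x) c r) b = rdual_iso G x y c (r \<odot>\<^bsub>bimod G x y\<^esub> b)"
    for c d b s r
    using rdual_iso[OF assms(1)] by (auto simp: bimodule_iso_def right_dual_def left_linear_def)
  have coeff: "rdual_iso G x y c b \<in> carrier (dring G y)"
    if "c \<in> carrier (bimod G y x)" "b \<in> carrier (bimod G x y)" for c b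
    using T.right_dualD(1)[OF rdual_iso_mem[OF assms(1)]] that by blast
  have 1: "dual_ev G x y V (c \<oplus>\<^bsub>bimod G y x\<^esub> d) t = dual_ev G x y V c t \<oplus>\<^bsub>V\<^esub> dual_ev G x y V d t"
    if "c \<in> carrier (bimod G y x)" "d \<in> carrier (bimod G y x)" "t \<in> carrier T.T" for c d t
    using that(3)
  proof (induction t rule: T.tensor_induct)
    case zero
    then show ?case using that ev(4) by simp
  next
    case (tau b v)
    then show ?case
      using that tau iso(1)[OF that(1,2)] coeff by (simp add: ev(3) V.smult_l_distr)
  next
    case (add s t)
    then show ?case using that by (simp add: ev V.M.a_ac)
  qed
  have 2: "dual_ev G x y V (a \<odot>\<^bsub>bimod G y x\<^esub> c) t = a \<odot>\<^bsub>V\<^esub> dual_ev G x y V c t"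
    if "a \<in> carrier (dring G y)" "c \<in> carrier (bimod G y x)" "t \<in> carrier T.T" for a c t
    using that(3)
  proof (induction t rule: T.tensor_induct)
    case zero
    then show ?case using that ev(4) W.B.smult_closed V.smult_zero by simp
  next
    case (tau b v)
    then show ?case
      using that tau iso(2)[OF that(1,2)] coeff by (simp add: ev(3) V.smult_assoc1 W.B.smult_closed)
  next
    case (add s t)
    then show ?case using that by (simp add: ev W.B.smult_closed V.smult_r_distr)
  qed
  \<comment> \<open>Balance: a scalar on the right of \<open>c\<close> acts on the functional by
    left multiplication of its argument, so it moves to the first factor of the tensor.\<close>
  have 3: "dual_ev G x y V (rsmult (bimod G y x) c r) t = dual_ev G x y V c (r \<odot>\<^bsub>T.T\<^esub> t)"
    if "r \<in> carrier (dring G x)" "c \<in> carrier (bimod G y x)" "t \<in> carrier T.T" for r c t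
    using that(3)
  proof (induction t rule: T.tensor_induct)
    case zero
    then show ?case using that ev(4) W.B.rsmult_closed TT.smult_zero by simp
  next
    case (tau b v)
    then show ?case
      using that tau iso(3)[OF that(1,2)] coeff
      by (simp add: ev(3) T.smult_tau T.B.smult_closed W.B.rsmult_closed)
  next
    case (add s t)
    then show ?case using that by (simp add: ev W.B.rsmult_closed TT.smult_r_distr TT.smult_closed)
  qed
  have bal: "W.balanced V ?\<beta>"
    unfolding W.balanced_def using lin
    by (auto simp: ev V.M.abelian_group_axioms 1 3)
  show "adjoint_map G x y V \<theta> \<in> left_linear (dring G y) (ten G y x W) V"
    unfolding adjoint_map_def
    by (rule W.tensor_lift_linear[OF bal assms(3)]) (simp add: 2 lin)
  show "adjoint_map G x y V \<theta> (pure G y x W c w) = dual_ev G x y V c (\<theta> w)"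
    if "c \<in> carrier (bimod G y x)" "w \<in> carrier W"
    unfolding adjoint_map_def using W.tensor_lift_tau[OF bal that] by simp
qed

end

lemma wrepD:
  assumes "wrep G \<Lambda> M"
  shows "left_module (dring G i) (space M i)"
    "(i, j) \<in> \<Lambda> \<Longrightarrow> arrow_map M i j \<in> left_linear (dring G j) (ten G j i (space M i)) (space M j)"
  using assms by (auto simp: wrep_def)

lemma rep_homD:
  assumes "\<phi> \<in> rep_hom G \<Lambda> M N"
  shows "\<phi> i \<in> left_linear (dring G i) (space M i) (space N i)"
    "(i, j) \<in> \<Lambda> \<Longrightarrow> t \<in> carrier (ten G j i (space M i)) \<Longrightarrow>
      \<phi> j (arrow_map M i j t) = arrow_map N i j (ten_map G j i (space N i) (\<phi> i) t)"
  using assms by (auto simp: rep_hom_def)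

section \<open>Morphisms of representations\<close>

locale oriented_graph = modulated_graph G for G :: "('i::finite, 'k, 'b, 'c) modulation" +
  fixes \<Lambda> :: "('i \<times> 'i) set"
  assumes orient: "orientation G \<Lambda>"
begin

lemma arrow_val:
  assumes "(i, j) \<in> \<Lambda>"
  shows "val G i j \<noteq> 0" "val G j i \<noteq> 0"
  using assms orient unfolding orientation_def by (metis not_gr_zero)+

lemma oriented_graph_reverse: "oriented_graph G (reverse_at x \<Lambda>)"
  using modulated_graph_axioms orientation_reverse_at[OF orient]
  by (simp add: oriented_graph_def oriented_graph_axioms_def)

lemma act_closed:
  assumes "wrep G \<Lambda> M" "(i, j) \<in> \<Lambda>" "b \<in> carrier (bimod G j i)" "v \<in> carrier (space M i)"
  shows "act G M i j b v \<in> carrier (space M j)"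
  using left_linearD(1)[OF wrepD(2)[OF assms(1,2)] pure_closed[OF arrow_val(2)[OF assms(2)] wrepD(1)[OF assms(1)] assms(3,4)]] .

lemma act_zero:
  assumes "wrep G \<Lambda> M" "(i, j) \<in> \<Lambda>" "b \<in> carrier (bimod G j i)"
  shows "act G M i j b \<zero>\<^bsub>space M i\<^esub> = \<zero>\<^bsub>space M j\<^esub>"
proof -
  interpret T: tensor_product "dring G j" "dring G i" "bimod G j i" "space M i"
    using tensor_product[OF arrow_val(2)[OF assms(2)] wrepD(1)[OF assms(1)]] .
  show ?thesis
    unfolding T.tau_zero_right[OF assms(3)]
    by (rule left_linear_zero[OF wrepD(2)[OF assms(1,2)] T.left_module_T wrepD(1)[OF assms(1)]])
qed

lemma rep_hom_act:
  assumes "wrep G \<Lambda> M" "wrep G \<Lambda> N" "\<phi> \<in> rep_hom G \<Lambda> M N" "(i, j) \<in> \<Lambda>" "b \<in> carrier (bimod G j i)" "v \<in> carrier (space M i)"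
  shows "\<phi> j (act G M i j b v) = act G N i j b (\<phi> i v)"
  using rep_homD(2)[OF assms(3,4) pure_closed[OF arrow_val(2)[OF assms(4)] wrepD(1)[OF assms(1)] assms(5,6)]]
    ten_map_pure[OF arrow_val(2)[OF assms(4)] wrepD(1)[OF assms(1)] wrepD(1)[OF assms(2)] rep_homD(1)[OF assms(3)] assms(5,6)]
  by simp

text \<open>Both sides of the commuting square are linear in the tensor, so it is enough to check
  pure tensors.\<close>

lemma rep_homI:
  assumes "wrep G \<Lambda> M" "wrep G \<Lambda> N" "\<And>i. \<phi> i \<in> left_linear (dring G i) (space M i) (space N i)"
    and act: "\<And>i j b v. (i, j) \<in> \<Lambda> \<Longrightarrow> b \<in> carrier (bimod G j i) \<Longrightarrow> v \<in> carrier (space M i) \<Longrightarrow>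
      \<phi> j (act G M i j b v) = act G N i j b (\<phi> i v)"
  shows "\<phi> \<in> rep_hom G \<Lambda> M N"
proof -
  have "\<phi> j (arrow_map M i j t) = arrow_map N i j (ten_map G j i (space N i) (\<phi> i) t)"
    if ij: "(i, j) \<in> \<Lambda>" and t: "t \<in> carrier (ten G j i (space M i))" for i j t
  proof -
    note v = arrow_val(2)[OF ij]
    note tl = ten_map_linear[OF v wrepD(1)[OF assms(1)] wrepD(1)[OF assms(2)] assms(3)]
    have "\<phi> j (act G M i j b u) = arrow_map N i j (ten_map G j i (space N i) (\<phi> i) (pure G j i (space M i) b u))"
      if "b \<in> carrier (bimod G j i)" "u \<in> carrier (space M i)" for b u
      using act[OF ij that] ten_map_pure[OF v wrepD(1)[OF assms(1)] wrepD(1)[OF assms(2)] assms(3) that] by simp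
    from ten_eqI[OF v wrepD(1)[OF assms(1)] wrepD(1)[OF assms(2)]
      left_linear_compose[OF wrepD(2)[OF assms(1) ij] assms(3)]
      left_linear_compose[OF tl wrepD(2)[OF assms(2) ij]] this t]
    show ?thesis .
  qed
  then show ?thesis
    using assms(3) by (auto simp: rep_hom_def)
qed

lemma rep_hom_compose:
  assumes "wrep G \<Lambda> M" "wrep G \<Lambda> N" "wrep G \<Lambda> P" "\<phi> \<in> rep_hom G \<Lambda> M N" "\<psi> \<in> rep_hom G \<Lambda> N P"
  shows "(\<lambda>i v. \<psi> i (\<phi> i v)) \<in> rep_hom G \<Lambda> M P"
  by (rule rep_homI[OF assms(1,3)])
    (simp_all add: left_linear_compose[OF rep_homD(1)[OF assms(4)] rep_homD(1)[OF assms(5)]]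
      rep_hom_act[OF assms(1,2,4)] rep_hom_act[OF assms(2,3,5)] left_linearD(1)[OF rep_homD(1)[OF assms(4)]])

lemma rep_hom_inverse:
  assumes "wrep G \<Lambda> M" "wrep G \<Lambda> N" "\<phi> \<in> rep_hom G \<Lambda> M N"
    and "\<And>i v. v \<in> carrier (space N i) \<Longrightarrow> \<psi> i v \<in> carrier (space M i)"
    and inv: "\<And>i v. v \<in> carrier (space M i) \<Longrightarrow> \<psi> i (\<phi> i v) = v" "\<And>i v. v \<in> carrier (space N i) \<Longrightarrow> \<phi> i (\<psi> i v) = v"
  shows "\<psi> \<in> rep_hom G \<Lambda> N M"
proof (rule rep_homI[OF assms(2,1)])
  fix i
  interpret M: left_module "dring G i" "space M i" using wrepD(1)[OF assms(1)] .
  note lin = left_linearD[OF rep_homD(1)[OF assms(3)]]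
  show "\<psi> i \<in> left_linear (dring G i) (space N i) (space M i)"
  proof (rule left_linearI)
    fix x y assume xy: "x \<in> carrier (space N i)" "y \<in> carrier (space N i)"
    then have "\<psi> i (x \<oplus>\<^bsub>space N i\<^esub> y) = \<psi> i (\<phi> i (\<psi> i x \<oplus>\<^bsub>space M i\<^esub> \<psi> i y))"
      using lin(2) assms(4) inv by simp
    then show "\<psi> i (x \<oplus>\<^bsub>space N i\<^esub> y) = \<psi> i x \<oplus>\<^bsub>space M i\<^esub> \<psi> i y"
      using inv(1) assms(4) xy by simp
  next
    fix r x assume rx: "r \<in> carrier (dring G i)" "x \<in> carrier (space N i)"
    then have "\<psi> i (r \<odot>\<^bsub>space N i\<^esub> x) = \<psi> i (\<phi> i (r \<odot>\<^bsub>space M i\<^esub> \<psi> i x))"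
      using lin(3) assms(4) inv by simp
    then show "\<psi> i (r \<odot>\<^bsub>space N i\<^esub> x) = r \<odot>\<^bsub>space M i\<^esub> \<psi> i x"
      using inv(1) assms(4) rx M.smult_closed by simp
  qed (rule assms(4))
next
  fix i j b v assume *: "(i, j) \<in> \<Lambda>" "b \<in> carrier (bimod G j i)" "v \<in> carrier (space N i)"
  then have "\<psi> j (act G N i j b v) = \<psi> j (\<phi> j (act G M i j b (\<psi> i v)))"
    using rep_hom_act[OF assms(1-3) *(1,2)] assms(4) inv by simp
  then show "\<psi> j (act G N i j b v) = act G M i j b (\<psi> i v)"
    using inv(1) act_closed[OF assms(1) *(1,2)] assms(4) * by simp
qed

section \<open>The space and the arrows created by a reflection\<close>

lemma left_module_in_sum:
  assumes "wrep G \<Lambda> M"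
  shows "left_module (dring G x) (in_sum G \<Lambda> x M)"
  using dring[of x] by (intro left_module_dsum left_module_ten arrow_val(2) wrepD(1)[OF assms])
    (auto simp: skew_field_def)

lemma in_sumD: "t \<in> carrier (in_sum G \<Lambda> x M) \<Longrightarrow> (y, x) \<in> \<Lambda> \<Longrightarrow> t y \<in> carrier (ten G x y (space M y))"
  by (auto simp: dsum_def)

lemma in_sum_comp_linear:
  assumes "(y, x) \<in> \<Lambda>"
  shows "(\<lambda>t. t y) \<in> left_linear (dring G x) (in_sum G \<Lambda> x M) (ten G x y (space M y))"
  using assms by (intro left_linearI) (auto simp: dsum_def)

lemma sink_map_linear:
  assumes "wrep G \<Lambda> M"
  shows "sink_map \<Lambda> x M \<in> left_linear (dring G x) (in_sum G \<Lambda> x M) (space M x)"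
proof -
  interpret V: left_module "dring G x" "space M x" using wrepD(1)[OF assms] .
  let ?Y = "{y. (y, x) \<in> \<Lambda>}"
  note lin = left_linearD[OF wrepD(2)[OF assms]]
  have c: "(\<lambda>y. arrow_map M y x (t y)) \<in> ?Y \<rightarrow> carrier (space M x)" if "t \<in> carrier (in_sum G \<Lambda> x M)" for t
    using lin(1) in_sumD[OF that] by auto
  show ?thesis
  proof (rule left_linearI)
    fix t assume t: "t \<in> carrier (in_sum G \<Lambda> x M)"
    show "sink_map \<Lambda> x M t \<in> carrier (space M x)"
      unfolding sink_map_def using c[OF t] by (rule V.finsum_closed)
  next
    fix s t assume st: "s \<in> carrier (in_sum G \<Lambda> x M)" "t \<in> carrier (in_sum G \<Lambda> x M)"
    have "sink_map \<Lambda> x M (s \<oplus>\<^bsub>in_sum G \<Lambda> x M\<^esub> t) =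
      finsum (space M x) (\<lambda>y. arrow_map M y x (s y) \<oplus>\<^bsub>space M x\<^esub> arrow_map M y x (t y)) ?Y"
      unfolding sink_map_def
      by (rule finsum_cong_weak) (use lin(2) in_sumD[OF st(1)] in_sumD[OF st(2)] in \<open>auto simp: dsum_def\<close>)
    then show "sink_map \<Lambda> x M (s \<oplus>\<^bsub>in_sum G \<Lambda> x M\<^esub> t) = sink_map \<Lambda> x M s \<oplus>\<^bsub>space M x\<^esub> sink_map \<Lambda> x M t"
      using V.finsum_addf[OF c[OF st(1)] c[OF st(2)]] by (simp add: sink_map_def)
  next
    fix r t assume rt: "r \<in> carrier (dring G x)" "t \<in> carrier (in_sum G \<Lambda> x M)"
    have "sink_map \<Lambda> x M (r \<odot>\<^bsub>in_sum G \<Lambda> x M\<^esub> t) =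
      finsum (space M x) (\<lambda>y. r \<odot>\<^bsub>space M x\<^esub> arrow_map M y x (t y)) ?Y"
      unfolding sink_map_def
      by (rule finsum_cong_weak) (use lin(3) in_sumD[OF rt(2)] rt(1) in \<open>auto simp: dsum_def\<close>)
    then show "sink_map \<Lambda> x M (r \<odot>\<^bsub>in_sum G \<Lambda> x M\<^esub> t) = r \<odot>\<^bsub>space M x\<^esub> sink_map \<Lambda> x M t"
      using V.finsum_smult[OF finite rt(1) c[OF rt(2)]] by (simp add: sink_map_def)
  qed
qed

lemma reflection_ker_submodule:
  assumes "wrep G \<Lambda> M"
  shows "submodule {t \<in> carrier (in_sum G \<Lambda> x M). sink_map \<Lambda> x M t = \<zero>\<^bsub>space M x\<^esub>} (dring G x) (in_sum G \<Lambda> x M)"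
proof -
  interpret D: left_module "dring G x" "in_sum G \<Lambda> x M" using left_module_in_sum[OF assms] .
  interpret V: left_module "dring G x" "space M x" using wrepD(1)[OF assms] .
  note lin = left_linearD[OF sink_map_linear[OF assms, of x]]
  show ?thesis
    by (rule D.submoduleI)
      (use left_linear_zero[OF sink_map_linear[OF assms] D.left_module_axioms V.left_module_axioms] lin
       in \<open>auto simp: D.smult_closed V.smult_zero\<close>)
qed

lemma left_module_reflection_ker:
  assumes "wrep G \<Lambda> M"
  shows "left_module (dring G x) (reflection_ker G \<Lambda> x M)"
  unfolding reflection_ker_eq
  using left_module_submodule[OF left_module_in_sum[OF assms] reflection_ker_submodule[OF assms]] .

text \<open>The list stored for a component represents an element of that component. Components are
  cosets of the same subgroup, so two of them that share an element are equal.\<close>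

lemma inj_on_encode:
  assumes "wrep G \<Lambda> M"
  shows "inj_on encode (carrier (in_sum G \<Lambda> x M))"
proof (rule inj_onI)
  fix s t assume st: "s \<in> carrier (in_sum G \<Lambda> x M)" "t \<in> carrier (in_sum G \<Lambda> x M)" "encode s = encode t"
  have "s y = t y" if y: "(y, x) \<in> \<Lambda>" for y
  proof -
    interpret T: tensor_product "dring G x" "dring G y" "bimod G x y" "space M y"
      using tensor_product[OF arrow_val(2)[OF y] wrepD(1)[OF assms]] .
    let ?ps = "\<lambda>u. SOME ps. sum_list (map frag_of ps) \<in> u"
    have mem: "sum_list (map frag_of (?ps u)) \<in> u" if "u \<in> carrier T.T" for u
      by (rule someI_ex[of "\<lambda>ps. sum_list (map frag_of ps) \<in> u"]) (use T.tensor_list[OF that] in blast)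
    have "?ps (s y) = ?ps (t y)"
      using fun_cong[of _ _ y] st(3) by (simp add: encode_def fun_eq_iff)
    then have "sum_list (map frag_of (?ps (s y))) \<in> s y \<inter> t y"
      using mem[OF in_sumD[OF st(1) y]] mem[OF in_sumD[OF st(2) y]] by simp
    then show ?thesis
      using T.mem_tensor(2)[OF in_sumD[OF st(1) y]] T.mem_tensor(2)[OF in_sumD[OF st(2) y]] by blast
  qed
  then show "s = t"
    using st(1,2) by (intro PiE_ext[of s "{y. (y, x) \<in> \<Lambda>}" "\<lambda>y. carrier (ten G x y (space M y))"]) (auto simp: dsum_def)
qed

lemma inj_on_encode_ker:
  assumes "wrep G \<Lambda> M"
  shows "inj_on encode (carrier (reflection_ker G \<Lambda> x M))"
  using inj_on_encode[OF assms] by (rule inj_on_subset) (auto simp: reflection_ker_eq)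

lemma space_reflect: "space (reflect G \<Lambda> x M) x = module_image encode (reflection_ker G \<Lambda> x M)"
  by (simp add: reflect_def Let_def)

lemma reflection_ker_carrier:
  "t \<in> carrier (reflection_ker G \<Lambda> x M) \<longleftrightarrow> t \<in> carrier (in_sum G \<Lambda> x M) \<and> sink_map \<Lambda> x M t = \<zero>\<^bsub>space M x\<^esub>"
  by (simp add: reflection_ker_eq)

lemma encode_closed:
  assumes "t \<in> carrier (reflection_ker G \<Lambda> x M)"
  shows "encode t \<in> carrier (space (reflect G \<Lambda> x M) x)"
  using assms by (simp add: space_reflect module_image_def Let_def)

lemma decode_encode:
  assumes "wrep G \<Lambda> M" "t \<in> carrier (reflection_ker G \<Lambda> x M)"
  shows "decode G \<Lambda> x M (encode t) = t"
  using inv_into_f_f[OF inj_on_encode_ker[OF assms(1)] assms(2)] .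

lemma decode_closed:
  assumes "w \<in> carrier (space (reflect G \<Lambda> x M) x)"
  shows "decode G \<Lambda> x M w \<in> carrier (reflection_ker G \<Lambda> x M)" "encode (decode G \<Lambda> x M w) = w"
  using assms by (auto simp: space_reflect module_image_def Let_def inv_into_into f_inv_into_f)

lemma left_module_reflect:
  assumes "wrep G \<Lambda> M"
  shows "left_module (dring G y) (space (reflect G \<Lambda> x M) y)"
  using left_module_image(1)[OF left_module_reflection_ker[OF assms] inj_on_encode_ker[OF assms]] wrepD(1)[OF assms]
  by (cases "y = x") (simp_all add: space_reflect)

lemma encode_linear:
  assumes "wrep G \<Lambda> M"
  shows "encode \<in> left_linear (dring G x) (reflection_ker G \<Lambda> x M) (space (reflect G \<Lambda> x M) x)"
  unfolding space_reflect
  using left_module_image(2)[OF left_module_reflection_ker[OF assms] inj_on_encode_ker[OF assms]] .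

lemma decode_linear:
  assumes "wrep G \<Lambda> M" "(y, x) \<in> \<Lambda>"
  shows "(\<lambda>w. decode G \<Lambda> x M w y) \<in> left_linear (dring G x) (space (reflect G \<Lambda> x M) x) (ten G x y (space M y))"
proof -
  have "(\<lambda>t. t y) \<in> left_linear (dring G x) (reflection_ker G \<Lambda> x M) (ten G x y (space M y))"
    using left_linearD[OF in_sum_comp_linear[OF assms(2), where M = M]]
    by (intro left_linearI) (simp_all add: reflection_ker_eq)
  then show ?thesis
    unfolding space_reflect
    using left_linear_compose[OF left_module_image(3)[OF left_module_reflection_ker[OF assms(1)] inj_on_encode_ker[OF assms(1)]]]
    by blast
qed

text \<open>The working description of a reversed arrow: it takes the component at \<open>y\<close>
  of a kernel element and contracts it with the functional of \<open>c\<close>. Together with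
  \<open>dual_ev_separates\<close> it recovers that component.\<close>

lemma act_reflect:
  assumes "wrep G \<Lambda> M" "(y, x) \<in> \<Lambda>" "c \<in> carrier (bimod G y x)" "w \<in> carrier (space (reflect G \<Lambda> x M) x)"
  shows "act G (reflect G \<Lambda> x M) x y c w = dual_ev G x y (space M y) c (decode G \<Lambda> x M w y)"
proof -
  have "arrow_map (reflect G \<Lambda> x M) x y = adjoint_map G x y (space M y) (\<lambda>w. decode G \<Lambda> x M w y)"
    by (simp add: reflect_def Let_def)
  then show ?thesis
    using adjoint_map_linear(2)[OF arrow_val(2,1)[OF assms(2)] wrepD(1)[OF assms(1)] left_module_reflect[OF assms(1)]
      decode_linear[OF assms(1,2)] assms(3,4)] by simp
qed

lemma wrep_reflect:
  assumes "wrep G \<Lambda> M" "sink \<Lambda> x"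
  shows "wrep G (reverse_at x \<Lambda>) (reflect G \<Lambda> x M)"
proof -
  have "arrow_map (reflect G \<Lambda> x M) i j \<in>
    left_linear (dring G j) (ten G j i (space (reflect G \<Lambda> x M) i)) (space (reflect G \<Lambda> x M) j)"
    if ij: "(i, j) \<in> reverse_at x \<Lambda>" for i j
  proof (cases "i = x")
    case True
    then have ji: "(j, x) \<in> \<Lambda>" "j \<noteq> x"
      using ij assms(2) by (auto simp: reverse_at_sink_iff sink_def)
    then show ?thesis
      using True adjoint_map_linear(1)[OF arrow_val(2,1)[OF ji(1)] wrepD(1)[OF assms(1)] left_module_reflect[OF assms(1)]
      decode_linear[OF assms(1) ji(1)]] by (simp add: reflect_def Let_def)
  next
    case False
    then have "(i, j) \<in> \<Lambda>" "j \<noteq> x"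
      using ij assms(2) by (auto simp: reverse_at_sink_iff)
    then show ?thesis
      using False wrepD(2)[OF assms(1)] by (simp add: reflect_def Let_def)
  qed
  with left_module_reflect[OF assms(1)] show ?thesis
    by (auto simp: wrep_def)
qed

lemma arrow_map_reflect_other: "i \<noteq> x \<Longrightarrow> arrow_map (reflect G \<Lambda> x M) i j = arrow_map M i j"
  by (simp add: reflect_def Let_def)

section \<open>Reflections of morphisms\<close>

lemma sink_map_hom:
  assumes "wrep G \<Lambda> M" "wrep G \<Lambda> N" "\<phi> \<in> rep_hom G \<Lambda> M N" "t \<in> carrier (in_sum G \<Lambda> x M)"
  shows "\<phi> x (sink_map \<Lambda> x M t) = sink_map \<Lambda> x N (\<lambda>y\<in>{y. (y, x) \<in> \<Lambda>}. ten_map G x y (space N y) (\<phi> y) (t y))"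
proof -
  let ?Y = "{y. (y, x) \<in> \<Lambda>}"
  have c: "(\<lambda>y. arrow_map M y x (t y)) \<in> ?Y \<rightarrow> carrier (space M x)"
    using left_linearD(1)[OF wrepD(2)[OF assms(1)]] in_sumD[OF assms(4)] by auto
  have "\<phi> x (sink_map \<Lambda> x M t) = finsum (space N x) (\<lambda>y. \<phi> x (arrow_map M y x (t y))) ?Y"
    unfolding sink_map_def
    by (rule left_linear_finsum[OF rep_homD(1)[OF assms(3)] wrepD(1)[OF assms(1)] wrepD(1)[OF assms(2)] finite c])
  also have "\<dots> = sink_map \<Lambda> x N (\<lambda>y\<in>?Y. ten_map G x y (space N y) (\<phi> y) (t y))"
    unfolding sink_map_def
    by (rule finsum_cong_weak) (use rep_homD(2)[OF assms(3)] in_sumD[OF assms(4)] in auto)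
  finally show ?thesis .
qed

lemma ten_map_in_sum:
  assumes "wrep G \<Lambda> M" "wrep G \<Lambda> N" "\<And>y. (y, x) \<in> \<Lambda> \<Longrightarrow> \<phi> y \<in> left_linear (dring G y) (space M y) (space N y)"
    "t \<in> carrier (in_sum G \<Lambda> x M)"
  shows "(\<lambda>y\<in>{y. (y, x) \<in> \<Lambda>}. ten_map G x y (space N y) (\<phi> y) (t y)) \<in> carrier (in_sum G \<Lambda> x N)"
proof -
  have "ten_map G x y (space N y) (\<phi> y) (t y) \<in> carrier (ten G x y (space N y))" if y: "(y, x) \<in> \<Lambda>" for y
    using left_linearD(1)[OF ten_map_linear[OF arrow_val(2)[OF y] wrepD(1)[OF assms(1)] wrepD(1)[OF assms(2)] assms(3)[OF y]]
        in_sumD[OF assms(4) y]] .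
  then show ?thesis
    by (simp add: dsum_def)
qed

lemma ten_map_in_sum_linear:
  assumes "wrep G \<Lambda> M" "wrep G \<Lambda> N" "\<And>y. (y, x) \<in> \<Lambda> \<Longrightarrow> \<phi> y \<in> left_linear (dring G y) (space M y) (space N y)"
  shows "(\<lambda>t. \<lambda>y\<in>{y. (y, x) \<in> \<Lambda>}. ten_map G x y (space N y) (\<phi> y) (t y)) \<in>
    left_linear (dring G x) (in_sum G \<Lambda> x M) (in_sum G \<Lambda> x N)"
proof (rule left_linearI)
  note tl = left_linearD[OF ten_map_linear[OF arrow_val(2) wrepD(1)[OF assms(1)] wrepD(1)[OF assms(2)] assms(3)]]
  {
    fix s t assume "s \<in> carrier (in_sum G \<Lambda> x M)" "t \<in> carrier (in_sum G \<Lambda> x M)"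
    then have "s y \<in> carrier (ten G x y (space M y))" "t y \<in> carrier (ten G x y (space M y))" if "(y, x) \<in> \<Lambda>" for y
      using in_sumD that by auto
    then show "(\<lambda>y\<in>{y. (y, x) \<in> \<Lambda>}. ten_map G x y (space N y) (\<phi> y) ((s \<oplus>\<^bsub>in_sum G \<Lambda> x M\<^esub> t) y)) =
      (\<lambda>y\<in>{y. (y, x) \<in> \<Lambda>}. ten_map G x y (space N y) (\<phi> y) (s y)) \<oplus>\<^bsub>in_sum G \<Lambda> x N\<^esub>
      (\<lambda>y\<in>{y. (y, x) \<in> \<Lambda>}. ten_map G x y (space N y) (\<phi> y) (t y))"
      using tl(2) by (auto simp: dsum_def intro!: restrict_ext)
  }
  fix r t assume "r \<in> carrier (dring G x)" "t \<in> carrier (in_sum G \<Lambda> x M)"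
  then have "t y \<in> carrier (ten G x y (space M y))" if "(y, x) \<in> \<Lambda>" for y
    using in_sumD that by auto
  then show "(\<lambda>y\<in>{y. (y, x) \<in> \<Lambda>}. ten_map G x y (space N y) (\<phi> y) ((r \<odot>\<^bsub>in_sum G \<Lambda> x M\<^esub> t) y)) =
    r \<odot>\<^bsub>in_sum G \<Lambda> x N\<^esub> (\<lambda>y\<in>{y. (y, x) \<in> \<Lambda>}. ten_map G x y (space N y) (\<phi> y) (t y))"
    using tl(3) \<open>r \<in> carrier (dring G x)\<close> by (auto simp: dsum_def intro!: restrict_ext)
qed (rule ten_map_in_sum[OF assms])

text \<open>Applying 1 \<otimes> \<phi> in each component commutes with the maps h, so it restricts
  to their kernels; at the reversed arrows it is compatible by \<open>dual_ev_ten_map\<close>. The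
  formula for the components is part of the conclusion because the behaviour of
  \<open>\<psi>\<close> at \<open>x\<close> is read off from it.\<close>

lemma reflect_hom:
  assumes "wrep G \<Lambda> M" "wrep G \<Lambda> N" "\<phi> \<in> rep_hom G \<Lambda> M N" "sink \<Lambda> x"
  obtains \<psi> where "\<psi> \<in> rep_hom G (reverse_at x \<Lambda>) (reflect G \<Lambda> x M) (reflect G \<Lambda> x N)"
    "\<And>y. y \<noteq> x \<Longrightarrow> \<psi> y = \<phi> y"
    "\<And>w y. w \<in> carrier (space (reflect G \<Lambda> x M) x) \<Longrightarrow> (y, x) \<in> \<Lambda> \<Longrightarrow>
      decode G \<Lambda> x N (\<psi> x w) y = ten_map G x y (space N y) (\<phi> y) (decode G \<Lambda> x M w y)"
proof -
  let ?Y = "{y. (y, x) \<in> \<Lambda>}"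
  let ?M = "reflect G \<Lambda> x M" and ?N = "reflect G \<Lambda> x N"
  interpret R: oriented_graph G "reverse_at x \<Lambda>" by (rule oriented_graph_reverse)
  define d where "d = (\<lambda>t. \<lambda>y\<in>?Y. ten_map G x y (space N y) (\<phi> y) (t y))"
  have d_ker: "d t \<in> carrier (reflection_ker G \<Lambda> x N)" if t: "t \<in> carrier (reflection_ker G \<Lambda> x M)" for t
  proof -
    have t': "t \<in> carrier (in_sum G \<Lambda> x M)" "sink_map \<Lambda> x M t = \<zero>\<^bsub>space M x\<^esub>"
      using t by (auto simp: reflection_ker_carrier)
    show ?thesis
      using ten_map_in_sum[OF assms(1,2) rep_homD(1)[OF assms(3)] t'(1)] sink_map_hom[OF assms(1-3) t'(1)] t'(2)
        left_linear_zero[OF rep_homD(1)[OF assms(3)] wrepD(1)[OF assms(1)] wrepD(1)[OF assms(2)]]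
      by (simp add: reflection_ker_carrier d_def)
  qed
  have d_lin: "d \<in> left_linear (dring G x) (reflection_ker G \<Lambda> x M) (reflection_ker G \<Lambda> x N)"
  proof -
    have "d \<in> left_linear (dring G x) (in_sum G \<Lambda> x M) (in_sum G \<Lambda> x N)"
      unfolding d_def by (rule ten_map_in_sum_linear[OF assms(1,2) rep_homD(1)[OF assms(3)]])
    from left_linearD[OF this] d_ker show ?thesis
      by (intro left_linearI) (auto simp: reflection_ker_eq)
  qed
  define \<psi> where "\<psi> = \<phi>(x := \<lambda>w. encode (d (decode G \<Lambda> x M w)))"
  have dec: "decode G \<Lambda> x N (\<psi> x w) y = ten_map G x y (space N y) (\<phi> y) (decode G \<Lambda> x M w y)"
    if "w \<in> carrier (space ?M x)" "(y, x) \<in> \<Lambda>" for w y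
    using decode_encode[OF assms(2) d_ker[OF decode_closed(1)[OF that(1)]]] that(2) by (simp add: \<psi>_def d_def)
  have "decode G \<Lambda> x M \<in> left_linear (dring G x) (space ?M x) (reflection_ker G \<Lambda> x M)"
    unfolding space_reflect
    by (rule left_module_image(3)[OF left_module_reflection_ker[OF assms(1)] inj_on_encode_ker[OF assms(1)]])
  from left_linear_compose[OF left_linear_compose[OF this d_lin] encode_linear[OF assms(2)]]
  have psi_x: "\<psi> x \<in> left_linear (dring G x) (space ?M x) (space ?N x)"
    by (simp add: \<psi>_def)
  have "\<psi> \<in> rep_hom G (reverse_at x \<Lambda>) ?M ?N"
  proof (rule R.rep_homI)
    show "wrep G (reverse_at x \<Lambda>) ?M" "wrep G (reverse_at x \<Lambda>) ?N"
      using wrep_reflect assms by blast+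
    show "\<psi> i \<in> left_linear (dring G i) (space ?M i) (space ?N i)" for i
      using psi_x rep_homD(1)[OF assms(3)] by (cases "i = x") (simp_all add: \<psi>_def)
  next
    fix i j b v assume *: "(i, j) \<in> reverse_at x \<Lambda>" "b \<in> carrier (bimod G j i)" "v \<in> carrier (space ?M i)"
    show "\<psi> j (act G ?M i j b v) = act G ?N i j b (\<psi> i v)"
    proof (cases "i = x")
      case True
      then have j: "(j, x) \<in> \<Lambda>" "j \<noteq> x"
        using * assms(4) by (auto simp: reverse_at_sink_iff sink_def)
      have v: "v \<in> carrier (space ?M x)" using * True by simp
      have b: "b \<in> carrier (bimod G j x)" using * True by simp
      have D: "decode G \<Lambda> x M v \<in> carrier (in_sum G \<Lambda> x M)"
        using decode_closed(1)[OF v] by (simp add: reflection_ker_carrier)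
      have "dual_ev G x j (space N j) b (decode G \<Lambda> x N (\<psi> x v) j) = \<phi> j (dual_ev G x j (space M j) b (decode G \<Lambda> x M v j))"
        unfolding dec[OF v j(1)]
        by (rule dual_ev_ten_map[OF arrow_val(2)[OF j(1)] wrepD(1)[OF assms(1)] wrepD(1)[OF assms(2)] rep_homD(1)[OF assms(3)] b
              in_sumD[OF D j(1)]])
      then show ?thesis
        using True j act_reflect[OF assms(1) j(1) b v] act_reflect[OF assms(2) j(1) b left_linearD(1)[OF psi_x v]]
        by (simp add: \<psi>_def)
    next
      case False
      then have j: "(i, j) \<in> \<Lambda>" "j \<noteq> x"
        using * assms(4) by (auto simp: reverse_at_sink_iff)
      then show ?thesis
        using False rep_hom_act[OF assms(1-3) j(1) *(2)] *(3)
        by (simp add: \<psi>_def arrow_map_reflect_other)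
    qed
  qed
  moreover have "\<psi> y = \<phi> y" if "y \<noteq> x" for y
    using that by (simp add: \<psi>_def)
  ultimately show thesis
    using dec that by blast
qed

text \<open>For \<open>J = {}\<close> this says that \<open>M\<close> is zero, for a one-element \<open>J\<close> that a morphism is injective.\<close>

definition joint_inj :: "'j set \<Rightarrow> ('i, 'k, 'b, 'v) rep \<Rightarrow> ('j \<Rightarrow> ('i, 'k, 'b, 'w) rep) \<Rightarrow> ('j \<Rightarrow> 'i \<Rightarrow> 'v \<Rightarrow> 'w) \<Rightarrow> bool" where
  "joint_inj J M N \<phi> \<longleftrightarrow> (\<forall>r\<in>J. wrep G \<Lambda> (N r) \<and> \<phi> r \<in> rep_hom G \<Lambda> M (N r)) \<and>
    (\<forall>i. \<forall>v\<in>carrier (space M i). (\<forall>r\<in>J. \<phi> r i v = \<zero>\<^bsub>space (N r) i\<^esub>) \<longrightarrow> v = \<zero>\<^bsub>space M i\<^esub>)"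

end

text \<open>Only the vertex \<open>x\<close> is in question. If all maps kill a kernel element, then
  1 \<otimes> \<phi> kills each of its components for every member \<phi> of the family. By
  naturality \<phi> kills every contraction of that component with a functional. These contractions
  lie at a neighbour, where the family is jointly injective, so they vanish, and then the component
  vanishes by \<open>dual_ev_separates\<close>.\<close>

lemma joint_inj_reflect:
  assumes "oriented_graph G \<Lambda>" "wrep G \<Lambda> M" "sink \<Lambda> x" "oriented_graph.joint_inj G \<Lambda> J M N \<phi>"
  obtains \<psi> where "oriented_graph.joint_inj G (reverse_at x \<Lambda>) J (reflect G \<Lambda> x M) (\<lambda>r. reflect G \<Lambda> x (N r)) \<psi>"
proof -
  interpret oriented_graph G \<Lambda> by fact
  interpret R: oriented_graph G "reverse_at x \<Lambda>" by (rule oriented_graph_reverse)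
  have N: "wrep G \<Lambda> (N r)" "\<phi> r \<in> rep_hom G \<Lambda> M (N r)" if "r \<in> J" for r
    using assms(4) that by (auto simp: joint_inj_def)
  have inj: "v = \<zero>\<^bsub>space M i\<^esub>" if "v \<in> carrier (space M i)" "\<And>r. r \<in> J \<Longrightarrow> \<phi> r i v = \<zero>\<^bsub>space (N r) i\<^esub>" for i v
    using assms(4) that by (auto simp: joint_inj_def)
  have "\<forall>r\<in>J. \<exists>\<psi>. \<psi> \<in> rep_hom G (reverse_at x \<Lambda>) (reflect G \<Lambda> x M) (reflect G \<Lambda> x (N r)) \<and>
    (\<forall>y. y \<noteq> x \<longrightarrow> \<psi> y = \<phi> r y) \<and>
    (\<forall>w y. w \<in> carrier (space (reflect G \<Lambda> x M) x) \<longrightarrow> (y, x) \<in> \<Lambda> \<longrightarrow>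
      decode G \<Lambda> x (N r) (\<psi> x w) y = ten_map G x y (space (N r) y) (\<phi> r y) (decode G \<Lambda> x M w y))"
  proof
    fix r assume "r \<in> J"
    from reflect_hom[OF assms(2) N[OF this] assms(3)]
    show "\<exists>\<psi>. \<psi> \<in> rep_hom G (reverse_at x \<Lambda>) (reflect G \<Lambda> x M) (reflect G \<Lambda> x (N r)) \<and>
      (\<forall>y. y \<noteq> x \<longrightarrow> \<psi> y = \<phi> r y) \<and>
      (\<forall>w y. w \<in> carrier (space (reflect G \<Lambda> x M) x) \<longrightarrow> (y, x) \<in> \<Lambda> \<longrightarrow>
        decode G \<Lambda> x (N r) (\<psi> x w) y = ten_map G x y (space (N r) y) (\<phi> r y) (decode G \<Lambda> x M w y))"
      by metis
  qed
  then obtain \<psi> where psi: "\<And>r. r \<in> J \<Longrightarrow> \<psi> r \<in> rep_hom G (reverse_at x \<Lambda>) (reflect G \<Lambda> x M) (reflect G \<Lambda> x (N r))"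
    "\<And>r y. r \<in> J \<Longrightarrow> y \<noteq> x \<Longrightarrow> \<psi> r y = \<phi> r y"
    "\<And>r w y. r \<in> J \<Longrightarrow> w \<in> carrier (space (reflect G \<Lambda> x M) x) \<Longrightarrow> (y, x) \<in> \<Lambda> \<Longrightarrow>
      decode G \<Lambda> x (N r) (\<psi> r x w) y = ten_map G x y (space (N r) y) (\<phi> r y) (decode G \<Lambda> x M w y)"
    unfolding bchoice_iff by blast
  have "v = \<zero>\<^bsub>space (reflect G \<Lambda> x M) i\<^esub>"
    if v: "v \<in> carrier (space (reflect G \<Lambda> x M) i)" "\<And>r. r \<in> J \<Longrightarrow> \<psi> r i v = \<zero>\<^bsub>space (reflect G \<Lambda> x (N r)) i\<^esub>" for i v
  proof (cases "i = x")
    case False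
    then show ?thesis
      using inj[of v i] v psi(2) by simp
  next
    case True
    note v = v[unfolded True]
    have D: "decode G \<Lambda> x M v \<in> carrier (in_sum G \<Lambda> x M)"
      using decode_closed(1)[OF v(1)] by (simp add: reflection_ker_carrier)
    have "decode G \<Lambda> x M v y = \<zero>\<^bsub>ten G x y (space M y)\<^esub>" if y: "(y, x) \<in> \<Lambda>" for y
    proof (rule dual_ev_separates[OF arrow_val(2)[OF y] wrepD(1)[OF assms(2)] in_sumD[OF D y]])
      fix c assume c: "c \<in> carrier (bimod G y x)"
      show "dual_ev G x y (space M y) c (decode G \<Lambda> x M v y) = \<zero>\<^bsub>space M y\<^esub>"
      proof (rule inj)
        show "dual_ev G x y (space M y) c (decode G \<Lambda> x M v y) \<in> carrier (space M y)"
          using dual_ev_linear(1)[OF arrow_val(2,1)[OF y] wrepD(1)[OF assms(2)] c in_sumD[OF D y]] .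
        fix r assume r: "r \<in> J"
        have "\<zero>\<^bsub>ten G x y (space (N r) y)\<^esub> = decode G \<Lambda> x (N r) \<zero>\<^bsub>space (reflect G \<Lambda> x (N r)) x\<^esub> y"
          using left_linear_zero[OF decode_linear[OF N(1)[OF r] y] left_module_reflect[OF N(1)[OF r]]
             left_module_ten[OF arrow_val(2)[OF y] wrepD(1)[OF N(1)[OF r]]]] by simp
        also have "\<dots> = ten_map G x y (space (N r) y) (\<phi> r y) (decode G \<Lambda> x M v y)"
          using psi(3)[OF r v(1) y] v(2)[OF r] by simp
        finally have z: "ten_map G x y (space (N r) y) (\<phi> r y) (decode G \<Lambda> x M v y) = \<zero>\<^bsub>ten G x y (space (N r) y)\<^esub>"
          by simp
        have "\<phi> r y (dual_ev G x y (space M y) c (decode G \<Lambda> x M v y)) =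
          dual_ev G x y (space (N r) y) c (ten_map G x y (space (N r) y) (\<phi> r y) (decode G \<Lambda> x M v y))"
          using dual_ev_ten_map[OF arrow_val(2)[OF y] wrepD(1)[OF assms(2)] wrepD(1)[OF N(1)[OF r]]
            rep_homD(1)[OF N(2)[OF r]] c in_sumD[OF D y]] by simp
        then show "\<phi> r y (dual_ev G x y (space M y) c (decode G \<Lambda> x M v y)) = \<zero>\<^bsub>space (N r) y\<^esub>"
          unfolding z using dual_ev_linear(4)[OF arrow_val(2,1)[OF y] wrepD(1)[OF N(1)[OF r]] c] by simp
      qed
    qed
    then have "decode G \<Lambda> x M v = \<zero>\<^bsub>reflection_ker G \<Lambda> x M\<^esub>"
      using D by (auto simp: reflection_ker_eq dsum_def PiE_iff extensional_def fun_eq_iff restrict_def)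
    then have "v = encode \<zero>\<^bsub>reflection_ker G \<Lambda> x M\<^esub>"
      using decode_closed(2)[OF v(1)] by simp
    then show ?thesis
      using left_linear_zero[OF encode_linear[OF assms(2)] left_module_reflection_ker[OF assms(2)] left_module_reflect[OF assms(2)]] True
      by simp
  qed
  then have "R.joint_inj J (reflect G \<Lambda> x M) (\<lambda>r. reflect G \<Lambda> x (N r)) \<psi>"
    unfolding R.joint_inj_def using psi(1) wrep_reflect N(1) assms(3) by blast
  with that show thesis .
qed

text \<open>The common source of the facts on annihilation. An empty \<open>J\<close> shows that
  sequences may be prolonged, one morphism handles isomorphisms and embedded summands, and the
  projections of a direct sum handle the sum itself.\<close>

lemma reflect_seq_zero_joint_inj:
  assumes "oriented_graph G \<Lambda>" "wrep G \<Lambda> M" "admissible \<Lambda> S" "oriented_graph.joint_inj G \<Lambda> J M N \<phi>"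
    and "\<And>r. r \<in> J \<Longrightarrow> rep_is_zero (reflect_seq G \<Lambda> S (N r))"
  shows "rep_is_zero (reflect_seq G \<Lambda> S M)"
  using assms
proof (induction S arbitrary: \<Lambda> M N \<phi>)
  case Nil
  interpret oriented_graph G \<Lambda> by fact
  have "carrier (space M i) = {\<zero>\<^bsub>space M i\<^esub>}" for i
  proof -
    interpret V: left_module "dring G i" "space M i" using wrepD(1)[OF Nil.prems(2)] .
    have "v = \<zero>\<^bsub>space M i\<^esub>" if v: "v \<in> carrier (space M i)" for v
    proof -
      have "\<phi> r i v = \<zero>\<^bsub>space (N r) i\<^esub>" if "r \<in> J" for r
        using Nil.prems(4) Nil.prems(5)[OF that] that left_linearD(1)[OF rep_homD(1) v]
        unfolding joint_inj_def rep_is_zero_def by fastforce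
      then show ?thesis
        using Nil.prems(4) v unfolding joint_inj_def by blast
    qed
    then show ?thesis by auto
  qed
  then show ?case by (simp add: rep_is_zero_def)
next
  case (Cons x S)
  interpret oriented_graph G \<Lambda> by fact
  have x: "sink \<Lambda> x" "admissible (reverse_at x \<Lambda>) S"
    using Cons.prems(3) by auto
  obtain \<psi> where psi: "oriented_graph.joint_inj G (reverse_at x \<Lambda>) J (reflect G \<Lambda> x M) (\<lambda>r. reflect G \<Lambda> x (N r)) \<psi>"
    using joint_inj_reflect[OF Cons.prems(1,2) x(1) Cons.prems(4)] by blast
  show ?case
    using Cons.IH[OF oriented_graph_reverse wrep_reflect[OF Cons.prems(2) x(1)] x(2) psi] Cons.prems(5)
    by simp
qed

section \<open>Indecomposable representations\<close>

text \<open>The universal property of a quotient, stated for a surjection. It supplies the component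
  at the sink when a morphism between reflections is lifted.\<close>

lemma left_linear_factor:
  assumes "left_module R A" "left_module R B" "left_module R C"
    and f: "f \<in> left_linear R A B" "f ` carrier A = carrier B" and g: "g \<in> left_linear R A C"
    and ker: "\<And>a. a \<in> carrier A \<Longrightarrow> f a = \<zero>\<^bsub>B\<^esub> \<Longrightarrow> g a = \<zero>\<^bsub>C\<^esub>"
  obtains h where "h \<in> left_linear R B C" "\<And>a. a \<in> carrier A \<Longrightarrow> h (f a) = g a"
proof -
  interpret A: left_module R A by fact
  interpret B: left_module R B by fact
  interpret C: left_module R C by fact
  note fl = left_linearD[OF f(1)] and gl = left_linearD[OF g]
  define s where "s = inv_into (carrier A) f"
  have s: "s b \<in> carrier A" "f (s b) = b" if "b \<in> carrier B" for b
    using that f(2) by (auto simp: s_def intro: inv_into_into f_inv_into_f)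
  \<comment> \<open>The chosen preimage of \<open>f a\<close> differs from \<open>a\<close> by an
    element of the kernel of \<open>f\<close>, where \<open>g\<close> vanishes.\<close>
  have hf: "g (s (f a)) = g a" if a: "a \<in> carrier A" for a
  proof -
    have s': "s (f a) \<in> carrier A" "f (s (f a)) = f a"
      using s fl(1) a by auto
    have "f (s (f a) \<oplus>\<^bsub>A\<^esub> \<ominus>\<^bsub>A\<^esub> a) = \<zero>\<^bsub>B\<^esub>"
      using a s' fl by (simp add: left_linear_minus[OF f(1) assms(1,2)] B.M.r_neg)
    then have "g (s (f a) \<oplus>\<^bsub>A\<^esub> \<ominus>\<^bsub>A\<^esub> a) = \<zero>\<^bsub>C\<^esub>"
      using ker a s' by simp
    then have "g (s (f a)) \<oplus>\<^bsub>C\<^esub> \<ominus>\<^bsub>C\<^esub> g a = \<zero>\<^bsub>C\<^esub>"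
      using a s' gl by (simp add: left_linear_minus[OF g assms(1,3)])
    then have "g (s (f a)) \<oplus>\<^bsub>C\<^esub> \<ominus>\<^bsub>C\<^esub> g a \<oplus>\<^bsub>C\<^esub> g a = g a"
      using gl(1) a by simp
    then show ?thesis
      using a s' gl(1) by (simp add: C.M.a_assoc C.M.l_neg)
  qed
  show thesis
  proof (rule that)
    show "(\<lambda>b. g (s b)) \<in> left_linear R B C"
    proof (rule left_linearI)
      fix x y assume xy: "x \<in> carrier B" "y \<in> carrier B"
      have "g (s (x \<oplus>\<^bsub>B\<^esub> y)) = g (s (f (s x \<oplus>\<^bsub>A\<^esub> s y)))"
        using s xy fl by simp
      also have "\<dots> = g (s x) \<oplus>\<^bsub>C\<^esub> g (s y)"
        using s xy gl by (subst hf) simp_all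
      finally show "g (s (x \<oplus>\<^bsub>B\<^esub> y)) = g (s x) \<oplus>\<^bsub>C\<^esub> g (s y)" .
    next
      fix r x assume rx: "r \<in> carrier R" "x \<in> carrier B"
      have "g (s (r \<odot>\<^bsub>B\<^esub> x)) = g (s (f (r \<odot>\<^bsub>A\<^esub> s x)))"
        using s rx fl by simp
      also have "\<dots> = r \<odot>\<^bsub>C\<^esub> g (s x)"
        using s rx gl A.smult_closed by (subst hf) simp_all
      finally show "g (s (r \<odot>\<^bsub>B\<^esub> x)) = r \<odot>\<^bsub>C\<^esub> g (s x)" .
    qed (use s gl in simp)
  qed (rule hf)
qed

text \<open>Indecomposability in terms of the endomorphisms of \<open>M\<close> alone. In this form
  it passes through fully faithful functors and along isomorphisms between different types of
  elements, and it does not mention finite dimension.\<close>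

definition idem_indec :: "('i, 'k, 'b, 'c) modulation \<Rightarrow> ('i \<times> 'i) set \<Rightarrow> ('i, 'k, 'b, 'v) rep \<Rightarrow> bool" where
  "idem_indec G \<Lambda> M \<longleftrightarrow> \<not> rep_is_zero M \<and>
    (\<forall>e\<in>rep_hom G \<Lambda> M M. (\<forall>i. \<forall>v\<in>carrier (space M i). e i (e i v) = e i v) \<longrightarrow>
      (\<forall>i. \<forall>v\<in>carrier (space M i). e i v = \<zero>\<^bsub>space M i\<^esub>) \<or> (\<forall>i. \<forall>v\<in>carrier (space M i). e i v = v))"

section \<open>Full faithfulness of reflections and reconstruction\<close>

context oriented_graph
begin

lemma no_loop: "(x, x) \<notin> \<Lambda>"
  using orient by (auto simp: orientation_def)

definition sink_surj :: "'i \<Rightarrow> ('i, 'k, 'b, 'v) rep \<Rightarrow> bool" where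
  "sink_surj x M \<longleftrightarrow> sink_map \<Lambda> x M ` carrier (in_sum G \<Lambda> x M) = carrier (space M x)"

abbreviation single :: "'i \<Rightarrow> 'i \<Rightarrow> ('i, 'k, 'b, 'v) rep \<Rightarrow> ('b, 'v) tens \<Rightarrow> 'i \<Rightarrow> ('b, 'v) tens" where
  "single x i M u \<equiv> \<lambda>y\<in>{y. (y, x) \<in> \<Lambda>}. if y = i then u else \<zero>\<^bsub>ten G x y (space M y)\<^esub>"

lemma ten_zero_closed:
  assumes "wrep G \<Lambda> M" "(y, x) \<in> \<Lambda>"
  shows "\<zero>\<^bsub>ten G x y (space M y)\<^esub> \<in> carrier (ten G x y (space M y))"
proof -
  interpret T: left_module "dring G x" "ten G x y (space M y)"
    using left_module_ten[OF arrow_val(2)[OF assms(2)] wrepD(1)[OF assms(1)]] .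
  show ?thesis by simp
qed

lemma single_closed:
  assumes "wrep G \<Lambda> M" "u \<in> carrier (ten G x i (space M i))"
  shows "single x i M u \<in> carrier (in_sum G \<Lambda> x M)"
  using assms ten_zero_closed[OF assms(1)] by (auto simp: dsum_def)

lemma sink_map_single:
  assumes "wrep G \<Lambda> M" "(i, x) \<in> \<Lambda>" "u \<in> carrier (ten G x i (space M i))"
  shows "sink_map \<Lambda> x M (single x i M u) = arrow_map M i x u"
proof -
  interpret V: left_module "dring G x" "space M x" using wrepD(1)[OF assms(1)] .
  have "sink_map \<Lambda> x M (single x i M u) = finsum (space M x) (\<lambda>y. if i = y then arrow_map M y x u else \<zero>\<^bsub>space M x\<^esub>) {y. (y, x) \<in> \<Lambda>}"
    unfolding sink_map_def
  proof (rule finsum_cong_weak)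
    fix y assume y: "y \<in> {y. (y, x) \<in> \<Lambda>}"
    then have "arrow_map M y x \<zero>\<^bsub>ten G x y (space M y)\<^esub> = \<zero>\<^bsub>space M x\<^esub>"
      using left_linear_zero[OF wrepD(2)[OF assms(1)] left_module_ten[OF arrow_val(2) wrepD(1)[OF assms(1)]] wrepD(1)[OF assms(1)]]
      by simp
    with y show "arrow_map M y x (single x i M u y) = (if i = y then arrow_map M y x u else \<zero>\<^bsub>space M x\<^esub>)"
      by auto
  qed
  also have "\<dots> = finsum (space M x) (\<lambda>y. if i = y then (\<lambda>y. arrow_map M i x u) y else \<zero>\<^bsub>space M x\<^esub>) {y. (y, x) \<in> \<Lambda>}"
    by (rule finsum_cong_weak) auto
  also have "\<dots> = arrow_map M i x u"
    using assms(2) left_linearD(1)[OF wrepD(2)[OF assms(1,2)] assms(3)]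
    by (intro V.add.finprod_singleton) auto
  finally show ?thesis .
qed

text \<open>A morphism commutes with the maps h, so on the image of h its component at
  \<open>x\<close> is determined by the components at the neighbours.\<close>

lemma sink_surj_hom_eq:
  assumes "wrep G \<Lambda> M" "wrep G \<Lambda> N" "sink_surj x M" "\<phi> \<in> rep_hom G \<Lambda> M N" "\<psi> \<in> rep_hom G \<Lambda> M N"
    and "\<And>y v. y \<noteq> x \<Longrightarrow> v \<in> carrier (space M y) \<Longrightarrow> \<phi> y v = \<psi> y v" "v \<in> carrier (space M i)"
  shows "\<phi> i v = \<psi> i v"
proof (cases "i = x")
  case True
  then obtain t where t: "t \<in> carrier (in_sum G \<Lambda> x M)" "v = sink_map \<Lambda> x M t"
    using assms(3,7) by (auto simp: sink_surj_def)
  have "ten_map G x y (space N y) (\<phi> y) (t y) = ten_map G x y (space N y) (\<psi> y) (t y)" if y: "(y, x) \<in> \<Lambda>" for y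
  proof (rule ten_map_cong[OF arrow_val(2)[OF y] wrepD(1)[OF assms(1)] wrepD(1)[OF assms(2)] rep_homD(1)[OF assms(4)]
      rep_homD(1)[OF assms(5)] _ in_sumD[OF t(1) y]])
    show "\<phi> y v = \<psi> y v" if "v \<in> carrier (space M y)" for v
      using assms(6) that y no_loop by metis
  qed
  then have "(\<lambda>y\<in>{y. (y, x) \<in> \<Lambda>}. ten_map G x y (space N y) (\<phi> y) (t y)) =
    (\<lambda>y\<in>{y. (y, x) \<in> \<Lambda>}. ten_map G x y (space N y) (\<psi> y) (t y))"
    by (auto intro: restrict_ext)
  then show ?thesis
    using sink_map_hom[OF assms(1,2,4) t(1)] sink_map_hom[OF assms(1,2,5) t(1)] True t(2) by simp
qed (use assms in simp)

lemma reflect_arrow: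
  assumes "sink \<Lambda> x" "(y, x) \<in> \<Lambda>"
  shows "(x, y) \<in> reverse_at x \<Lambda>" "y \<noteq> x"
  using assms no_loop by (auto simp: reverse_at_sink_iff)

text \<open>Here \<open>\<psi>\<close> is an arbitrary morphism between reflections, not one
  produced by \<open>reflect_hom\<close>. Its compatibility with the reversed arrow into
  \<open>y\<close> fixes all contractions of the component at \<open>y\<close>, and these determine
  the component by \<open>dual_ev_eqI\<close>.\<close>

lemma reflect_hom_decode:
  assumes "wrep G \<Lambda> M" "wrep G \<Lambda> N" "sink \<Lambda> x"
    and psi: "\<psi> \<in> rep_hom G (reverse_at x \<Lambda>) (reflect G \<Lambda> x M) (reflect G \<Lambda> x N)"
    and y: "(y, x) \<in> \<Lambda>" and w: "w \<in> carrier (space (reflect G \<Lambda> x M) x)"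
  shows "decode G \<Lambda> x N (\<psi> x w) y = ten_map G x y (space N y) (\<psi> y) (decode G \<Lambda> x M w y)"
proof -
  interpret R: oriented_graph G "reverse_at x \<Lambda>" by (rule oriented_graph_reverse)
  have psi_y: "\<psi> y \<in> left_linear (dring G y) (space M y) (space N y)"
    using rep_homD(1)[OF psi, of y] reflect_arrow(2)[OF assms(3) y] by simp
  have w': "\<psi> x w \<in> carrier (space (reflect G \<Lambda> x N) x)"
    using left_linearD(1)[OF rep_homD(1)[OF psi] w] .
  note D = left_linearD(1)[OF decode_linear[OF assms(1) y] w]
  note D' = left_linearD(1)[OF decode_linear[OF assms(2) y] w']
  show ?thesis
  proof (rule dual_ev_eqI[OF arrow_val(2,1)[OF y] wrepD(1)[OF assms(2)] D'])
    show "ten_map G x y (space N y) (\<psi> y) (decode G \<Lambda> x M w y) \<in> carrier (ten G x y (space N y))"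
      using left_linearD(1)[OF ten_map_linear[OF arrow_val(2)[OF y] wrepD(1)[OF assms(1)] wrepD(1)[OF assms(2)] psi_y] D] .
    fix c assume c: "c \<in> carrier (bimod G y x)"
    have "dual_ev G x y (space N y) c (decode G \<Lambda> x N (\<psi> x w) y) = \<psi> y (act G (reflect G \<Lambda> x M) x y c w)"
      using act_reflect[OF assms(2) y c w'] R.rep_hom_act[OF wrep_reflect[OF assms(1,3)] wrep_reflect[OF assms(2,3)] psi
        reflect_arrow(1)[OF assms(3) y] c w] by simp
    also have "\<dots> = dual_ev G x y (space N y) c (ten_map G x y (space N y) (\<psi> y) (decode G \<Lambda> x M w y))"
      using act_reflect[OF assms(1) y c w] dual_ev_ten_map[OF arrow_val(2)[OF y] wrepD(1)[OF assms(1)] wrepD(1)[OF assms(2)] psi_y c D]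
      by simp
    finally show "dual_ev G x y (space N y) c (decode G \<Lambda> x N (\<psi> x w) y) =
      dual_ev G x y (space N y) c (ten_map G x y (space N y) (\<psi> y) (decode G \<Lambda> x M w y))" .
  qed
qed

lemma decode_eqI:
  assumes "v \<in> carrier (space (reflect G \<Lambda> x M) x)" "w \<in> carrier (space (reflect G \<Lambda> x M) x)"
    "\<And>y. (y, x) \<in> \<Lambda> \<Longrightarrow> decode G \<Lambda> x M v y = decode G \<Lambda> x M w y"
  shows "v = w"
proof -
  have "decode G \<Lambda> x M u \<in> carrier (in_sum G \<Lambda> x M)" if "u \<in> carrier (space (reflect G \<Lambda> x M) x)" for u
    using decode_closed(1)[OF that] by (simp add: reflection_ker_carrier)
  from this[OF assms(1)] this[OF assms(2)] have "decode G \<Lambda> x M v = decode G \<Lambda> x M w"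
    using assms(3) by (intro PiE_ext[of _ "{y. (y, x) \<in> \<Lambda>}" "\<lambda>y. carrier (ten G x y (space M y))"]) (auto simp: dsum_def)
  then show ?thesis
    using decode_closed(2)[OF assms(1)] decode_closed(2)[OF assms(2)] by metis
qed

text \<open>The new space at \<open>x\<close> embeds into the tensors over the neighbours, so
  \<open>reflect_hom_decode\<close> determines the component at \<open>x\<close> from the others.
  This compares arbitrary morphisms between reflections.\<close>

lemma reflect_faithful:
  assumes "wrep G \<Lambda> M" "wrep G \<Lambda> N" "sink \<Lambda> x"
    and \<phi>: "\<phi> \<in> rep_hom G (reverse_at x \<Lambda>) (reflect G \<Lambda> x M) (reflect G \<Lambda> x N)"
    and \<psi>: "\<psi> \<in> rep_hom G (reverse_at x \<Lambda>) (reflect G \<Lambda> x M) (reflect G \<Lambda> x N)"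
    and eq: "\<And>y v. y \<noteq> x \<Longrightarrow> v \<in> carrier (space M y) \<Longrightarrow> \<phi> y v = \<psi> y v"
    and v: "v \<in> carrier (space (reflect G \<Lambda> x M) i)"
  shows "\<phi> i v = \<psi> i v"
proof (cases "i = x")
  case True
  note v = v[unfolded True]
  have "\<phi> x v = \<psi> x v"
  proof (rule decode_eqI)
    show "\<phi> x v \<in> carrier (space (reflect G \<Lambda> x N) x)" "\<psi> x v \<in> carrier (space (reflect G \<Lambda> x N) x)"
      using left_linearD(1)[OF rep_homD(1)[OF \<phi>] v] left_linearD(1)[OF rep_homD(1)[OF \<psi>] v] .
    fix y assume y: "(y, x) \<in> \<Lambda>"
    have "\<phi> y \<in> left_linear (dring G y) (space M y) (space N y)" "\<psi> y \<in> left_linear (dring G y) (space M y) (space N y)"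
      using rep_homD(1)[OF \<phi>, of y] rep_homD(1)[OF \<psi>, of y] reflect_arrow(2)[OF assms(3) y] by simp_all
    from ten_map_cong[OF arrow_val(2)[OF y] wrepD(1)[OF assms(1)] wrepD(1)[OF assms(2)] this
        eq[OF reflect_arrow(2)[OF assms(3) y]] left_linearD(1)[OF decode_linear[OF assms(1) y] v]]
    show "decode G \<Lambda> x N (\<phi> x v) y = decode G \<Lambda> x N (\<psi> x v) y"
      by (simp add: reflect_hom_decode[OF assms(1-3) \<phi> y v] reflect_hom_decode[OF assms(1-3) \<psi> y v])
  qed
  with True show ?thesis by simp
qed (use eq v in simp)

text \<open>The maps 1 \<otimes> \<psi> between the direct sums restrict on the kernels to the
  component of \<open>\<psi>\<close> at \<open>x\<close>. So they map kernel to kernel and induce a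
  map of the quotients by the kernels. The quotient for \<open>M\<close> is the whole space at
  \<open>x\<close>, since h is onto.\<close>

lemma reflect_full:
  assumes "wrep G \<Lambda> M" "wrep G \<Lambda> N" "sink \<Lambda> x" "sink_surj x M"
    and psi: "\<psi> \<in> rep_hom G (reverse_at x \<Lambda>) (reflect G \<Lambda> x M) (reflect G \<Lambda> x N)"
  obtains \<phi> where "\<phi> \<in> rep_hom G \<Lambda> M N" "\<And>y. y \<noteq> x \<Longrightarrow> \<phi> y = \<psi> y"
proof -
  interpret R: oriented_graph G "reverse_at x \<Lambda>" by (rule oriented_graph_reverse)
  let ?Y = "{y. (y, x) \<in> \<Lambda>}"
  define d where "d = (\<lambda>t. \<lambda>y\<in>?Y. ten_map G x y (space N y) (\<psi> y) (t y))"
  have psi_y: "\<psi> y \<in> left_linear (dring G y) (space M y) (space N y)" if "y \<noteq> x" for y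
    using rep_homD(1)[OF psi, of y] that by simp
  have psi_Y: "\<psi> y \<in> left_linear (dring G y) (space M y) (space N y)" if "(y, x) \<in> \<Lambda>" for y
    using psi_y reflect_arrow(2)[OF assms(3) that] by simp
  have d_lin: "d \<in> left_linear (dring G x) (in_sum G \<Lambda> x M) (in_sum G \<Lambda> x N)"
    unfolding d_def by (rule ten_map_in_sum_linear[OF assms(1,2) psi_Y])
  have ker: "sink_map \<Lambda> x N (d t) = \<zero>\<^bsub>space N x\<^esub>"
    if t: "t \<in> carrier (in_sum G \<Lambda> x M)" "sink_map \<Lambda> x M t = \<zero>\<^bsub>space M x\<^esub>" for t
  proof -
    have tK: "t \<in> carrier (reflection_ker G \<Lambda> x M)"
      using t by (simp add: reflection_ker_carrier)
    let ?w = "\<psi> x (encode t)"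
    have w: "?w \<in> carrier (space (reflect G \<Lambda> x N) x)"
      using left_linearD(1)[OF rep_homD(1)[OF psi] encode_closed[OF tK]] .
    have D: "decode G \<Lambda> x N ?w \<in> carrier (in_sum G \<Lambda> x N)" "sink_map \<Lambda> x N (decode G \<Lambda> x N ?w) = \<zero>\<^bsub>space N x\<^esub>"
      using decode_closed(1)[OF w] by (simp_all add: reflection_ker_carrier)
    \<comment> \<open>On the kernel, 1 \<otimes> \<psi> agrees with the component of
      \<open>\<psi>\<close> at \<open>x\<close>. This is where the compatibility of
      \<open>\<psi>\<close> with the reversed arrows enters.\<close>
    have "d t = decode G \<Lambda> x N ?w"
    proof (rule PiE_ext[of _ ?Y "\<lambda>y. carrier (ten G x y (space N y))"])
      show "d t \<in> (\<Pi>\<^sub>E y\<in>?Y. carrier (ten G x y (space N y)))" "decode G \<Lambda> x N ?w \<in> (\<Pi>\<^sub>E y\<in>?Y. carrier (ten G x y (space N y)))"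
        using left_linearD(1)[OF d_lin t(1)] D(1) by (simp_all add: dsum_def)
      show "d t y = decode G \<Lambda> x N ?w y" if "y \<in> ?Y" for y
        using reflect_hom_decode[OF assms(1-3) psi _ encode_closed[OF tK], of y] that decode_encode[OF assms(1) tK]
        by (simp add: d_def)
    qed
    with D show ?thesis by simp
  qed
  obtain h where h: "h \<in> left_linear (dring G x) (space M x) (space N x)"
    "\<And>t. t \<in> carrier (in_sum G \<Lambda> x M) \<Longrightarrow> h (sink_map \<Lambda> x M t) = sink_map \<Lambda> x N (d t)"
    using left_linear_factor[OF left_module_in_sum[OF assms(1)] wrepD(1)[OF assms(1)] wrepD(1)[OF assms(2)]
      sink_map_linear[OF assms(1)] assms(4)[unfolded sink_surj_def] left_linear_compose[OF d_lin sink_map_linear[OF assms(2)]] ker]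
    by blast
  define \<phi> where "\<phi> = \<psi>(x := h)"
  have "\<phi> \<in> rep_hom G \<Lambda> M N"
  proof (rule rep_homI[OF assms(1,2)])
    show "\<phi> i \<in> left_linear (dring G i) (space M i) (space N i)" for i
      using h(1) psi_y by (simp add: \<phi>_def)
  next
    fix i j b v assume *: "(i, j) \<in> \<Lambda>" "b \<in> carrier (bimod G j i)" "v \<in> carrier (space M i)"
    have i: "i \<noteq> x" using assms(3) * by (auto simp: sink_def)
    show "\<phi> j (act G M i j b v) = act G N i j b (\<phi> i v)"
    proof (cases "j = x")
      case False
      then have "(i, j) \<in> reverse_at x \<Lambda>"
        using * assms(3) i by (simp add: reverse_at_sink_iff)
      from R.rep_hom_act[OF wrep_reflect[OF assms(1,3)] wrep_reflect[OF assms(2,3)] psi this *(2), of v] show ?thesis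
        using *(3) i False by (simp add: arrow_map_reflect_other \<phi>_def)
    next
      case True
      note ix = *(1)[unfolded True] and b = *(2)[unfolded True]
      note p = pure_closed[OF arrow_val(2)[OF ix] wrepD(1)[OF assms(1)] b *(3)]
      note p' = pure_closed[OF arrow_val(2)[OF ix] wrepD(1)[OF assms(2)] b left_linearD(1)[OF psi_Y[OF ix] *(3)]]
      \<comment> \<open>An arrow into \<open>x\<close> is h restricted to one summand. The square
        for this arrow is the defining equation of the induced map at a family supported on that
        summand.\<close>
      have "d (single x i M (pure G x i (space M i) b v)) = single x i N (pure G x i (space N i) b (\<psi> i v))"
        unfolding d_def
      proof (rule restrict_ext)
        fix y assume y: "y \<in> ?Y"
        then have y': "(y, x) \<in> \<Lambda>" by simp
        have "ten_map G x y (space N y) (\<psi> y) \<zero>\<^bsub>ten G x y (space M y)\<^esub> = \<zero>\<^bsub>ten G x y (space N y)\<^esub>"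
          by (rule left_linear_zero[OF ten_map_linear[OF arrow_val(2)[OF y'] wrepD(1)[OF assms(1)] wrepD(1)[OF assms(2)] psi_Y[OF y']]
             left_module_ten[OF arrow_val(2)[OF y'] wrepD(1)[OF assms(1)]] left_module_ten[OF arrow_val(2)[OF y'] wrepD(1)[OF assms(2)]]])
        then show "ten_map G x y (space N y) (\<psi> y) (single x i M (pure G x i (space M i) b v) y) =
          (if y = i then pure G x i (space N i) b (\<psi> i v) else \<zero>\<^bsub>ten G x y (space N y)\<^esub>)"
          using y ten_map_pure[OF arrow_val(2)[OF ix] wrepD(1)[OF assms(1)] wrepD(1)[OF assms(2)] psi_Y[OF ix] b *(3)] by simp
      qed
      then show ?thesis
        using h(2)[OF single_closed[OF assms(1) p]] sink_map_single[OF assms(1) ix p] sink_map_single[OF assms(2) ix p'] True i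
        by (simp add: \<phi>_def)
    qed
  qed
  then show thesis
    using that by (simp add: \<phi>_def)
qed

lemma rep_isoE:
  assumes "wrep G \<Lambda> M" "wrep G \<Lambda> N" "rep_iso G \<Lambda> M N"
  obtains \<phi> \<psi> where "\<phi> \<in> rep_hom G \<Lambda> M N" "\<psi> \<in> rep_hom G \<Lambda> N M"
    "\<And>i v. v \<in> carrier (space M i) \<Longrightarrow> \<psi> i (\<phi> i v) = v" "\<And>i v. v \<in> carrier (space N i) \<Longrightarrow> \<phi> i (\<psi> i v) = v"
proof -
  obtain \<phi> where phi: "\<phi> \<in> rep_hom G \<Lambda> M N" "\<And>i. bij_betw (\<phi> i) (carrier (space M i)) (carrier (space N i))"
    using assms(3) by (auto simp: rep_iso_def)
  define \<psi> where "\<psi> i = inv_into (carrier (space M i)) (\<phi> i)" for i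
  have inv: "\<And>i v. v \<in> carrier (space N i) \<Longrightarrow> \<psi> i v \<in> carrier (space M i)"
    "\<And>i v. v \<in> carrier (space M i) \<Longrightarrow> \<psi> i (\<phi> i v) = v"
    "\<And>i v. v \<in> carrier (space N i) \<Longrightarrow> \<phi> i (\<psi> i v) = v"
    using phi(2) unfolding \<psi>_def bij_betw_def by (auto simp: inv_into_into f_inv_into_f)
  from that[OF phi(1) rep_hom_inverse[OF assms(1,2) phi(1) inv] inv(2,3)] show thesis .
qed

lemma rep_isoI:
  assumes "\<phi> \<in> rep_hom G \<Lambda> M N" "\<psi> \<in> rep_hom G \<Lambda> N M"
    "\<And>i v. v \<in> carrier (space M i) \<Longrightarrow> \<psi> i (\<phi> i v) = v" "\<And>i v. v \<in> carrier (space N i) \<Longrightarrow> \<phi> i (\<psi> i v) = v"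
  shows "rep_iso G \<Lambda> M N"
proof -
  have "bij_betw (\<phi> i) (carrier (space M i)) (carrier (space N i))" for i
    using assms left_linearD(1)[OF rep_homD(1)[OF assms(1)]] left_linearD(1)[OF rep_homD(1)[OF assms(2)]]
    by (intro bij_betwI[where g = "\<psi> i"]) auto
  then show ?thesis
    using assms(1) by (auto simp: rep_iso_def)
qed

lemma rep_iso_sym:
  assumes "wrep G \<Lambda> M" "wrep G \<Lambda> N" "rep_iso G \<Lambda> M N"
  shows "rep_iso G \<Lambda> N M"
  using rep_isoE[OF assms] rep_isoI by metis

lemma rep_iso_trans:
  assumes "wrep G \<Lambda> M" "wrep G \<Lambda> N" "wrep G \<Lambda> P" "rep_iso G \<Lambda> M N" "rep_iso G \<Lambda> N P"
  shows "rep_iso G \<Lambda> M P"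
proof -
  obtain f f' where f: "f \<in> rep_hom G \<Lambda> M N" "f' \<in> rep_hom G \<Lambda> N M"
    "\<And>i v. v \<in> carrier (space M i) \<Longrightarrow> f' i (f i v) = v" "\<And>i v. v \<in> carrier (space N i) \<Longrightarrow> f i (f' i v) = v"
    using rep_isoE[OF assms(1,2,4)] by blast
  obtain g g' where g: "g \<in> rep_hom G \<Lambda> N P" "g' \<in> rep_hom G \<Lambda> P N"
    "\<And>i v. v \<in> carrier (space N i) \<Longrightarrow> g' i (g i v) = v" "\<And>i v. v \<in> carrier (space P i) \<Longrightarrow> g i (g' i v) = v"
    using rep_isoE[OF assms(2,3,5)] by blast
  show ?thesis
    by (rule rep_isoI[OF rep_hom_compose[OF assms(1-3) f(1) g(1)] rep_hom_compose[OF assms(3,2,1) g(2) f(2)]])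
      (simp_all add: f g left_linearD(1)[OF rep_homD(1)[OF f(1)]] left_linearD(1)[OF rep_homD(1)[OF g(2)]])
qed

lemma rep_hom_id:
  assumes "wrep G \<Lambda> M"
  shows "(\<lambda>i v. v) \<in> rep_hom G \<Lambda> M M"
  by (rule rep_homI[OF assms assms]) (auto intro: left_linearI)

lemma rep_hom_zero:
  assumes "wrep G \<Lambda> M" "wrep G \<Lambda> N"
  shows "(\<lambda>i v. \<zero>\<^bsub>space N i\<^esub>) \<in> rep_hom G \<Lambda> M N"
proof (rule rep_homI[OF assms])
  fix i
  interpret V: left_module "dring G i" "space N i" using wrepD(1)[OF assms(2)] .
  show "(\<lambda>v. \<zero>\<^bsub>space N i\<^esub>) \<in> left_linear (dring G i) (space M i) (space N i)"
    by (rule left_linearI) (auto simp: V.smult_zero)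
qed (simp add: act_zero[OF assms(2)])

text \<open>The two lifts of mutually inverse morphisms compose to the identity away from
  \<open>x\<close>, and then at \<open>x\<close> too by \<open>sink_surj_hom_eq\<close>.\<close>

lemma reflect_reconstruct:
  assumes "wrep G \<Lambda> M" "wrep G \<Lambda> N" "sink \<Lambda> x" "sink_surj x M" "sink_surj x N"
    and "rep_iso G (reverse_at x \<Lambda>) (reflect G \<Lambda> x M) (reflect G \<Lambda> x N)"
  shows "rep_iso G \<Lambda> M N"
proof -
  interpret R: oriented_graph G "reverse_at x \<Lambda>" by (rule oriented_graph_reverse)
  obtain f g where fg: "f \<in> rep_hom G (reverse_at x \<Lambda>) (reflect G \<Lambda> x M) (reflect G \<Lambda> x N)"
    "g \<in> rep_hom G (reverse_at x \<Lambda>) (reflect G \<Lambda> x N) (reflect G \<Lambda> x M)"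
    "\<And>i v. v \<in> carrier (space (reflect G \<Lambda> x M) i) \<Longrightarrow> g i (f i v) = v"
    "\<And>i v. v \<in> carrier (space (reflect G \<Lambda> x N) i) \<Longrightarrow> f i (g i v) = v"
    using R.rep_isoE[OF wrep_reflect[OF assms(1,3)] wrep_reflect[OF assms(2,3)] assms(6)] by blast
  obtain \<phi> where \<phi>: "\<phi> \<in> rep_hom G \<Lambda> M N" "\<And>y. y \<noteq> x \<Longrightarrow> \<phi> y = f y"
    using reflect_full[OF assms(1-4) fg(1)] by blast
  obtain \<psi> where \<psi>: "\<psi> \<in> rep_hom G \<Lambda> N M" "\<And>y. y \<noteq> x \<Longrightarrow> \<psi> y = g y"
    using reflect_full[OF assms(2,1,3,5) fg(2)] by blast
  show ?thesis
  proof (rule rep_isoI[OF \<phi>(1) \<psi>(1)])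
    show "\<psi> i (\<phi> i v) = v" if "v \<in> carrier (space M i)" for i v
      using sink_surj_hom_eq[OF assms(1,1,4) rep_hom_compose[OF assms(1,2,1) \<phi>(1) \<psi>(1)] rep_hom_id[OF assms(1)] _ that]
        fg(3) by (simp add: \<phi>(2) \<psi>(2))
    show "\<phi> i (\<psi> i v) = v" if "v \<in> carrier (space N i)" for i v
      using sink_surj_hom_eq[OF assms(2,2,5) rep_hom_compose[OF assms(2,1,2) \<psi>(1) \<phi>(1)] rep_hom_id[OF assms(2)] _ that]
        fg(4) by (simp add: \<phi>(2) \<psi>(2))
  qed
qed

text \<open>No arrow starts at the sink, and \<open>f\<close> kills the images of the arrows that
  end there, so every square commutes trivially. With \<open>M\<close> and \<open>N\<close> equal
  this gives the projections onto lines; in general it gives the isomorphism between simple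
  representations.\<close>

lemma rank_one_hom:
  assumes "wrep G \<Lambda> M" "wrep G \<Lambda> N" "sink \<Lambda> x" "c \<in> carrier (space N x)"
    "f \<in> functionals (dring G x) (space M x)"
    "\<And>i b v. (i, x) \<in> \<Lambda> \<Longrightarrow> b \<in> carrier (bimod G x i) \<Longrightarrow> v \<in> carrier (space M i) \<Longrightarrow> f (act G M i x b v) = \<zero>\<^bsub>dring G x\<^esub>"
  shows "(\<lambda>i v. if i = x then f v \<odot>\<^bsub>space N x\<^esub> c else \<zero>\<^bsub>space N i\<^esub>) \<in> rep_hom G \<Lambda> M N"
proof (rule rep_homI[OF assms(1,2)])
  fix i
  interpret V: left_module "dring G i" "space N i" using wrepD(1)[OF assms(2)] .
  interpret W: left_module "dring G x" "space N x" using wrepD(1)[OF assms(2)] .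
  show "(\<lambda>v. if i = x then f v \<odot>\<^bsub>space N x\<^esub> c else \<zero>\<^bsub>space N i\<^esub>) \<in> left_linear (dring G i) (space M i) (space N i)"
    by (rule left_linearI)
      (use assms(4) functionalsD[OF assms(5)] in
        \<open>auto simp: V.smult_zero W.smult_closed W.smult_l_distr W.smult_assoc1\<close>)
next
  interpret V: left_module "dring G x" "space N x" using wrepD(1)[OF assms(2)] .
  fix i j b v assume *: "(i, j) \<in> \<Lambda>" "b \<in> carrier (bimod G j i)" "v \<in> carrier (space M i)"
  then have "i \<noteq> x" using assms(3) by (auto simp: sink_def)
  then show "(if j = x then f (act G M i j b v) \<odot>\<^bsub>space N x\<^esub> c else \<zero>\<^bsub>space N j\<^esub>) =
    act G N i j b (if i = x then f v \<odot>\<^bsub>space N x\<^esub> c else \<zero>\<^bsub>space N i\<^esub>)"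
    using * assms(4,6) act_zero[OF assms(2) *(1,2)] by (auto simp: V.zero_smult)
qed

text \<open>The new space at \<open>x\<close> consists of families of tensors over the neighbours.
  When the spaces there vanish, all contractions vanish, hence so do the tensors. The old space at
  \<open>x\<close> leaves no trace.\<close>

lemma reflect_zero_iff:
  assumes "wrep G \<Lambda> M"
  shows "rep_is_zero (reflect G \<Lambda> x M) \<longleftrightarrow> (\<forall>y. y \<noteq> x \<longrightarrow> carrier (space M y) = {\<zero>\<^bsub>space M y\<^esub>})"
proof
  assume "rep_is_zero (reflect G \<Lambda> x M)"
  then show "\<forall>y. y \<noteq> x \<longrightarrow> carrier (space M y) = {\<zero>\<^bsub>space M y\<^esub>}"
    unfolding rep_is_zero_def by (metis reflect_other)
next
  assume z: "\<forall>y. y \<noteq> x \<longrightarrow> carrier (space M y) = {\<zero>\<^bsub>space M y\<^esub>}"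
  interpret W: left_module "dring G x" "space (reflect G \<Lambda> x M) x" using left_module_reflect[OF assms] .
  have "w = \<zero>\<^bsub>space (reflect G \<Lambda> x M) x\<^esub>" if w: "w \<in> carrier (space (reflect G \<Lambda> x M) x)" for w
  proof (rule decode_eqI[OF w W.zero_closed])
    fix y assume y: "(y, x) \<in> \<Lambda>"
    have y': "y \<noteq> x" using y no_loop by auto
    have zero: "t = \<zero>\<^bsub>ten G x y (space M y)\<^esub>" if t: "t \<in> carrier (ten G x y (space M y))" for t
      by (rule dual_ev_separates[OF arrow_val(2)[OF y] wrepD(1)[OF assms] t])
        (use dual_ev_linear(1)[OF arrow_val(2,1)[OF y] wrepD(1)[OF assms] _ t] z y' in blast)
    show "decode G \<Lambda> x M w y = decode G \<Lambda> x M \<zero>\<^bsub>space (reflect G \<Lambda> x M) x\<^esub> y"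
      using zero[OF left_linearD(1)[OF decode_linear[OF assms y] w]]
        zero[OF left_linearD(1)[OF decode_linear[OF assms y] W.zero_closed]] by simp
  qed
  then have "carrier (space (reflect G \<Lambda> x M) x) = {\<zero>\<^bsub>space (reflect G \<Lambda> x M) x\<^esub>}"
    by auto
  with z show "rep_is_zero (reflect G \<Lambda> x M)"
    unfolding rep_is_zero_def by (metis reflect_other)
qed

section \<open>Indecomposables at a sink: simple or with surjective h\<close>

lemma idem_indecD:
  assumes "idem_indec G \<Lambda> M" "e \<in> rep_hom G \<Lambda> M M" "\<And>i v. v \<in> carrier (space M i) \<Longrightarrow> e i (e i v) = e i v"
  shows "(\<forall>i. \<forall>v\<in>carrier (space M i). e i v = \<zero>\<^bsub>space M i\<^esub>) \<or> (\<forall>i. \<forall>v\<in>carrier (space M i). e i v = v)"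
  using assms unfolding idem_indec_def by blast

text \<open>
  The projection onto a line \<open>\<langle>b\<rangle>\<close> of the space at a sink along a complement of it that contains the
  images of all arrows is an idempotent endomorphism, hence the identity.
\<close>

lemma idem_indec_sink_line:
  assumes "wrep G \<Lambda> M" "sink \<Lambda> x" "idem_indec G \<Lambda> M"
    and sub: "submodule U (dring G x) (space M x)" and b: "b \<in> carrier (space M x)" "b \<notin> U"
    and act: "\<And>i c v. (i, x) \<in> \<Lambda> \<Longrightarrow> c \<in> carrier (bimod G x i) \<Longrightarrow> v \<in> carrier (space M i) \<Longrightarrow> act G M i x c v \<in> U"
  obtains f where "f \<in> functionals (dring G x) (space M x)" "\<And>u. u \<in> U \<Longrightarrow> f u = \<zero>\<^bsub>dring G x\<^esub>" "f b = \<one>\<^bsub>dring G x\<^esub>"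
    "\<And>v. v \<in> carrier (space M x) \<Longrightarrow> f v \<odot>\<^bsub>space M x\<^esub> b = v"
    "\<And>y. y \<noteq> x \<Longrightarrow> carrier (space M y) = {\<zero>\<^bsub>space M y\<^esub>}"
proof -
  interpret V: left_module "dring G x" "space M x" using wrepD(1)[OF assms(1)] .
  obtain f where f: "f \<in> functionals (dring G x) (space M x)" "\<And>u. u \<in> U \<Longrightarrow> f u = \<zero>\<^bsub>dring G x\<^esub>" "f b = \<one>\<^bsub>dring G x\<^esub>"
    using functional_extension[OF dring V.left_module_axioms sub b] by blast
  define e where "e = (\<lambda>i v. if i = x then f v \<odot>\<^bsub>space M x\<^esub> b else \<zero>\<^bsub>space M i\<^esub>)"
  have "e \<in> rep_hom G \<Lambda> M M"
    unfolding e_def by (rule rank_one_hom[OF assms(1,1,2) b(1) f(1)]) (rule f(2)[OF act])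
  moreover have "e i (e i v) = e i v" if "v \<in> carrier (space M i)" for i v
    using that b functionalsD[OF f(1)] f(3) by (auto simp: e_def)
  moreover have "e x b \<noteq> \<zero>\<^bsub>space M x\<^esub>"
    using f(3) b V.submoduleD(2)[OF sub] by (auto simp: e_def V.smult_one)
  ultimately have id: "e i v = v" if "v \<in> carrier (space M i)" for i v
    using idem_indecD[OF assms(3)] b(1) that by blast
  have "f v \<odot>\<^bsub>space M x\<^esub> b = v" if "v \<in> carrier (space M x)" for v
    using id[OF that] by (simp add: e_def)
  note line = this
  have "carrier (space M y) = {\<zero>\<^bsub>space M y\<^esub>}" if "y \<noteq> x" for y
  proof -
    interpret W: left_module "dring G y" "space M y" using wrepD(1)[OF assms(1)] .
    show ?thesis
      using id[of _ y] that by (auto simp: e_def)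
  qed
  from that[OF f line this] show thesis .
qed

text \<open>The image of h contains the images of all arrows into \<open>x\<close>. If it were
  proper, \<open>idem_indec_sink_line\<close> would show that \<open>M\<close> is zero away from
  \<open>x\<close>, and the reflection would be zero.\<close>

lemma idem_indec_sink_surj:
  assumes "wrep G \<Lambda> M" "sink \<Lambda> x" "idem_indec G \<Lambda> M" "\<not> rep_is_zero (reflect G \<Lambda> x M)"
  shows "sink_surj x M"
proof (rule ccontr)
  assume ns: "\<not> sink_surj x M"
  interpret V: left_module "dring G x" "space M x" using wrepD(1)[OF assms(1)] .
  interpret I: left_module "dring G x" "in_sum G \<Lambda> x M" using left_module_in_sum[OF assms(1)] .
  note lin = left_linearD[OF sink_map_linear[OF assms(1), of x]]
  let ?U = "sink_map \<Lambda> x M ` carrier (in_sum G \<Lambda> x M)"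
  have sub: "submodule ?U (dring G x) (space M x)"
  proof (rule V.submoduleI)
    show "\<zero>\<^bsub>space M x\<^esub> \<in> ?U"
      using left_linear_zero[OF sink_map_linear[OF assms(1)] I.left_module_axioms V.left_module_axioms] by force
  qed (use lin in \<open>auto simp flip: lin(2,3) simp: I.smult_closed\<close>)
  obtain b where b: "b \<in> carrier (space M x)" "b \<notin> ?U"
    using ns lin(1) unfolding sink_surj_def by blast
  have "act G M i x c v \<in> ?U" if *: "(i, x) \<in> \<Lambda>" "c \<in> carrier (bimod G x i)" "v \<in> carrier (space M i)" for i c v
  proof -
    note p = pure_closed[OF arrow_val(2)[OF *(1)] wrepD(1)[OF assms(1)] *(2,3)]
    show ?thesis
      using sink_map_single[OF assms(1) *(1) p] single_closed[OF assms(1) p] by force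
  qed
  then show False
    by (rule idem_indec_sink_line[OF assms(1-3) sub b]) (use assms(4) reflect_zero_iff[OF assms(1)] in auto)
qed

text \<open>An idempotent endomorphism of the reflection lifts to \<open>M\<close> by fullness. The
  lift is idempotent away from \<open>x\<close>, hence everywhere because h is onto, so it is 0 or
  1, and faithfulness carries this back.\<close>

lemma idem_indec_reflect:
  assumes "wrep G \<Lambda> M" "sink \<Lambda> x" "idem_indec G \<Lambda> M" "\<not> rep_is_zero (reflect G \<Lambda> x M)"
  shows "idem_indec G (reverse_at x \<Lambda>) (reflect G \<Lambda> x M)"
  unfolding idem_indec_def
proof (intro conjI ballI impI)
  interpret R: oriented_graph G "reverse_at x \<Lambda>" by (rule oriented_graph_reverse)
  let ?M = "reflect G \<Lambda> x M"
  note w = wrep_reflect[OF assms(1,2)]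
  note surj = idem_indec_sink_surj[OF assms]
  fix e assume e: "e \<in> rep_hom G (reverse_at x \<Lambda>) ?M ?M" "\<forall>i. \<forall>v\<in>carrier (space ?M i). e i (e i v) = e i v"
  obtain \<phi> where phi: "\<phi> \<in> rep_hom G \<Lambda> M M" "\<And>y. y \<noteq> x \<Longrightarrow> \<phi> y = e y"
    using reflect_full[OF assms(1,1,2) surj e(1)] by blast
  have "\<phi> y (\<phi> y v) = \<phi> y v" if "y \<noteq> x" "v \<in> carrier (space M y)" for y v
    using e(2) that by (auto simp: phi(2))
  then have "\<phi> i (\<phi> i v) = \<phi> i v" if "v \<in> carrier (space M i)" for i v
    using sink_surj_hom_eq[OF assms(1,1) surj rep_hom_compose[OF assms(1,1,1) phi(1) phi(1)] phi(1) _ that] by blast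
  then consider "\<forall>i. \<forall>v\<in>carrier (space M i). \<phi> i v = \<zero>\<^bsub>space M i\<^esub>" | "\<forall>i. \<forall>v\<in>carrier (space M i). \<phi> i v = v"
    using idem_indecD[OF assms(3) phi(1)] by blast
  then show "(\<forall>i. \<forall>v\<in>carrier (space ?M i). e i v = \<zero>\<^bsub>space ?M i\<^esub>) \<or> (\<forall>i. \<forall>v\<in>carrier (space ?M i). e i v = v)"
  proof cases
    case 1
    have "e y v = \<zero>\<^bsub>space ?M y\<^esub>" if "y \<noteq> x" "v \<in> carrier (space M y)" for y v
      using 1 that phi(2) by fastforce
    then show ?thesis
      using reflect_faithful[OF assms(1,1,2) e(1) R.rep_hom_zero[OF w w]] by blast
  next
    case 2
    have "e y v = v" if "y \<noteq> x" "v \<in> carrier (space M y)" for y v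
      using 2 that phi(2) by fastforce
    then show ?thesis
      using reflect_faithful[OF assms(1,1,2) e(1) R.rep_hom_id[OF w]] by blast
  qed
qed (rule assms(4))

text \<open>All spaces except the one at \<open>x\<close> vanish, so the arrows into
  \<open>x\<close> are zero and the zero subspace may serve in \<open>idem_indec_sink_line\<close>.
  The space at \<open>x\<close> is then a line with basis vector \<open>b\<close> and coordinate
  \<open>f\<close>.\<close>

lemma idem_indec_concentrated:
  assumes "wrep G \<Lambda> M" "sink \<Lambda> x" "idem_indec G \<Lambda> M" "rep_is_zero (reflect G \<Lambda> x M)"
  obtains b f where "b \<in> carrier (space M x)" "f \<in> functionals (dring G x) (space M x)"
    "\<And>i b v. (i, x) \<in> \<Lambda> \<Longrightarrow> b \<in> carrier (bimod G x i) \<Longrightarrow> v \<in> carrier (space M i) \<Longrightarrow> f (act G M i x b v) = \<zero>\<^bsub>dring G x\<^esub>"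
    "f b = \<one>\<^bsub>dring G x\<^esub>" "\<And>v. v \<in> carrier (space M x) \<Longrightarrow> f v \<odot>\<^bsub>space M x\<^esub> b = v"
proof -
  interpret V: left_module "dring G x" "space M x" using wrepD(1)[OF assms(1)] .
  have z: "carrier (space M y) = {\<zero>\<^bsub>space M y\<^esub>}" if "y \<noteq> x" for y
    using assms(4) reflect_zero_iff[OF assms(1)] that by blast
  then have "carrier (space M x) \<noteq> {\<zero>\<^bsub>space M x\<^esub>}"
    using assms(3) unfolding idem_indec_def rep_is_zero_def by metis
  then obtain b where b: "b \<in> carrier (space M x)" "b \<notin> {\<zero>\<^bsub>space M x\<^esub>}"
    using V.zero_closed by blast
  have sub: "submodule {\<zero>\<^bsub>space M x\<^esub>} (dring G x) (space M x)"
    by (rule V.submoduleI) (auto simp: V.smult_zero)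
  have act0: "act G M i x c v \<in> {\<zero>\<^bsub>space M x\<^esub>}"
    if *: "(i, x) \<in> \<Lambda>" "c \<in> carrier (bimod G x i)" "v \<in> carrier (space M i)" for i c v
    using z[of i] * no_loop act_zero[OF assms(1) *(1,2)] by fastforce
  show thesis
  proof (rule idem_indec_sink_line[OF assms(1-3) sub b act0])
    fix f
    assume f: "f \<in> functionals (dring G x) (space M x)" "\<And>u. u \<in> {\<zero>\<^bsub>space M x\<^esub>} \<Longrightarrow> f u = \<zero>\<^bsub>dring G x\<^esub>"
      "f b = \<one>\<^bsub>dring G x\<^esub>" "\<And>v. v \<in> carrier (space M x) \<Longrightarrow> f v \<odot>\<^bsub>space M x\<^esub> b = v"
    show thesis
      by (rule that[OF b(1) f(1) f(2)[OF act0] f(3,4)])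
  qed
qed

text \<open>Both representations are lines at \<open>x\<close> with bases \<open>b\<close> and
  \<open>c\<close>. The map v \<mapsto> f(v) c has the inverse w \<mapsto> g(w) b.\<close>

lemma rep_iso_concentrated:
  assumes "wrep G \<Lambda> M" "sink \<Lambda> x" "idem_indec G \<Lambda> M" "rep_is_zero (reflect G \<Lambda> x M)"
    and "wrep G \<Lambda> N" "idem_indec G \<Lambda> N" "rep_is_zero (reflect G \<Lambda> x N)"
  shows "rep_iso G \<Lambda> M N"
proof (rule idem_indec_concentrated[OF assms(1-4)], rule idem_indec_concentrated[OF assms(5,2,6,7)])
  fix b f c g
  assume f: "b \<in> carrier (space M x)" "f \<in> functionals (dring G x) (space M x)"
    "\<And>i b v. (i, x) \<in> \<Lambda> \<Longrightarrow> b \<in> carrier (bimod G x i) \<Longrightarrow> v \<in> carrier (space M i) \<Longrightarrow> f (act G M i x b v) = \<zero>\<^bsub>dring G x\<^esub>"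
    "f b = \<one>\<^bsub>dring G x\<^esub>" "\<And>v. v \<in> carrier (space M x) \<Longrightarrow> f v \<odot>\<^bsub>space M x\<^esub> b = v"
  assume g: "c \<in> carrier (space N x)" "g \<in> functionals (dring G x) (space N x)"
    "\<And>i b v. (i, x) \<in> \<Lambda> \<Longrightarrow> b \<in> carrier (bimod G x i) \<Longrightarrow> v \<in> carrier (space N i) \<Longrightarrow> g (act G N i x b v) = \<zero>\<^bsub>dring G x\<^esub>"
    "g c = \<one>\<^bsub>dring G x\<^esub>" "\<And>v. v \<in> carrier (space N x) \<Longrightarrow> g v \<odot>\<^bsub>space N x\<^esub> c = v"
  interpret R: skew_field "dring G x" by (rule dring)
  have zM: "carrier (space M y) = {\<zero>\<^bsub>space M y\<^esub>}" and zN: "carrier (space N y) = {\<zero>\<^bsub>space N y\<^esub>}" if "y \<noteq> x" for y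
    using assms(4,7) reflect_zero_iff[OF assms(1)] reflect_zero_iff[OF assms(5)] that by blast+
  show ?thesis
    by (rule rep_isoI[OF rank_one_hom[OF assms(1,5,2) g(1) f(2,3)] rank_one_hom[OF assms(5,1,2) f(1) g(2,3)]])
      (use f g functionalsD[OF f(2)] functionalsD[OF g(2)] zM zN in \<open>auto split: if_splits\<close>)
qed

end

text \<open>Leastness is assumed as a bound on the multiplicities of every annihilating sequence. In
  this form it passes to the reflections: prepend \<open>x\<close> to a sequence that annihilates a
  reflection and cancel it afterwards.\<close>

theorem rep_iso_of_least_annihilating:
  assumes "oriented_graph G \<Lambda>" "wrep G \<Lambda> M" "wrep G \<Lambda> N" "idem_indec G \<Lambda> M" "idem_indec G \<Lambda> N" "admissible \<Lambda> S"
    and "rep_is_zero (reflect_seq G \<Lambda> S M)" "rep_is_zero (reflect_seq G \<Lambda> S N)"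
    and "\<And>T. admissible \<Lambda> T \<Longrightarrow> rep_is_zero (reflect_seq G \<Lambda> T M) \<Longrightarrow> count_list S \<le> count_list T"
    and "\<And>T. admissible \<Lambda> T \<Longrightarrow> rep_is_zero (reflect_seq G \<Lambda> T N) \<Longrightarrow> count_list S \<le> count_list T"
  shows "rep_iso G \<Lambda> M N"
  using assms
proof (induction S arbitrary: \<Lambda> M N)
  case Nil
  then show ?case by (simp add: idem_indec_def)
next
  case (Cons x S)
  interpret oriented_graph G \<Lambda> by (rule Cons.prems(1))
  have x: "sink \<Lambda> x" "admissible (reverse_at x \<Lambda>) S"
    using Cons.prems(6) by auto
  have Nil: "S = []" if "count_list (x # S) \<le> count_list [x]"
  proof -
    have "count_list S y = 0" for y
      using le_funD[OF that, of y] by (simp split: if_splits)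
    then show ?thesis
      by (metis count_list_0_iff list.set_intros(1) neq_Nil_conv)
  qed
  \<comment> \<open>If reflecting at \<open>x\<close> already gives zero, then \<open>[x]\<close>
    annihilates and leastness of \<open>x # S\<close> leaves \<open>S\<close> empty. The same holds
    for \<open>N\<close>, so the two representations become zero at the same moment.\<close>
  have M: "S = []" if "rep_is_zero (reflect G \<Lambda> x M)"
    using Nil Cons.prems(9)[of "[x]"] that x by simp
  have N: "S = []" if "rep_is_zero (reflect G \<Lambda> x N)"
    using Nil Cons.prems(10)[of "[x]"] that x by simp
  show ?case
  proof (cases "S = []")
    case True
    then show ?thesis
      using rep_iso_concentrated[OF Cons.prems(2) x(1) Cons.prems(4) _ Cons.prems(3,5)] Cons.prems(7,8) by simp
  next
    case False
    then have nz: "\<not> rep_is_zero (reflect G \<Lambda> x M)" "\<not> rep_is_zero (reflect G \<Lambda> x N)"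
      using M N by auto
    have le: "count_list S \<le> count_list T" if "count_list (x # S) \<le> count_list (x # T)" for T
    proof (rule le_funI)
      fix y
      show "count_list S y \<le> count_list T y"
        using le_funD[OF that, of y] by (simp split: if_splits)
    qed
    have "rep_iso G (reverse_at x \<Lambda>) (reflect G \<Lambda> x M) (reflect G \<Lambda> x N)"
    proof (rule Cons.IH[OF oriented_graph_reverse wrep_reflect[OF Cons.prems(2) x(1)] wrep_reflect[OF Cons.prems(3) x(1)]
          idem_indec_reflect[OF Cons.prems(2) x(1) Cons.prems(4) nz(1)]
          idem_indec_reflect[OF Cons.prems(3) x(1) Cons.prems(5) nz(2)] x(2)])
      show "rep_is_zero (reflect_seq G (reverse_at x \<Lambda>) S (reflect G \<Lambda> x M))"
        "rep_is_zero (reflect_seq G (reverse_at x \<Lambda>) S (reflect G \<Lambda> x N))"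
        using Cons.prems(7,8) by simp_all
      show "count_list S \<le> count_list T"
        if "admissible (reverse_at x \<Lambda>) T" "rep_is_zero (reflect_seq G (reverse_at x \<Lambda>) T (reflect G \<Lambda> x M))" for T
        using that x by (intro le Cons.prems(9)) simp_all
      show "count_list S \<le> count_list T"
        if "admissible (reverse_at x \<Lambda>) T" "rep_is_zero (reflect_seq G (reverse_at x \<Lambda>) T (reflect G \<Lambda> x N))" for T
        using that x by (intro le Cons.prems(10)) simp_all
    qed
    then show ?thesis
      by (rule reflect_reconstruct[OF Cons.prems(2,3) x(1)
          idem_indec_sink_surj[OF Cons.prems(2) x(1) Cons.prems(4) nz(1)]
          idem_indec_sink_surj[OF Cons.prems(3) x(1) Cons.prems(5) nz(2)]])
  qed
qed

section \<open>Direct sums\<close>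

text \<open>The summands in \<open>indecomposable\<close> range over finite dimensional
  representations, so the images of an idempotent have to be shown finite dimensional. The image of
  a spanning set spans.\<close>

lemma fin_dim_image:
  fixes M :: "('k, 'v, 'm) module_scheme" and N :: "('k, 'w, 'n) module_scheme"
  assumes "left_module R M" "left_module R N" "f \<in> left_linear R M N" "f ` carrier M = carrier N" "fin_dim R M"
  shows "fin_dim R N"
proof -
  interpret M: left_module R M by fact
  interpret N: left_module R N by fact
  note lin = left_linearD[OF assms(3)]
  obtain A where A: "finite A" "A \<subseteq> carrier M" "left_span R M A = carrier M"
    using assms(5) by (auto simp: fin_dim_def)
  let ?B = "f ` A"
  have B: "finite ?B" "?B \<subseteq> carrier N"
    using A lin(1) by auto
  have add: "u \<oplus>\<^bsub>N\<^esub> v \<in> left_span R N ?B" if u: "u \<in> left_span R N ?B" and v: "v \<in> left_span R N ?B" for u v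
  proof -
    obtain c where c: "u = finsum N (\<lambda>b. c b \<odot>\<^bsub>N\<^esub> b) ?B" "c \<in> ?B \<rightarrow> carrier R"
      using u unfolding left_span_def by blast
    obtain d where d: "v = finsum N (\<lambda>b. d b \<odot>\<^bsub>N\<^esub> b) ?B" "d \<in> ?B \<rightarrow> carrier R"
      using v unfolding left_span_def by blast
    note cd = c(2,1) d(2,1)
    have "finsum N (\<lambda>b. (c b \<oplus>\<^bsub>R\<^esub> d b) \<odot>\<^bsub>N\<^esub> b) ?B = finsum N (\<lambda>b. c b \<odot>\<^bsub>N\<^esub> b \<oplus>\<^bsub>N\<^esub> d b \<odot>\<^bsub>N\<^esub> b) ?B"
      using cd B by (intro N.add.finprod_cong') (auto simp: N.smult_l_distr N.smult_closed Pi_iff)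
    also have "\<dots> = u \<oplus>\<^bsub>N\<^esub> v"
      unfolding cd(2,4) using cd B by (intro N.finsum_addf) (auto intro!: N.smult_closed)
    finally show ?thesis
      using cd unfolding left_span_def by (intro CollectI exI[of _ "\<lambda>b. c b \<oplus>\<^bsub>R\<^esub> d b"]) auto
  qed
  have zero: "\<zero>\<^bsub>N\<^esub> \<in> left_span R N ?B"
  proof -
    have "finsum N (\<lambda>b. \<zero>\<^bsub>R\<^esub> \<odot>\<^bsub>N\<^esub> b) ?B = finsum N (\<lambda>b. \<zero>\<^bsub>N\<^esub>) ?B"
      using B by (intro N.add.finprod_cong') (auto simp: N.zero_smult)
    also have "\<dots> = \<zero>\<^bsub>N\<^esub>" by simp
    finally show ?thesis
      unfolding left_span_def by (intro CollectI exI[of _ "\<lambda>b. \<zero>\<^bsub>R\<^esub>"]) auto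
  qed
  have smult: "r \<odot>\<^bsub>N\<^esub> b \<in> left_span R N ?B" if "r \<in> carrier R" "b \<in> ?B" for r b
  proof -
    have "finsum N (\<lambda>a. (if b = a then r else \<zero>\<^bsub>R\<^esub>) \<odot>\<^bsub>N\<^esub> a) ?B = finsum N (\<lambda>a. if b = a then r \<odot>\<^bsub>N\<^esub> a else \<zero>\<^bsub>N\<^esub>) ?B"
      using B that by (intro N.add.finprod_cong') (auto simp: N.zero_smult N.smult_closed)
    also have "\<dots> = r \<odot>\<^bsub>N\<^esub> b"
      using B that by (intro N.add.finprod_singleton) (auto intro!: N.smult_closed)
    finally show ?thesis
      unfolding left_span_def using that by (intro CollectI exI[of _ "\<lambda>a. if b = a then r else \<zero>\<^bsub>R\<^esub>"]) auto
  qed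
  have sum: "finsum N (\<lambda>a. c a \<odot>\<^bsub>N\<^esub> f a) A' \<in> left_span R N ?B" if "finite A'" "A' \<subseteq> A" "c \<in> A \<rightarrow> carrier R" for A' c
    using that(1,2)
  proof induction
    case empty
    then show ?case using zero by simp
  next
    case (insert a A')
    then have "(\<lambda>a. c a \<odot>\<^bsub>N\<^esub> f a) \<in> insert a A' \<rightarrow> carrier N"
      using that(3) A(2) lin(1) by (auto intro!: N.smult_closed)
    with insert show ?case
      using add smult[of "c a" "f a"] that(3) by (auto simp: Pi_iff)
  qed
  have "v \<in> left_span R N ?B" if v: "v \<in> carrier N" for v
  proof -
    obtain m where m: "m \<in> carrier M" "v = f m"
      using assms(4) v by blast
    then obtain c where c: "c \<in> A \<rightarrow> carrier R" "m = finsum M (\<lambda>a. c a \<odot>\<^bsub>M\<^esub> a) A"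
      using A(3) by (auto simp: left_span_def)
    have "v = finsum N (\<lambda>a. f (c a \<odot>\<^bsub>M\<^esub> a)) A"
      unfolding m(2) c(2) using c A by (intro left_linear_finsum[OF assms(3,1,2)]) (auto intro!: M.smult_closed)
    also have "\<dots> = finsum N (\<lambda>a. c a \<odot>\<^bsub>N\<^esub> f a) A"
      by (rule finsum_cong_weak) (use c(1) A(2) in \<open>auto intro!: lin(3)\<close>)
    finally show ?thesis
      using sum[OF A(1) subset_refl c(1)] by simp
  qed
  moreover have "left_span R N ?B \<subseteq> carrier N"
    using B by (auto simp: left_span_def intro!: N.finsum_closed N.smult_closed)
  ultimately show ?thesis
    unfolding fin_dim_def using B by blast
qed

text \<open>A tensor over a subspace is a coset of a different subgroup than the corresponding
  tensor over the whole space. It has to be carried along the inclusion by \<open>ten_map\<close>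
  before the arrow of \<open>M\<close> applies.\<close>

definition subrep :: "('i, 'k, 'b, 'c) modulation \<Rightarrow> ('i, 'k, 'b, 'v) rep \<Rightarrow> ('i \<Rightarrow> 'v set) \<Rightarrow> ('i, 'k, 'b, 'v) rep" where
  "subrep G M U = \<lparr>space = (\<lambda>i. (space M i)\<lparr>carrier := U i\<rparr>),
     arrow_map = (\<lambda>i j t. arrow_map M i j (ten_map G j i (space M i) (\<lambda>v. v) t))\<rparr>"

context oriented_graph
begin

lemma subrep:
  assumes "wrep G \<Lambda> M" and sub: "\<And>i. submodule (U i) (dring G i) (space M i)"
    and act: "\<And>i j b v. (i, j) \<in> \<Lambda> \<Longrightarrow> b \<in> carrier (bimod G j i) \<Longrightarrow> v \<in> U i \<Longrightarrow> act G M i j b v \<in> U j"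
  shows "wrep G \<Lambda> (subrep G M U)"
    "(i, j) \<in> \<Lambda> \<Longrightarrow> b \<in> carrier (bimod G j i) \<Longrightarrow> v \<in> U i \<Longrightarrow> act G (subrep G M U) i j b v = act G M i j b v"
proof -
  let ?S = "\<lambda>i. (space M i)\<lparr>carrier := U i\<rparr>"
  have S: "left_module (dring G i) (?S i)" for i
    using left_module_submodule[OF wrepD(1)[OF assms(1)] sub] .
  have incl: "(\<lambda>v. v) \<in> left_linear (dring G i) (?S i) (space M i)" for i
    using left_module.submoduleD(1)[OF wrepD(1)[OF assms(1)] sub] by (intro left_linearI) auto
  have pure: "arrow_map (subrep G M U) i j (pure G j i (?S i) b v) = act G M i j b v"
    if "(i, j) \<in> \<Lambda>" "b \<in> carrier (bimod G j i)" "v \<in> U i" for i j b v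
    using ten_map_pure[OF arrow_val(2)[OF that(1)] S wrepD(1)[OF assms(1)] incl that(2)] that(3) by (simp add: subrep_def)
  then show "(i, j) \<in> \<Lambda> \<Longrightarrow> b \<in> carrier (bimod G j i) \<Longrightarrow> v \<in> U i \<Longrightarrow> act G (subrep G M U) i j b v = act G M i j b v"
    by (simp add: subrep_def)
  have "arrow_map (subrep G M U) i j \<in> left_linear (dring G j) (ten G j i (?S i)) (?S j)" if ij: "(i, j) \<in> \<Lambda>" for i j
  proof -
    have lin: "arrow_map (subrep G M U) i j \<in> left_linear (dring G j) (ten G j i (?S i)) (space M j)"
      using left_linear_compose[OF ten_map_linear[OF arrow_val(2)[OF ij] S wrepD(1)[OF assms(1)] incl] wrepD(2)[OF assms(1) ij]]
      by (simp add: subrep_def)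
    interpret T: tensor_product "dring G j" "dring G i" "bimod G j i" "?S i"
      using tensor_product[OF arrow_val(2)[OF ij] S] .
    note Uj = left_module.submoduleD[OF wrepD(1)[OF assms(1)] sub[of j]]
    have "arrow_map (subrep G M U) i j t \<in> U j" if "t \<in> carrier (ten G j i (?S i))" for t
      using that
    proof (induction t rule: T.tensor_induct)
      case zero
      then show ?case
        using left_linear_zero[OF lin T.left_module_T wrepD(1)[OF assms(1)]] Uj(2) by simp
    next
      case (tau b v)
      then show ?case using pure[OF ij, of b v] act[OF ij, of b v] by simp
    next
      case (add s t)
      then show ?case using left_linearD(2)[OF lin] Uj(3) by simp
    qed
    then show ?thesis
      using left_linearD[OF lin] by (intro left_linearI) auto
  qed
  then show "wrep G \<Lambda> (subrep G M U)"
    using S by (auto simp: wrep_def subrep_def)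
qed

lemma subrep_image:
  assumes "is_rep G \<Lambda> M" and p: "p \<in> rep_hom G \<Lambda> M M"
  shows "is_rep G \<Lambda> (subrep G M (\<lambda>i. p i ` carrier (space M i)))"
    "(i, j) \<in> \<Lambda> \<Longrightarrow> b \<in> carrier (bimod G j i) \<Longrightarrow> v \<in> p i ` carrier (space M i) \<Longrightarrow>
      act G (subrep G M (\<lambda>i. p i ` carrier (space M i))) i j b v = act G M i j b v"
proof -
  let ?U = "\<lambda>i. p i ` carrier (space M i)"
  have M: "wrep G \<Lambda> M" using assms(1) by (rule is_rep_wrep)
  have sub: "submodule (?U i) (dring G i) (space M i)" for i
  proof -
    interpret V: left_module "dring G i" "space M i" using wrepD(1)[OF M] .
    note lin = left_linearD[OF rep_homD(1)[OF p]]
    show ?thesis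
    proof (rule V.submoduleI)
      show "\<zero>\<^bsub>space M i\<^esub> \<in> ?U i"
        using left_linear_zero[OF rep_homD(1)[OF p] V.left_module_axioms V.left_module_axioms] by force
    qed (use lin in \<open>auto simp flip: lin(2,3) simp: V.smult_closed\<close>)
  qed
  have act: "act G M i j b v \<in> ?U j" if "(i, j) \<in> \<Lambda>" "b \<in> carrier (bimod G j i)" "v \<in> ?U i" for i j b v
    using rep_hom_act[OF M M p that(1,2)] act_closed[OF M that(1,2)] that(3) by force
  have w: "wrep G \<Lambda> (subrep G M ?U)"
    using subrep(1)[OF M sub act] .
  have "fin_dim (dring G i) ((space M i)\<lparr>carrier := ?U i\<rparr>)" for i
  proof (rule fin_dim_image[OF wrepD(1)[OF M] left_module_submodule[OF wrepD(1)[OF M] sub]])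
    show "p i \<in> left_linear (dring G i) (space M i) (space M i\<lparr>carrier := ?U i\<rparr>)"
      using left_linearD[OF rep_homD(1)[OF p]] by (intro left_linearI) auto
  qed (use assms(1) in \<open>auto simp: is_rep_def\<close>)
  then show "is_rep G \<Lambda> (subrep G M ?U)"
    using w by (auto simp: is_rep_def wrep_def subrep_def)
  show "(i, j) \<in> \<Lambda> \<Longrightarrow> b \<in> carrier (bimod G j i) \<Longrightarrow> v \<in> ?U i \<Longrightarrow> act G (subrep G M ?U) i j b v = act G M i j b v"
    by (rule subrep(2)[OF M sub act])
qed

section \<open>Direct sums and copies of representations\<close>

lemma component_linear: "r \<in> J \<Longrightarrow> (\<lambda>u. u r) \<in> left_linear R (dsum J V) (V r)"
  by (intro left_linearI) (auto simp: dsum_def)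

lemma space_rep_dsum: "space (rep_dsum G J N) i = dsum J (\<lambda>r. space (N r) i)"
  by (simp add: rep_dsum_def)

lemma rep_dsum_component_linear:
  "r \<in> J \<Longrightarrow> (\<lambda>u. u r) \<in> left_linear (dring G i) (space (rep_dsum G J N) i) (space (N r) i)"
  unfolding space_rep_dsum by (rule component_linear)

lemma left_module_rep_dsum:
  assumes "\<And>r. r \<in> J \<Longrightarrow> wrep G \<Lambda> (N r)"
  shows "left_module (dring G i) (space (rep_dsum G J N) i)"
  using dring[of i] assms unfolding rep_dsum_def
  by (auto intro!: left_module_dsum wrepD(1) simp: skew_field_def)

lemma act_rep_dsum:
  assumes "\<And>r. r \<in> J \<Longrightarrow> wrep G \<Lambda> (N r)" "(i, j) \<in> \<Lambda>" "b \<in> carrier (bimod G j i)" "u \<in> carrier (space (rep_dsum G J N) i)"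
  shows "act G (rep_dsum G J N) i j b u = (\<lambda>r\<in>J. act G (N r) i j b (u r))"
proof -
  have "ten_map G j i (space (N r) i) (\<lambda>u. u r) (pure G j i (space (rep_dsum G J N) i) b u) = pure G j i (space (N r) i) b (u r)"
    if "r \<in> J" for r
    by (rule ten_map_pure[OF arrow_val(2)[OF assms(2)] left_module_rep_dsum[OF assms(1)] wrepD(1)[OF assms(1)[OF that]]
          rep_dsum_component_linear[OF that] assms(3,4)])
  then show ?thesis
    by (auto simp: rep_dsum_def intro!: restrict_ext)
qed

lemma wrep_rep_dsum:
  assumes "\<And>r. r \<in> J \<Longrightarrow> wrep G \<Lambda> (N r)"
  shows "wrep G \<Lambda> (rep_dsum G J N)"
proof -
  have "arrow_map (rep_dsum G J N) i j \<in>
    left_linear (dring G j) (ten G j i (space (rep_dsum G J N) i)) (space (rep_dsum G J N) j)" if ij: "(i, j) \<in> \<Lambda>" for i j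
  proof -
    have lin: "(\<lambda>t. arrow_map (N r) i j (ten_map G j i (space (N r) i) (\<lambda>u. u r) t)) \<in>
      left_linear (dring G j) (ten G j i (space (rep_dsum G J N) i)) (space (N r) j)" if r: "r \<in> J" for r
    proof (rule left_linear_compose[OF ten_map_linear[OF arrow_val(2)[OF ij] _ wrepD(1)[OF assms[OF r]]] wrepD(2)[OF assms[OF r] ij]])
      show "left_module (dring G i) (space (rep_dsum G J N) i)"
        by (rule left_module_rep_dsum[OF assms])
      show "(\<lambda>u. u r) \<in> left_linear (dring G i) (space (rep_dsum G J N) i) (space (N r) i)"
        by (rule rep_dsum_component_linear[OF r])
    qed
    from left_linearD[OF this] have l: "\<And>r t. r \<in> J \<Longrightarrow> t \<in> carrier (ten G j i (space (rep_dsum G J N) i)) \<Longrightarrow>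
        arrow_map (N r) i j (ten_map G j i (space (N r) i) (\<lambda>u. u r) t) \<in> carrier (space (N r) j)"
      "\<And>r s t. r \<in> J \<Longrightarrow> s \<in> carrier (ten G j i (space (rep_dsum G J N) i)) \<Longrightarrow> t \<in> carrier (ten G j i (space (rep_dsum G J N) i)) \<Longrightarrow>
        arrow_map (N r) i j (ten_map G j i (space (N r) i) (\<lambda>u. u r) (s \<oplus>\<^bsub>ten G j i (space (rep_dsum G J N) i)\<^esub> t)) =
        arrow_map (N r) i j (ten_map G j i (space (N r) i) (\<lambda>u. u r) s) \<oplus>\<^bsub>space (N r) j\<^esub>
        arrow_map (N r) i j (ten_map G j i (space (N r) i) (\<lambda>u. u r) t)"
      "\<And>r a t. r \<in> J \<Longrightarrow> a \<in> carrier (dring G j) \<Longrightarrow> t \<in> carrier (ten G j i (space (rep_dsum G J N) i)) \<Longrightarrow>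
        arrow_map (N r) i j (ten_map G j i (space (N r) i) (\<lambda>u. u r) (a \<odot>\<^bsub>ten G j i (space (rep_dsum G J N) i)\<^esub> t)) =
        a \<odot>\<^bsub>space (N r) j\<^esub> arrow_map (N r) i j (ten_map G j i (space (N r) i) (\<lambda>u. u r) t)"
      by blast+
    show ?thesis
      by (rule left_linearI) (auto simp: l rep_dsum_def[of G J N, THEN arg_cong[of _ _ arrow_map]]
         rep_dsum_def[of G J N, THEN arg_cong[of _ _ "\<lambda>M. space M j"]] dsum_def intro!: restrict_ext)
  qed
  then show ?thesis
    using left_module_rep_dsum[OF assms] by (auto simp: wrep_def)
qed

lemma rep_dsum_component:
  assumes "\<And>r. r \<in> J \<Longrightarrow> wrep G \<Lambda> (N r)" "r \<in> J"
  shows "(\<lambda>i u. u r) \<in> rep_hom G \<Lambda> (rep_dsum G J N) (N r)"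
proof (rule rep_homI)
  show "wrep G \<Lambda> (rep_dsum G J N)"
    by (rule wrep_rep_dsum) (rule assms(1))
  show "wrep G \<Lambda> (N r)"
    by (rule assms(1)[OF assms(2)])
  show "(\<lambda>u. u r) \<in> left_linear (dring G i) (space (rep_dsum G J N) i) (space (N r) i)" for i
    by (rule rep_dsum_component_linear[OF assms(2)])
  fix i j b u
  assume "(i, j) \<in> \<Lambda>" "b \<in> carrier (bimod G j i)" "u \<in> carrier (space (rep_dsum G J N) i)"
  with assms(1) have "act G (rep_dsum G J N) i j b u = (\<lambda>r\<in>J. act G (N r) i j b (u r))"
    by (intro act_rep_dsum)
  then show "act G (rep_dsum G J N) i j b u r = act G (N r) i j b (u r)"
    using assms(2) by simp
qed

lemma rep_dsum_hom:
  assumes N: "\<And>r. r \<in> J \<Longrightarrow> wrep G \<Lambda> (N r)" and "wrep G \<Lambda> M"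
    and \<phi>: "\<And>r. r \<in> J \<Longrightarrow> \<phi> r \<in> rep_hom G \<Lambda> M (N r)"
  shows "(\<lambda>i v. \<lambda>r\<in>J. \<phi> r i v) \<in> rep_hom G \<Lambda> M (rep_dsum G J N)"
proof (rule rep_homI[OF assms(2)])
  show "wrep G \<Lambda> (rep_dsum G J N)"
    by (rule wrep_rep_dsum) (rule N)
  note lin = left_linearD[OF rep_homD(1)[OF \<phi>]]
  show l: "(\<lambda>v. \<lambda>r\<in>J. \<phi> r i v) \<in> left_linear (dring G i) (space M i) (space (rep_dsum G J N) i)" for i
    unfolding space_rep_dsum by (rule left_linearI) (auto simp: dsum_def lin intro!: restrict_ext)
  fix i j b v
  assume *: "(i, j) \<in> \<Lambda>" "b \<in> carrier (bimod G j i)" "v \<in> carrier (space M i)"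
  show "(\<lambda>r\<in>J. \<phi> r j (act G M i j b v)) = act G (rep_dsum G J N) i j b (\<lambda>r\<in>J. \<phi> r i v)"
  proof -
    have "act G (rep_dsum G J N) i j b (\<lambda>r\<in>J. \<phi> r i v) = (\<lambda>q\<in>J. act G (N q) i j b ((\<lambda>r\<in>J. \<phi> r i v) q))"
      by (rule act_rep_dsum[OF _ *(1,2) left_linearD(1)[OF l *(3)]]) (rule N)
    also have "\<dots> = (\<lambda>r\<in>J. \<phi> r j (act G M i j b v))"
      by (rule restrict_ext) (use rep_hom_act[OF assms(2) N \<phi> *] in simp)
    finally show ?thesis by simp
  qed
qed

lemma rep_atom:
  assumes "wrep G \<Lambda> M"
  shows "wrep G \<Lambda> (rep_atom G M)" "(\<lambda>i. Atom) \<in> rep_hom G \<Lambda> M (rep_atom G M)"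
    "(\<lambda>i. inv_into (carrier (space M i)) Atom) \<in> rep_hom G \<Lambda> (rep_atom G M) M"
proof -
  have sp: "space (rep_atom G M) i = module_image Atom (space M i)" for i
    by (simp add: rep_atom_def)
  have inj: "inj_on (Atom :: _ \<Rightarrow> ('i, 'b, _) elem) (carrier (space M i))" for i
    by (simp add: inj_on_def)
  note im = left_module_image[OF wrepD(1)[OF assms] inj, folded sp]
  have "arrow_map (rep_atom G M) i j \<in> left_linear (dring G j) (ten G j i (space (rep_atom G M) i)) (space (rep_atom G M) j)"
    if ij: "(i, j) \<in> \<Lambda>" for i j
    using left_linear_compose[OF left_linear_compose[OF ten_map_linear[OF arrow_val(2)[OF ij] im(1) wrepD(1)[OF assms] im(3)]
        wrepD(2)[OF assms ij]] im(2)]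
    by (simp add: rep_atom_def)
  then show w: "wrep G \<Lambda> (rep_atom G M)"
    using im(1) by (auto simp: wrep_def)
  show atom: "(\<lambda>i. Atom) \<in> rep_hom G \<Lambda> M (rep_atom G M)"
  proof (rule rep_homI[OF assms w im(2)])
    fix i j b v assume *: "(i, j) \<in> \<Lambda>" "b \<in> carrier (bimod G j i)" "v \<in> carrier (space M i)"
    have "ten_map G j i (space M i) (inv_into (carrier (space M i)) Atom) (pure G j i (space (rep_atom G M) i) b (Atom v)) =
      pure G j i (space M i) b v"
      using ten_map_pure[OF arrow_val(2)[OF *(1)] im(1) wrepD(1)[OF assms] im(3) *(2) left_linearD(1)[OF im(2) *(3)]]
        inv_into_f_f[OF inj *(3)] by simp
    then show "Atom (act G M i j b v) = act G (rep_atom G M) i j b (Atom v)"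
      by (simp add: rep_atom_def)
  qed
  show "(\<lambda>i. inv_into (carrier (space M i)) Atom) \<in> rep_hom G \<Lambda> (rep_atom G M) M"
  proof (rule rep_hom_inverse[OF assms w atom])
    fix i v assume "v \<in> carrier (space (rep_atom G M) i)"
    then have v: "v \<in> Atom ` carrier (space M i)"
      by (simp add: sp module_image_def Let_def)
    then show "inv_into (carrier (space M i)) Atom v \<in> carrier (space M i)" "Atom (inv_into (carrier (space M i)) Atom v) = v"
      by (simp_all add: inv_into_into f_inv_into_f)
  qed (simp add: inv_into_f_f[OF inj])
qed

lemma rep_iso_atom:
  assumes "wrep G \<Lambda> M"
  shows "rep_iso G \<Lambda> M (rep_atom G M)"
proof (rule rep_isoI[OF rep_atom(2,3)[OF assms]])
  show "inv_into (carrier (space M i)) Atom (Atom v) = v" if "v \<in> carrier (space M i)" for i v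
    using that by (simp add: inv_into_f_f inj_on_def)
  show "Atom (inv_into (carrier (space M i)) Atom v) = v" if "v \<in> carrier (space (rep_atom G M) i)" for i v
    using that by (simp add: rep_atom_def module_image_def Let_def f_inv_into_f)
qed

text \<open>\<open>annihilates\<close> is evaluated on the copies made by \<open>rep_atom\<close>.
  Conjugating the family by \<open>Atom\<close> moves joint injectivity to these copies.\<close>

lemma annihilates_joint_inj:
  assumes "wrep G \<Lambda> M" "joint_inj J M N \<phi>" "admissible \<Lambda> S" "\<And>r. r \<in> J \<Longrightarrow> annihilates G \<Lambda> S (N r)"
  shows "annihilates G \<Lambda> S M"
proof -
  let ?inv = "\<lambda>i. inv_into (carrier (space M i)) Atom"
  define \<psi> :: "_ \<Rightarrow> 'i \<Rightarrow> ('i, 'b, _) elem \<Rightarrow> ('i, 'b, _) elem" where "\<psi> r i a = Atom (\<phi> r i (?inv i a))" for r i a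
  have N: "wrep G \<Lambda> (N r)" "\<phi> r \<in> rep_hom G \<Lambda> M (N r)" if "r \<in> J" for r
    using assms(2) that by (auto simp: joint_inj_def)
  note w = rep_atom[OF assms(1)]
  have "\<psi> r \<in> rep_hom G \<Lambda> (rep_atom G M) (rep_atom G (N r))" if r: "r \<in> J" for r
    using rep_hom_compose[OF w(1) N(1)[OF r] rep_atom(1)[OF N(1)[OF r]]
      rep_hom_compose[OF w(1) assms(1) N(1)[OF r] w(3) N(2)[OF r]] rep_atom(2)[OF N(1)[OF r]]]
    by (simp add: \<psi>_def[abs_def])
  moreover have "a = \<zero>\<^bsub>space (rep_atom G M) i\<^esub>"
    if a: "a \<in> carrier (space (rep_atom G M) i)" "\<forall>r\<in>J. \<psi> r i a = \<zero>\<^bsub>space (rep_atom G (N r)) i\<^esub>" for i a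
  proof -
    obtain v where v: "v \<in> carrier (space M i)" "a = Atom v"
      using a(1) by (auto simp: rep_atom_def module_image_def Let_def)
    have "?inv i a = v"
      using v by (simp add: inv_into_f_f inj_on_def)
    then have "\<phi> r i v = \<zero>\<^bsub>space (N r) i\<^esub>" if "r \<in> J" for r
      using a(2) that by (simp add: \<psi>_def rep_atom_def module_image_def Let_def)
    then have "v = \<zero>\<^bsub>space M i\<^esub>"
      using assms(2) v(1) unfolding joint_inj_def by blast
    then show ?thesis
      using v(2) by (simp add: rep_atom_def module_image_def Let_def)
  qed
  ultimately have "joint_inj J (rep_atom G M) (\<lambda>r. rep_atom G (N r)) \<psi>"
    unfolding joint_inj_def using rep_atom(1)[OF N(1)] by blast
  from reflect_seq_zero_joint_inj[OF oriented_graph_axioms w(1) assms(3) this] assms(4) show ?thesis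
    by (simp add: annihilates_def)
qed

text \<open>Both directions rest on preservation of joint injectivity: the projections from
  \<open>M\<close> to the summands are jointly injective, and each summand embeds into
  \<open>M\<close>.\<close>

lemma annihilates_rep_dsum:
  assumes "wrep G \<Lambda> M" "\<And>r. r \<in> J \<Longrightarrow> wrep G \<Lambda> (N r)" "rep_iso G \<Lambda> M (rep_dsum G J N)" "admissible \<Lambda> S"
  shows "annihilates G \<Lambda> S M \<longleftrightarrow> (\<forall>r\<in>J. annihilates G \<Lambda> S (N r))"
proof -
  let ?D = "rep_dsum G J N"
  have D: "wrep G \<Lambda> ?D" by (rule wrep_rep_dsum[OF assms(2)])
  obtain f g where fg: "f \<in> rep_hom G \<Lambda> M ?D" "g \<in> rep_hom G \<Lambda> ?D M"
    "\<And>i v. v \<in> carrier (space M i) \<Longrightarrow> g i (f i v) = v" "\<And>i v. v \<in> carrier (space ?D i) \<Longrightarrow> f i (g i v) = v"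
    using rep_isoE[OF assms(1) D assms(3)] by blast
  note fl = left_linearD(1)[OF rep_homD(1)[OF fg(1)]]
  have f0: "f i \<zero>\<^bsub>space M i\<^esub> = \<zero>\<^bsub>space ?D i\<^esub>" and g0: "g i \<zero>\<^bsub>space ?D i\<^esub> = \<zero>\<^bsub>space M i\<^esub>" for i
    using left_linear_zero[OF rep_homD(1)[OF fg(1)] wrepD(1)[OF assms(1)] wrepD(1)[OF D]]
      left_linear_zero[OF rep_homD(1)[OF fg(2)] wrepD(1)[OF D] wrepD(1)[OF assms(1)]] by auto
  show ?thesis
  proof
    assume *: "\<forall>r\<in>J. annihilates G \<Lambda> S (N r)"
    have "joint_inj J M N (\<lambda>r i v. f i v r)"
      unfolding joint_inj_def
    proof (intro conjI ballI allI impI)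
      fix r assume r: "r \<in> J"
      show "wrep G \<Lambda> (N r)" using assms(2)[OF r] .
      show "(\<lambda>i v. f i v r) \<in> rep_hom G \<Lambda> M (N r)"
        using rep_hom_compose[OF assms(1) D assms(2)[OF r] fg(1) rep_dsum_component[OF assms(2) r]] .
    next
      fix i v assume v: "v \<in> carrier (space M i)" "\<forall>r\<in>J. f i v r = \<zero>\<^bsub>space (N r) i\<^esub>"
      have "f i v = \<zero>\<^bsub>space ?D i\<^esub>"
        using fl[OF v(1)] v(2)
        by (auto simp: space_rep_dsum dsum_def PiE_iff extensional_def fun_eq_iff restrict_def)
      then show "v = \<zero>\<^bsub>space M i\<^esub>"
        using fg(3)[OF v(1)] g0 by simp
    qed
    then show "annihilates G \<Lambda> S M"
      using annihilates_joint_inj[OF assms(1) _ assms(4)] * by blast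
  next
    assume *: "annihilates G \<Lambda> S M"
    show "\<forall>r\<in>J. annihilates G \<Lambda> S (N r)"
    proof
      fix r assume r: "r \<in> J"
      \<comment> \<open>The components of the inclusion of the summand \<open>r\<close>: the
        identity for \<open>q = r\<close> and zero otherwise.\<close>
      define \<iota> where "\<iota> q i v = (if q = r then v else \<zero>\<^bsub>space (N q) i\<^esub>)" for q i v
      have "\<iota> q \<in> rep_hom G \<Lambda> (N r) (N q)" if "q \<in> J" for q
        using rep_hom_id[OF assms(2)[OF r]] rep_hom_zero[OF assms(2)[OF r] assms(2)[OF that]]
        by (cases "q = r") (simp_all add: \<iota>_def[abs_def])
      note h = rep_dsum_hom[OF assms(2) assms(2)[OF r] this]
      have "joint_inj {()} (N r) (\<lambda>_. M) (\<lambda>_ i v. g i (\<lambda>q\<in>J. \<iota> q i v))"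
        unfolding joint_inj_def
      proof (intro conjI ballI allI impI)
        show "(\<lambda>i v. g i (\<lambda>q\<in>J. \<iota> q i v)) \<in> rep_hom G \<Lambda> (N r) M"
          using rep_hom_compose[OF assms(2)[OF r] D assms(1) h fg(2)] .
        fix i v assume v: "v \<in> carrier (space (N r) i)" "\<forall>s\<in>{()}. g i (\<lambda>q\<in>J. \<iota> q i v) = \<zero>\<^bsub>space M i\<^esub>"
        have "(\<lambda>q\<in>J. \<iota> q i v) \<in> carrier (space ?D i)"
          using left_linearD(1)[OF rep_homD(1)[OF h] v(1)] .
        then have "(\<lambda>q\<in>J. \<iota> q i v) = \<zero>\<^bsub>space ?D i\<^esub>"
          using fg(4) v(2) f0 by fastforce
        from fun_cong[OF this, of r] show "v = \<zero>\<^bsub>space (N r) i\<^esub>"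
          using r by (simp add: \<iota>_def space_rep_dsum dsum_def)
      qed (rule assms(1))
      then show "annihilates G \<Lambda> S (N r)"
        by (rule annihilates_joint_inj[OF assms(2)[OF r] _ assms(4)]) (rule *)
    qed
  qed
qed

lemma annihilates_rep_iso:
  assumes "wrep G \<Lambda> M" "wrep G \<Lambda> N" "rep_iso G \<Lambda> M N" "admissible \<Lambda> S" "annihilates G \<Lambda> S N"
  shows "annihilates G \<Lambda> S M"
proof -
  obtain f g where fg: "f \<in> rep_hom G \<Lambda> M N" "g \<in> rep_hom G \<Lambda> N M"
    "\<And>i v. v \<in> carrier (space M i) \<Longrightarrow> g i (f i v) = v" "\<And>i v. v \<in> carrier (space N i) \<Longrightarrow> f i (g i v) = v"
    using rep_isoE[OF assms(1-3)] by blast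
  have g0: "g i \<zero>\<^bsub>space N i\<^esub> = \<zero>\<^bsub>space M i\<^esub>" for i
    using left_linear_zero[OF rep_homD(1)[OF fg(2)] wrepD(1)[OF assms(2)] wrepD(1)[OF assms(1)]] .
  have "joint_inj {()} M (\<lambda>_. N) (\<lambda>_. f)"
    unfolding joint_inj_def
  proof (intro conjI ballI allI impI)
    fix i v assume v: "v \<in> carrier (space M i)" "\<forall>r\<in>{()}. f i v = \<zero>\<^bsub>space N i\<^esub>"
    then have "g i (f i v) = \<zero>\<^bsub>space M i\<^esub>"
      using g0 by simp
    then show "v = \<zero>\<^bsub>space M i\<^esub>"
      using fg(3)[OF v(1)] by simp
  qed (use assms(2) fg(1) in auto)
  then show ?thesis
    by (rule annihilates_joint_inj[OF assms(1) _ assms(4)]) (rule assms(5))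
qed

lemma annihilates_rep_pow:
  assumes "wrep G \<Lambda> M" "m > 0" "admissible \<Lambda> S"
  shows "annihilates G \<Lambda> S (rep_pow G m M) \<longleftrightarrow> annihilates G \<Lambda> S M" "wrep G \<Lambda> (rep_pow G m M)"
proof -
  show w: "wrep G \<Lambda> (rep_pow G m M)"
    unfolding rep_pow_def by (rule wrep_rep_dsum) (rule assms(1))
  have "rep_iso G \<Lambda> (rep_pow G m M) (rep_pow G m M)"
    by (rule rep_isoI[OF rep_hom_id[OF w] rep_hom_id[OF w]]) auto
  then show "annihilates G \<Lambda> S (rep_pow G m M) \<longleftrightarrow> annihilates G \<Lambda> S M"
    using annihilates_rep_dsum[OF w, of "{..<m}" "\<lambda>_. M"] assms by (auto simp: rep_pow_def)
qed

end

section \<open>Idempotents and direct decompositions\<close>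

context oriented_graph
begin

lemma act_add:
  assumes "wrep G \<Lambda> M" "(i, j) \<in> \<Lambda>" "b \<in> carrier (bimod G j i)" "u \<in> carrier (space M i)" "v \<in> carrier (space M i)"
  shows "act G M i j b (u \<oplus>\<^bsub>space M i\<^esub> v) = act G M i j b u \<oplus>\<^bsub>space M j\<^esub> act G M i j b v"
proof -
  interpret T: tensor_product "dring G j" "dring G i" "bimod G j i" "space M i"
    using tensor_product[OF arrow_val(2)[OF assms(2)] wrepD(1)[OF assms(1)]] .
  show ?thesis
    unfolding T.tau_add_right[OF assms(3-5)]
    by (rule left_linearD(2)[OF wrepD(2)[OF assms(1,2)] T.tau_closed[OF assms(3,4)] T.tau_closed[OF assms(3,5)]])
qed

lemma rep_hom_complement:
  assumes M: "wrep G \<Lambda> M" and e: "e \<in> rep_hom G \<Lambda> M M"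
  shows "(\<lambda>i v. v \<oplus>\<^bsub>space M i\<^esub> \<ominus>\<^bsub>space M i\<^esub> e i v) \<in> rep_hom G \<Lambda> M M"
proof (rule rep_homI[OF M M])
  note lin = left_linearD[OF rep_homD(1)[OF e]]
  {
    fix i
    interpret V: left_module "dring G i" "space M i" using wrepD(1)[OF M] .
    show "(\<lambda>v. v \<oplus>\<^bsub>space M i\<^esub> \<ominus>\<^bsub>space M i\<^esub> e i v) \<in> left_linear (dring G i) (space M i) (space M i)"
      by (rule left_linearI)
        (simp_all add: lin V.minus_add V.M.a_ac V.smult_r_distr V.smult_minus V.smult_closed)
  next
    fix i j b v assume *: "(i, j) \<in> \<Lambda>" "b \<in> carrier (bimod G j i)" "v \<in> carrier (space M i)"
    interpret V: left_module "dring G i" "space M i" using wrepD(1)[OF M] .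
    interpret W: left_module "dring G j" "space M j" using wrepD(1)[OF M] .
    have ev: "e i v \<in> carrier (space M i)" using lin(1) * by blast
    have c: "v \<oplus>\<^bsub>space M i\<^esub> \<ominus>\<^bsub>space M i\<^esub> e i v \<in> carrier (space M i)"
      using ev * by simp
    have "act G M i j b (v \<oplus>\<^bsub>space M i\<^esub> \<ominus>\<^bsub>space M i\<^esub> e i v) \<oplus>\<^bsub>space M j\<^esub> act G M i j b (e i v) = act G M i j b v"
      using act_add[OF M *(1,2) c ev] ev * by (simp add: V.M.a_assoc V.M.l_neg)
    then have "act G M i j b v \<oplus>\<^bsub>space M j\<^esub> \<ominus>\<^bsub>space M j\<^esub> act G M i j b (e i v) =
        act G M i j b (v \<oplus>\<^bsub>space M i\<^esub> \<ominus>\<^bsub>space M i\<^esub> e i v)"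
      using act_closed[OF M *(1,2) c] act_closed[OF M *(1,2) ev] by (metis W.M.a_assoc W.M.r_neg W.M.r_zero W.M.a_inv_closed)
    then show "act G M i j b v \<oplus>\<^bsub>space M j\<^esub> \<ominus>\<^bsub>space M j\<^esub> e j (act G M i j b v) =
        act G M i j b (v \<oplus>\<^bsub>space M i\<^esub> \<ominus>\<^bsub>space M i\<^esub> e i v)"
      using rep_hom_act[OF M M e *] by simp
  }
qed

lemma subrep_image_hom:
  assumes "is_rep G \<Lambda> M" "p \<in> rep_hom G \<Lambda> M M"
  shows "p \<in> rep_hom G \<Lambda> M (subrep G M (\<lambda>i. p i ` carrier (space M i)))"
proof (rule rep_homI[OF is_rep_wrep[OF assms(1)] is_rep_wrep[OF subrep_image(1)[OF assms]]])
  show "p i \<in> left_linear (dring G i) (space M i) (space (subrep G M (\<lambda>i. p i ` carrier (space M i))) i)" for i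
    using left_linearD[OF rep_homD(1)[OF assms(2)]] by (intro left_linearI) (auto simp: subrep_def)
  fix i j b v assume *: "(i, j) \<in> \<Lambda>" "b \<in> carrier (bimod G j i)" "v \<in> carrier (space M i)"
  show "p j (act G M i j b v) = act G (subrep G M (\<lambda>i. p i ` carrier (space M i))) i j b (p i v)"
    using rep_hom_act[OF is_rep_wrep[OF assms(1)] is_rep_wrep[OF assms(1)] assms(2) *]
      subrep_image(2)[OF assms *(1,2), of "p i v"] *(3) by simp
qed

text \<open>An idempotent \<open>e\<close> splits \<open>M\<close> into the images of
  \<open>e\<close> and of 1 - e. Both are realised as subrepresentations, so their elements have the
  type that \<open>indecomposable\<close> prescribes for the summands.\<close>

lemma indecomposable_idem_indec:
  assumes "is_rep G \<Lambda> M" "indecomposable G \<Lambda> M"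
  shows "idem_indec G \<Lambda> M"
  unfolding idem_indec_def
proof (intro conjI ballI impI)
  show "\<not> rep_is_zero M" using assms(2) by (simp add: indecomposable_def)
  fix e assume e: "e \<in> rep_hom G \<Lambda> M M" and "\<forall>i. \<forall>v\<in>carrier (space M i). e i (e i v) = e i v"
  then have ee: "e i (e i v) = e i v" if "v \<in> carrier (space M i)" for i v
    using that by blast
  have M: "wrep G \<Lambda> M" using assms(1) by (rule is_rep_wrep)
  define p where "p = (\<lambda>i v. v \<oplus>\<^bsub>space M i\<^esub> \<ominus>\<^bsub>space M i\<^esub> e i v)"
  have p: "p \<in> rep_hom G \<Lambda> M M"
    unfolding p_def by (rule rep_hom_complement[OF M e])
  define P where "P r = (if r = 0 then e else p)" for r :: nat
  have P: "P r \<in> rep_hom G \<Lambda> M M" for r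
    using e p by (simp add: P_def)
  define N where "N r = subrep G M (\<lambda>i. P r i ` carrier (space M i))" for r
  have N: "is_rep G \<Lambda> (N r)" for r
    unfolding N_def by (rule subrep_image(1)[OF assms(1) P])
  have PN: "P r \<in> rep_hom G \<Lambda> M (N r)" for r
    unfolding N_def by (rule subrep_image_hom[OF assms(1) P])
  let ?D = "rep_dsum G {0, 1} N"
  define \<Phi> where "\<Phi> = (\<lambda>i v. \<lambda>r\<in>{0, 1}. P r i v)"
  have \<Phi>: "\<Phi> \<in> rep_hom G \<Lambda> M ?D"
    unfolding \<Phi>_def by (rule rep_dsum_hom[OF is_rep_wrep[OF N] M PN])
  have "bij_betw (\<Phi> i) (carrier (space M i)) (carrier (space ?D i))" for i
  \<comment> \<open>The inverse adds the two components inside \<open>M\<close>. Both composites are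
    identities because e + p = 1 and e p = p e = 0.\<close>
  proof (rule bij_betwI[where g = "\<lambda>u. u 0 \<oplus>\<^bsub>space M i\<^esub> u 1"])
    interpret V: left_module "dring G i" "space M i" using wrepD(1)[OF M] .
    note el = left_linearD[OF rep_homD(1)[OF e]] and pl = left_linearD[OF rep_homD(1)[OF p]]
    have em: "e i (\<ominus>\<^bsub>space M i\<^esub> v) = \<ominus>\<^bsub>space M i\<^esub> e i v" if "v \<in> carrier (space M i)" for v
      using left_linear_minus[OF rep_homD(1)[OF e] V.left_module_axioms V.left_module_axioms that] .
    have ep: "e i (p i v) = \<zero>\<^bsub>space M i\<^esub>" and pe: "p i (e i v) = \<zero>\<^bsub>space M i\<^esub>" if "v \<in> carrier (space M i)" for v
      using that el by (simp_all add: p_def em ee V.M.r_neg)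
    have pp: "p i (p i v) = p i v" if "v \<in> carrier (space M i)" for v
    proof -
      have "p i (p i v) = p i v \<oplus>\<^bsub>space M i\<^esub> \<ominus>\<^bsub>space M i\<^esub> e i (p i v)"
        by (simp add: p_def)
      then show ?thesis
        using that pl(1) by (simp add: ep V.minus_zero_eq)
    qed
    have D: "u \<in> carrier (space ?D i) \<longleftrightarrow> u \<in> (\<Pi>\<^sub>E r\<in>{0, 1}. P r i ` carrier (space M i))" for u
      by (simp add: space_rep_dsum dsum_def N_def subrep_def)
    show "\<Phi> i \<in> carrier (space M i) \<rightarrow> carrier (space ?D i)"
      using left_linearD(1)[OF rep_homD(1)[OF \<Phi>]] by auto
    show "(\<lambda>u. u 0 \<oplus>\<^bsub>space M i\<^esub> u 1) \<in> carrier (space ?D i) \<rightarrow> carrier (space M i)"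
    proof (rule funcsetI)
      fix u assume "u \<in> carrier (space ?D i)"
      then obtain a b where "a \<in> carrier (space M i)" "b \<in> carrier (space M i)" "u 0 = e i a" "u 1 = p i b"
        unfolding D by (auto simp: PiE_iff P_def)
      then show "u 0 \<oplus>\<^bsub>space M i\<^esub> u 1 \<in> carrier (space M i)"
        using el(1) pl(1) by simp
    qed
    show "\<Phi> i v 0 \<oplus>\<^bsub>space M i\<^esub> \<Phi> i v 1 = v" if v: "v \<in> carrier (space M i)" for v
    proof -
      have "e i v \<oplus>\<^bsub>space M i\<^esub> (v \<oplus>\<^bsub>space M i\<^esub> \<ominus>\<^bsub>space M i\<^esub> e i v) = v"
        using v el(1) by (simp add: V.M.a_lcomm V.M.r_neg)
      then show ?thesis
        by (simp add: \<Phi>_def P_def p_def)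
    qed
    show "\<Phi> i (u 0 \<oplus>\<^bsub>space M i\<^esub> u 1) = u" if u: "u \<in> carrier (space ?D i)" for u
    proof -
      obtain a b where ab: "a \<in> carrier (space M i)" "b \<in> carrier (space M i)" "u 0 = e i a" "u 1 = p i b"
        using u unfolding D by (auto simp: PiE_iff P_def)
      have "e i (u 0 \<oplus>\<^bsub>space M i\<^esub> u 1) = u 0" "p i (u 0 \<oplus>\<^bsub>space M i\<^esub> u 1) = u 1"
        using ab el pl by (simp_all add: ee ep pe pp)
      then show ?thesis
        using u unfolding D by (auto simp: \<Phi>_def P_def PiE_iff extensional_def fun_eq_iff)
    qed
  qed
  with \<Phi> have "rep_iso G \<Lambda> M ?D"
    unfolding rep_iso_def by blast
  then have "rep_is_zero (N 0) \<or> rep_is_zero (N 1)"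
    using assms(2) N unfolding indecomposable_def by blast
  then show "(\<forall>i. \<forall>v\<in>carrier (space M i). e i v = \<zero>\<^bsub>space M i\<^esub>) \<or> (\<forall>i. \<forall>v\<in>carrier (space M i). e i v = v)"
  proof
    assume "rep_is_zero (N 0)"
    then have "e i ` carrier (space M i) = {\<zero>\<^bsub>space M i\<^esub>}" for i
      by (simp add: rep_is_zero_def N_def subrep_def P_def)
    then show ?thesis by blast
  next
    assume "rep_is_zero (N 1)"
    then have p0: "p i ` carrier (space M i) = {\<zero>\<^bsub>space M i\<^esub>}" for i
      by (simp add: rep_is_zero_def N_def subrep_def P_def)
    have "e i v = v" if v: "v \<in> carrier (space M i)" for i v
    proof -
      interpret V: left_module "dring G i" "space M i" using wrepD(1)[OF M] .
      have ev: "e i v \<in> carrier (space M i)"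
        using left_linearD(1)[OF rep_homD(1)[OF e] v] .
      have "v \<oplus>\<^bsub>space M i\<^esub> \<ominus>\<^bsub>space M i\<^esub> e i v = \<zero>\<^bsub>space M i\<^esub>"
        using p0[of i] v unfolding p_def by blast
      then have "(v \<oplus>\<^bsub>space M i\<^esub> \<ominus>\<^bsub>space M i\<^esub> e i v) \<oplus>\<^bsub>space M i\<^esub> e i v = e i v"
        using ev by simp
      then show ?thesis
        using v ev by (simp add: V.M.a_assoc V.M.l_neg)
    qed
    then show ?thesis by blast
  qed
qed

text \<open>An idempotent of \<open>N\<close> is conjugated into one of \<open>M\<close>. This moves
  the condition to the copy made by \<open>rep_atom\<close>, on which the reflections act.\<close>

lemma idem_indec_rep_iso:
  assumes M: "wrep G \<Lambda> M" and N: "wrep G \<Lambda> N" and "rep_iso G \<Lambda> M N" "idem_indec G \<Lambda> M"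
  shows "idem_indec G \<Lambda> N"
proof -
  obtain f g where fg: "f \<in> rep_hom G \<Lambda> M N" "g \<in> rep_hom G \<Lambda> N M"
    "\<And>i v. v \<in> carrier (space M i) \<Longrightarrow> g i (f i v) = v" "\<And>i v. v \<in> carrier (space N i) \<Longrightarrow> f i (g i v) = v"
    using rep_isoE[OF assms(1-3)] by blast
  note fl = left_linearD(1)[OF rep_homD(1)[OF fg(1)]] and gl = left_linearD(1)[OF rep_homD(1)[OF fg(2)]]
  have f0: "f i \<zero>\<^bsub>space M i\<^esub> = \<zero>\<^bsub>space N i\<^esub>" and g0: "g i \<zero>\<^bsub>space N i\<^esub> = \<zero>\<^bsub>space M i\<^esub>" for i
    using left_linear_zero[OF rep_homD(1)[OF fg(1)] wrepD(1)[OF M] wrepD(1)[OF N]]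
      left_linear_zero[OF rep_homD(1)[OF fg(2)] wrepD(1)[OF N] wrepD(1)[OF M]] by auto
  show ?thesis
    unfolding idem_indec_def
  proof (intro conjI ballI impI notI)
    assume z: "rep_is_zero N"
    have "carrier (space M i) = {\<zero>\<^bsub>space M i\<^esub>}" for i
    proof -
      interpret V: left_module "dring G i" "space M i" using wrepD(1)[OF M] .
      have "v = \<zero>\<^bsub>space M i\<^esub>" if v: "v \<in> carrier (space M i)" for v
      proof -
        have "f i v = \<zero>\<^bsub>space N i\<^esub>"
          using fl[OF v] z unfolding rep_is_zero_def by blast
        then show ?thesis using fg(3)[OF v] g0 by simp
      qed
      then show ?thesis by auto
    qed
    then show False using assms(4) by (simp add: idem_indec_def rep_is_zero_def)
  next
    fix e assume e: "e \<in> rep_hom G \<Lambda> N N" "\<forall>i. \<forall>v\<in>carrier (space N i). e i (e i v) = e i v"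
    note el = left_linearD(1)[OF rep_homD(1)[OF e(1)]]
    have h: "(\<lambda>i v. g i (e i (f i v))) \<in> rep_hom G \<Lambda> M M"
      using rep_hom_compose[OF M N M rep_hom_compose[OF M N N fg(1) e(1)] fg(2)] .
    have "g i (e i (f i (g i (e i (f i v))))) = g i (e i (f i v))" if v: "v \<in> carrier (space M i)" for i v
      using fg(4)[OF el[OF fl[OF v]]] e(2) fl[OF v] by simp
    then consider "\<forall>i. \<forall>v\<in>carrier (space M i). g i (e i (f i v)) = \<zero>\<^bsub>space M i\<^esub>"
      | "\<forall>i. \<forall>v\<in>carrier (space M i). g i (e i (f i v)) = v"
      using idem_indecD[OF assms(4) h] by blast
    then show "(\<forall>i. \<forall>v\<in>carrier (space N i). e i v = \<zero>\<^bsub>space N i\<^esub>) \<or> (\<forall>i. \<forall>v\<in>carrier (space N i). e i v = v)"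
    proof cases
      case 1
      have "e i v = \<zero>\<^bsub>space N i\<^esub>" if v: "v \<in> carrier (space N i)" for i v
      proof -
        have "g i (e i (f i (g i v))) = \<zero>\<^bsub>space M i\<^esub>" using 1 gl[OF v] by blast
        then have "g i (e i v) = \<zero>\<^bsub>space M i\<^esub>" using fg(4)[OF v] by simp
        then show ?thesis using fg(4)[OF el[OF v]] f0 by metis
      qed
      then show ?thesis by blast
    next
      case 2
      have "e i v = v" if v: "v \<in> carrier (space N i)" for i v
      proof -
        have "g i (e i (f i (g i v))) = g i v" using 2 gl[OF v] by blast
        then have "g i (e i v) = g i v" using fg(4)[OF v] by simp
        then show ?thesis using fg(4)[OF el[OF v]] fg(4)[OF v] by metis
      qed
      then show ?thesis by blast
    qed
  qed
qed

lemma is_join_iff: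
  assumes "\<And>T. T \<in> \<C> \<Longrightarrow> admissible \<Lambda> T"
  shows "is_join G \<Lambda> S \<C> \<longleftrightarrow> admissible \<Lambda> S \<and> (\<forall>T\<in>\<C>. count_list T \<le> count_list S) \<and>
    (\<forall>U. admissible \<Lambda> U \<and> (\<forall>T\<in>\<C>. count_list T \<le> count_list U) \<longrightarrow> count_list S \<le> count_list U)"
  unfolding is_join_def least_def Upper_def seq_order_def
  using assms by (auto simp: seq_le_iff[OF orient])

end

lemma wrep_reflect_seq:
  assumes "oriented_graph G \<Lambda>" "wrep G \<Lambda> M" "admissible \<Lambda> S"
  shows "wrep G (reverse_seq S \<Lambda>) (reflect_seq G \<Lambda> S M) \<and> oriented_graph G (reverse_seq S \<Lambda>)"
  using assms
proof (induction S arbitrary: \<Lambda> M)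
  case (Cons x S)
  then have "sink \<Lambda> x" "admissible (reverse_at x \<Lambda>) S"
    by auto
  then show ?case
    using Cons.IH[OF oriented_graph.oriented_graph_reverse[OF Cons.prems(1)]
      oriented_graph.wrep_reflect[OF Cons.prems(1,2)]] by simp
qed simp

section \<open>Shortest annihilating sequences\<close>

locale acyclic_quiver = oriented_graph +
  assumes acyc: "acyclic \<Lambda>"
begin

text \<open>\<open>T\<close> is equivalent to a continuation of \<open>S\<close>, and a zero
  representation stays zero under further reflections. The latter is joint injectivity of the empty
  family.\<close>

lemma annihilates_mono:
  assumes "wrep G \<Lambda> M" "admissible \<Lambda> S" "admissible \<Lambda> T" "count_list S \<le> count_list T" "annihilates G \<Lambda> S M"
  shows "annihilates G \<Lambda> T M"
proof -
  obtain U where U: "admissible (reverse_seq S \<Lambda>) U" "seq_equiv G \<Lambda> T (S @ U)"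
    using count_le_imp_seq_le[OF orient assms(2-4)] by (auto simp: seq_le_def)
  let ?M = "reflect_seq G \<Lambda> S (rep_atom G M)"
  have z: "rep_is_zero ?M" using assms(5) by (simp add: annihilates_def)
  note w = wrep_reflect_seq[OF oriented_graph_axioms rep_atom(1)[OF assms(1)] assms(2)]
  \<comment> \<open>The family is empty, so joint injectivity says exactly that the reflected
    representation is zero. The index type, targets and maps given here are arbitrary.\<close>
  have "oriented_graph.joint_inj G (reverse_seq S \<Lambda>) {} ?M (\<lambda>_::unit. ?M) (\<lambda>_ _ v. v)"
    using z w by (auto simp: oriented_graph.joint_inj_def rep_is_zero_def)
  from reflect_seq_zero_joint_inj[OF conjunct2[OF w] conjunct1[OF w] U(1) this]
  have "rep_is_zero (reflect_seq G \<Lambda> (S @ U) (rep_atom G M))"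
    by (simp add: reflect_seq_append)
  then show ?thesis
    using rep_is_zero_seq_equiv[OF orient U(2), of "rep_atom G M"] by (simp add: annihilates_def)
qed

text \<open>The annihilating sequences are those above a least one, \<open>U\<close>. A shortest
  sequence lies above \<open>U\<close> and has no proper annihilating subsequence, so it has the
  multiplicities of \<open>U\<close>.\<close>

lemma shortest_annihilating_iff:
  assumes "wrep G \<Lambda> M" "preprojective G \<Lambda> M"
  obtains U where "admissible \<Lambda> U" "\<And>T. admissible \<Lambda> T \<Longrightarrow> annihilates G \<Lambda> T M \<longleftrightarrow> count_list U \<le> count_list T"
    "\<And>S. shortest_annihilating G \<Lambda> S M \<longleftrightarrow> admissible \<Lambda> S \<and> count_list S = count_list U"
proof -
  obtain S where "admissible \<Lambda> S" "annihilates G \<Lambda> S M"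
    using assms(2) by (auto simp: preprojective_def)
  then obtain U where U: "admissible \<Lambda> U" "annihilates G \<Lambda> U M"
    "\<And>T. admissible \<Lambda> T \<Longrightarrow> annihilates G \<Lambda> T M \<Longrightarrow> count_list U \<le> count_list T"
    unfolding annihilates_def using annihilating_least[OF orient acyc] by metis
  then have 1: "annihilates G \<Lambda> T M \<longleftrightarrow> count_list U \<le> count_list T" if "admissible \<Lambda> T" for T
    using annihilates_mono[OF assms(1) U(1) that _ U(2)] that by blast
  have 2: "shortest_annihilating G \<Lambda> S M \<longleftrightarrow> admissible \<Lambda> S \<and> count_list S = count_list U" for S
    unfolding shortest_annihilating_def seq_le_iff[OF orient] seq_equiv_iff[OF orient] using 1 U(1)
    by (metis order.antisym order.refl)
  from that[OF U(1) 1 2] show thesis .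
qed

lemma shortest_seq:
  assumes "wrep G \<Lambda> M" "preprojective G \<Lambda> M"
  shows "shortest_annihilating G \<Lambda> S M \<longleftrightarrow> seq_equiv G \<Lambda> S (shortest_seq G \<Lambda> M)"
    "admissible \<Lambda> (shortest_seq G \<Lambda> M)"
    "admissible \<Lambda> T \<Longrightarrow> annihilates G \<Lambda> T M \<longleftrightarrow> count_list (shortest_seq G \<Lambda> M) \<le> count_list T"
proof -
  obtain U where U: "admissible \<Lambda> U" "\<And>T. admissible \<Lambda> T \<Longrightarrow> annihilates G \<Lambda> T M \<longleftrightarrow> count_list U \<le> count_list T"
    "\<And>S. shortest_annihilating G \<Lambda> S M \<longleftrightarrow> admissible \<Lambda> S \<and> count_list S = count_list U"
    using shortest_annihilating_iff[OF assms] by blast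
  have "shortest_annihilating G \<Lambda> (shortest_seq G \<Lambda> M) M"
    unfolding shortest_seq_def by (rule someI[of _ U]) (simp add: U)
  then have s: "admissible \<Lambda> (shortest_seq G \<Lambda> M)" "count_list (shortest_seq G \<Lambda> M) = count_list U"
    using U(3) by auto
  show "shortest_annihilating G \<Lambda> S M \<longleftrightarrow> seq_equiv G \<Lambda> S (shortest_seq G \<Lambda> M)"
    using U(3) s by (simp add: seq_equiv_iff[OF orient])
  show "admissible \<Lambda> (shortest_seq G \<Lambda> M)" by (rule s(1))
  show "admissible \<Lambda> T \<Longrightarrow> annihilates G \<Lambda> T M \<longleftrightarrow> count_list (shortest_seq G \<Lambda> M) \<le> count_list T"
    using U(2) s(2) by simp
qed

text \<open>A sequence annihilates \<open>M\<close> iff it lies above the shortest sequences of all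
  \<open>N r\<close>, and also iff it lies above that of \<open>M\<close>. So the shortest sequence
  of \<open>M\<close> is the least upper bound, and the existence of the join is obtained on the
  way.\<close>

lemma shortest_seq_join:
  assumes "wrep G \<Lambda> M" "preprojective G \<Lambda> M" "\<And>r. r \<in> J \<Longrightarrow> wrep G \<Lambda> (N r)"
    and ann: "\<And>S. admissible \<Lambda> S \<Longrightarrow> annihilates G \<Lambda> S M \<longleftrightarrow> (\<forall>r\<in>J. annihilates G \<Lambda> S (N r))"
  shows "\<forall>r\<in>J. preprojective G \<Lambda> (N r)"
    "is_join G \<Lambda> (shortest_seq G \<Lambda> M) ((\<lambda>r. shortest_seq G \<Lambda> (N r)) ` J)"
proof -
  show pre: "\<forall>r\<in>J. preprojective G \<Lambda> (N r)"
    using assms(2) ann unfolding preprojective_def by blast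
  note sM = shortest_seq[OF assms(1,2)] and sN = shortest_seq[OF assms(3) pre[rule_format]]
  have "(\<forall>r\<in>J. count_list (shortest_seq G \<Lambda> (N r)) \<le> count_list T) \<longleftrightarrow> count_list (shortest_seq G \<Lambda> M) \<le> count_list T"
    if "admissible \<Lambda> T" for T
    using ann[OF that] sM(3)[OF that] sN(3)[OF _ _ that] by blast
  then show "is_join G \<Lambda> (shortest_seq G \<Lambda> M) ((\<lambda>r. shortest_seq G \<Lambda> (N r)) ` J)"
    using sM(2) sN(2) by (subst is_join_iff) auto
qed

lemma annihilates_rep_iso_iff:
  assumes "wrep G \<Lambda> M" "wrep G \<Lambda> N" "rep_iso G \<Lambda> M N" "admissible \<Lambda> S"
  shows "annihilates G \<Lambda> S M \<longleftrightarrow> annihilates G \<Lambda> S N"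
  using annihilates_rep_iso[OF assms] annihilates_rep_iso[OF assms(2,1) rep_iso_sym[OF assms(1-3)] assms(4)] by blast

lemma rep_iso_iff_shortest_seq_equiv:
  assumes M: "is_rep G \<Lambda> M" "indecomposable G \<Lambda> M" "preprojective G \<Lambda> M"
    and N: "is_rep G \<Lambda> N" "indecomposable G \<Lambda> N" "preprojective G \<Lambda> N"
  shows "seq_equiv G \<Lambda> (shortest_seq G \<Lambda> N) (shortest_seq G \<Lambda> M) \<longleftrightarrow> rep_iso G \<Lambda> N M"
proof -
  note wM = is_rep_wrep[OF M(1)] and wN = is_rep_wrep[OF N(1)]
  note sM = shortest_seq[OF wM M(3)] and sN = shortest_seq[OF wN N(3)]
  note aM = rep_atom(1)[OF wM] and aN = rep_atom(1)[OF wN]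
  have iff: "seq_equiv G \<Lambda> (shortest_seq G \<Lambda> N) (shortest_seq G \<Lambda> M) \<longleftrightarrow>
      count_list (shortest_seq G \<Lambda> N) = count_list (shortest_seq G \<Lambda> M)"
    using sM(2) sN(2) by (simp add: seq_equiv_iff[OF orient])
  show ?thesis
    unfolding iff
  proof
    assume eq: "count_list (shortest_seq G \<Lambda> N) = count_list (shortest_seq G \<Lambda> M)"
    \<comment> \<open>Reflections act on the copies made by \<open>rep_atom\<close>, so the
      reconstruction is carried out there. The isomorphisms with the originals bring
      indecomposability in and the result back.\<close>
    have "rep_iso G \<Lambda> (rep_atom G N) (rep_atom G M)"
    proof (rule rep_iso_of_least_annihilating[OF oriented_graph_axioms aN aM _ _ sM(2)])
      show "idem_indec G \<Lambda> (rep_atom G N)" "idem_indec G \<Lambda> (rep_atom G M)"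
        using idem_indec_rep_iso[OF wN aN rep_iso_atom[OF wN] indecomposable_idem_indec[OF N(1,2)]]
          idem_indec_rep_iso[OF wM aM rep_iso_atom[OF wM] indecomposable_idem_indec[OF M(1,2)]] .
    qed (use sM(2) sM(3) sN(3) eq in \<open>simp_all flip: annihilates_def\<close>)
    then show "rep_iso G \<Lambda> N M"
      using rep_iso_trans[OF wN aN wM rep_iso_atom[OF wN] rep_iso_trans[OF aN aM wM _ rep_iso_sym[OF wM aM rep_iso_atom[OF wM]]]]
      by blast
  next
    assume "rep_iso G \<Lambda> N M"
    then have "annihilates G \<Lambda> T N \<longleftrightarrow> annihilates G \<Lambda> T M" if "admissible \<Lambda> T" for T
      using annihilates_rep_iso_iff[OF wN wM _ that] by blast
    then show "count_list (shortest_seq G \<Lambda> N) = count_list (shortest_seq G \<Lambda> M)"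
      using sM(2,3) sN(2,3) by (metis order.antisym order.refl)
  qed
qed

end

theorem theorem2p2:
  fixes G :: "('i::finite, 'k, 'b, 'c) modulation"
    and \<Lambda> :: "('i \<times> 'i) set"
    and M :: "('i, 'k, 'b, 'v) rep"
  assumes "valued_quiver G \<Lambda>"
    and "is_rep G \<Lambda> M"
    and "preprojective G \<Lambda> M"
  shows "
    (\<exists>S. shortest_annihilating G \<Lambda> S M \<and>
       (\<forall>T. shortest_annihilating G \<Lambda> T M \<longrightarrow> seq_equiv G \<Lambda> T S))
    \<and>
    ((\<forall>s. \<forall>N :: nat \<Rightarrow> ('i, 'k, 'b, 'w) rep.
       (\<forall>r<s. is_rep G \<Lambda> (N r)) \<and> rep_iso G \<Lambda> M (rep_dsum G {..<s} N) \<longrightarrow>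
         (\<forall>r<s. preprojective G \<Lambda> (N r)) \<and>
         is_join G \<Lambda> (shortest_seq G \<Lambda> M) ((\<lambda>r. shortest_seq G \<Lambda> (N r)) ` {..<s}))
     \<and>
     (\<forall>m>0. preprojective G \<Lambda> (rep_pow G m M) \<and>
        seq_equiv G \<Lambda> (shortest_seq G \<Lambda> (rep_pow G m M)) (shortest_seq G \<Lambda> M)))
    \<and>
    (\<forall>t m. \<forall>N :: nat \<Rightarrow> ('i, 'k, 'b, 'u) rep.
       (\<forall>r<t. is_rep G \<Lambda> (N r) \<and> indecomposable G \<Lambda> (N r) \<and> m r > 0) \<and>
       (\<forall>r<t. \<forall>q<t. r \<noteq> q \<longrightarrow> \<not> rep_iso G \<Lambda> (N r) (N q)) \<and>
       rep_iso G \<Lambda> M (rep_dsum G {..<t} (\<lambda>r. rep_pow G (m r) (N r))) \<longrightarrow>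
         (\<forall>r<t. preprojective G \<Lambda> (N r)) \<and>
         is_join G \<Lambda> (shortest_seq G \<Lambda> M) ((\<lambda>r. shortest_seq G \<Lambda> (N r)) ` {..<t}))
    \<and>
    (indecomposable G \<Lambda> M \<longrightarrow>
       (\<forall>N :: ('i, 'k, 'b, 'x) rep.
          is_rep G \<Lambda> N \<and> indecomposable G \<Lambda> N \<and> preprojective G \<Lambda> N \<longrightarrow>
            (seq_equiv G \<Lambda> (shortest_seq G \<Lambda> N) (shortest_seq G \<Lambda> M) \<longleftrightarrow> rep_iso G \<Lambda> N M)))"
proof -
  interpret acyclic_quiver G \<Lambda>
    using assms(1) by (simp add: valued_quiver_def acyclic_quiver_def acyclic_quiver_axioms_def
        oriented_graph_def oriented_graph_axioms_def)
  note wM = is_rep_wrep[OF assms(2)]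
  note sM = shortest_seq[OF wM assms(3)]
  show ?thesis
  proof (intro conjI allI impI)
    show "\<exists>S. shortest_annihilating G \<Lambda> S M \<and> (\<forall>T. shortest_annihilating G \<Lambda> T M \<longrightarrow> seq_equiv G \<Lambda> T S)"
      using sM(1) seq_equiv_refl[OF sM(2)] by blast
  next
    fix s and N :: "nat \<Rightarrow> ('i, 'k, 'b, 'w) rep"
    assume *: "(\<forall>r<s. is_rep G \<Lambda> (N r)) \<and> rep_iso G \<Lambda> M (rep_dsum G {..<s} N)"
    then have wN: "wrep G \<Lambda> (N r)" if "r \<in> {..<s}" for r
      using that by (simp add: is_rep_wrep)
    note join = shortest_seq_join[OF wM assms(3) wN annihilates_rep_dsum[OF wM wN conjunct2[OF *]]]
    show "preprojective G \<Lambda> (N r)" if "r < s" for r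
      using join(1) that by simp
    show "is_join G \<Lambda> (shortest_seq G \<Lambda> M) ((\<lambda>r. shortest_seq G \<Lambda> (N r)) ` {..<s})"
      by (rule join(2))
  next
    fix m :: nat assume m: "m > 0"
    note w = annihilates_rep_pow(2)[OF wM m sM(2)]
    show pre: "preprojective G \<Lambda> (rep_pow G m M)"
      using assms(3) annihilates_rep_pow(1)[OF wM m] unfolding preprojective_def by blast
    note s = shortest_seq[OF w pre]
    show "seq_equiv G \<Lambda> (shortest_seq G \<Lambda> (rep_pow G m M)) (shortest_seq G \<Lambda> M)"
      unfolding seq_equiv_iff[OF orient] using s(2,3) sM(2,3) annihilates_rep_pow(1)[OF wM m]
      by (metis order.antisym order.refl)
  next
    fix t and m :: "nat \<Rightarrow> nat" and N :: "nat \<Rightarrow> ('i, 'k, 'b, 'u) rep"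
    assume *: "(\<forall>r<t. is_rep G \<Lambda> (N r) \<and> indecomposable G \<Lambda> (N r) \<and> m r > 0) \<and>
       (\<forall>r<t. \<forall>q<t. r \<noteq> q \<longrightarrow> \<not> rep_iso G \<Lambda> (N r) (N q)) \<and>
       rep_iso G \<Lambda> M (rep_dsum G {..<t} (\<lambda>r. rep_pow G (m r) (N r)))"
    then have wN: "wrep G \<Lambda> (N r)" and m: "m r > 0" if "r \<in> {..<t}" for r
      using that by (simp_all add: is_rep_wrep)
    \<comment> \<open>The multiplicities drop out, since a positive power is annihilated by the same
      sequences as the representation itself.\<close>
    have "annihilates G \<Lambda> S M \<longleftrightarrow> (\<forall>r\<in>{..<t}. annihilates G \<Lambda> S (N r))" if S: "admissible \<Lambda> S" for S
      using annihilates_rep_dsum[OF wM annihilates_rep_pow(2)[OF wN m S] conjunct2[OF conjunct2[OF *]] S]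
        annihilates_rep_pow(1)[OF wN m S] by auto
    note join = shortest_seq_join[OF wM assms(3) wN this]
    show "preprojective G \<Lambda> (N r)" if "r < t" for r
      using join(1) that by simp
    show "is_join G \<Lambda> (shortest_seq G \<Lambda> M) ((\<lambda>r. shortest_seq G \<Lambda> (N r)) ` {..<t})"
      by (rule join(2))
  next
    fix N :: "('i, 'k, 'b, 'x) rep"
    assume M: "indecomposable G \<Lambda> M" and N: "is_rep G \<Lambda> N \<and> indecomposable G \<Lambda> N \<and> preprojective G \<Lambda> N"
    show "seq_equiv G \<Lambda> (shortest_seq G \<Lambda> N) (shortest_seq G \<Lambda> M) \<longleftrightarrow> rep_iso G \<Lambda> N M"
      using rep_iso_iff_shortest_seq_equiv[OF assms(2) M assms(3)] N by blast
  qed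
qed

end
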